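(* Let $G$ be a finite group acting freely and smoothly on a manifold $M$, and let $p:M\to M/G$ be the associated principal $G$-bundle in the category of manifolds. Suppose further that $M$ is simply connected. Then the smooth map $\widetilde{p}:\mathcal{P}_G^\infty(M)\to L^\infty(M/G)$, $\widetilde{p}((\gamma,g))=p\circ\gamma$, gives rise to a well-defined isomorphism $$\widetilde{p}^*:H_{DR}^*(L^\infty(M/G))\stackrel{\cong}{\longrightarrow}\mathbb{R}\,\Box_{\mathbb{R}[G]^\vee}H^*_{DR}(\mathcal{P}_G^\infty(M))$$ of algebras.
   Context: Everything is in the category $\mathsf{Diff}$ of diffeological spaces; manifolds carry the standard diffeology, subsets the subspace diffeology, $I=[0,1]\subset\mathbb{R}$ the subspace diffeology, and mapping spaces $C^\infty(X,Y)$ the functional diffeology (a map $U\to C^\infty(X,Y)$ is a plot iff its adjoint $U\times X\to Y$ is smooth). $L^\infty N$ is the diffeological subspace of $N^I=C^\infty(I,N)$ of smooth paths $\gamma$ with $\gamma(0)=\gamma(1)$ (the pullback of $(\varepsilon_0,\varepsilon_1):N^I\to N\times N$ along the diagonal). $\mathcal{P}^\infty_g(M)$ is the diffeological subspace of $M^I$ of smooth paths with $\gamma(1)=g\gamma(0)$, and $\mathcal{P}_G^\infty(M)=\coprod_{g\in G}(\mathcal{P}^\infty_g(M)\times\{g\})$ with $G$-action $h\cdot(\gamma,g)=(h\gamma,hgh^{-1})$. For a diffeological space $X$, $H^*_{DR}(X)=H^*(A_{DR}(S^D_\bullet(X)))$ is the singular de Rham cohomology. Here $S^D_n(X)$ is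 the set of smooth maps $\Delta^n_{st}\to X$, where $\Delta^n_{st}$ is the standard simplex with Kihara's diffeology: for $n\le1$ the subspace diffeology from $\mathbb{R}^{n+1}$; inductively for $n\ge2$ the final diffeology for the maps $\varphi_i:\Delta^{n-1}_{st}\times[0,1)\to\Delta^n$, $\varphi_i(x,t)=(1-t)v_i+t\,d^i(x)$ ($v_i$ the $i$-th vertex, $d^i$ the affine inclusion of the opposite face). $(A^*_{DR})_n$ is the usual de Rham algebra of $\mathbb{A}^n=\{x\in\mathbb{R}^{n+1}\mid\sum x_i=1\}$, and $A_{DR}(K)$ is the algebra of simplicial maps $K\to(A_{DR}^* )_\bullet$. For a finite group $G$ acting smoothly on $X$, $H^*_{DR}(X)$ is a left $\mathbb{R}[G]^\vee$-comodule with coaction $\nabla$ induced by the action, and $\mathbb{R}\,\Box_{\mathbb{R}[G]^\vee}H^*_{DR}(X)=\{x\mid\nabla(x)=1\otimes x\}$, a subalgebra of $H^*_{DR}(X)$. *)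

theory Defs
  imports
    "HOL-Analysis.Analysis"
    "HOL-Algebra.Group_Action"
    "HOL-Algebra.Module"
    "HOL-Algebra.QuotRing"
    "HOL-Homology.Simplices"
begin

section \<open>Smooth functions on open subsets of Euclidean space\<close>

text \<open>
  The space R^n is \<^const>\<open>Euclidean_space\<close> n, i.e. the sequences supported on the indices below n.
  A function is C^k on an open set if all its iterated partial derivatives up to order k exist
  and are continuous.
\<close>

primrec Ck_on :: "nat \<Rightarrow> nat \<Rightarrow> (nat \<Rightarrow> real) set \<Rightarrow> ((nat \<Rightarrow> real) \<Rightarrow> real) \<Rightarrow> bool" where
  "Ck_on n 0 U f \<longleftrightarrow> continuous_map (subtopology (Euclidean_space n) U) euclideanreal f"
| "Ck_on n (Suc k) U f \<longleftrightarrow>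
     continuous_map (subtopology (Euclidean_space n) U) euclideanreal f \<and>
     (\<forall>i<n. \<exists>g. Ck_on n k U g \<and>
        (\<forall>x\<in>U. ((\<lambda>t. f (x(i := t))) has_real_derivative g x) (at (x i))))"

definition Cinf_on :: "nat \<Rightarrow> (nat \<Rightarrow> real) set \<Rightarrow> ((nat \<Rightarrow> real) \<Rightarrow> real) \<Rightarrow> bool" where
  "Cinf_on n U f \<longleftrightarrow> openin (Euclidean_space n) U \<and> (\<forall>k. Ck_on n k U f)"


section \<open>Diffeological spaces\<close>

text \<open>
  A space is given by its underlying set and its plots: \<open>plot D n U p\<close> says that U is open in R^n
  and that the restriction of p to U is a plot; the values of p outside U are irrelevant.
  The axioms of a diffeology are not part of the type, but each construction below
  yields (or preserves) a diffeology.
\<close>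

datatype 'a diffsp =
  Diffsp (pts: "'a set") (plot: "nat \<Rightarrow> (nat \<Rightarrow> real) set \<Rightarrow> ((nat \<Rightarrow> real) \<Rightarrow> 'a) \<Rightarrow> bool")

definition smooth :: "'a diffsp \<Rightarrow> 'b diffsp \<Rightarrow> ('a \<Rightarrow> 'b) \<Rightarrow> bool" where
  "smooth D E f \<longleftrightarrow> f \<in> pts D \<rightarrow> pts E \<and> (\<forall>n U p. plot D n U p \<longrightarrow> plot E n U (f \<circ> p))"

definition euclid :: "nat \<Rightarrow> (nat \<Rightarrow> real) diffsp" where
  "euclid n = Diffsp (topspace (Euclidean_space n))
     (\<lambda>m U p. openin (Euclidean_space m) U \<and> p \<in> U \<rightarrow> topspace (Euclidean_space n) \<and>
        (\<forall>i<n. Cinf_on m U (\<lambda>u. p u i)))"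

definition real_line :: "real diffsp" where
  "real_line = Diffsp UNIV Cinf_on"

definition subspace_diff :: "'a diffsp \<Rightarrow> 'a set \<Rightarrow> 'a diffsp" where
  "subspace_diff D A = Diffsp (pts D \<inter> A) (\<lambda>n U p. plot D n U p \<and> p \<in> U \<rightarrow> A)"

definition prod_diff :: "'a diffsp \<Rightarrow> 'b diffsp \<Rightarrow> ('a \<times> 'b) diffsp" where
  "prod_diff D E = Diffsp (pts D \<times> pts E) (\<lambda>n U p. plot D n U (fst \<circ> p) \<and> plot E n U (snd \<circ> p))"

text \<open>Maps are represented extensionally, so that equal mappings are equal elements.\<close>

definition map_diff :: "'a diffsp \<Rightarrow> 'b diffsp \<Rightarrow> ('a \<Rightarrow> 'b) diffsp" where
  "map_diff D E =
     (let F = {f \<in> extensional (pts D). smooth D E f} in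
      Diffsp F (\<lambda>n U P. openin (Euclidean_space n) U \<and> P \<in> U \<rightarrow> F \<and>
        smooth (prod_diff (subspace_diff (euclid n) U) D) E (\<lambda>(u, x). P u x)))"

text \<open>The final diffeology on B for a family of maps \<open>f i : D i \<rightarrow> B\<close>, i in J.\<close>

definition final_diff ::
    "'b set \<Rightarrow> 'i set \<Rightarrow> ('i \<Rightarrow> 'a diffsp) \<Rightarrow> ('i \<Rightarrow> 'a \<Rightarrow> 'b) \<Rightarrow> 'b diffsp" where
  "final_diff B J D f = Diffsp B
     (\<lambda>n U p. openin (Euclidean_space n) U \<and> p \<in> U \<rightarrow> B \<and>
        (\<forall>u\<in>U. \<exists>W. openin (Euclidean_space n) W \<and> u \<in> W \<and> W \<subseteq> U \<and>
           ((\<exists>b. \<forall>w\<in>W. p w = b) \<or>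
            (\<exists>i\<in>J. \<exists>q. plot (D i) n W q \<and> (\<forall>w\<in>W. p w = f i (q w))))))"

definition coprod_diff :: "'i set \<Rightarrow> ('i \<Rightarrow> 'a diffsp) \<Rightarrow> ('a \<times> 'i) diffsp" where
  "coprod_diff J D = final_diff {(x, i). i \<in> J \<and> x \<in> pts (D i)} J D (\<lambda>i x. (x, i))"

abbreviation unit_interval :: "real diffsp" where
  "unit_interval \<equiv> subspace_diff real_line {0..1}"


section \<open>Manifolds\<close>

text \<open>A chart is a pair of its domain and its coordinate map; atlases need not be maximal.\<close>

type_synonym 'a chart = "'a set \<times> ('a \<Rightarrow> nat \<Rightarrow> real)"

definition smooth_manifold :: "nat \<Rightarrow> 'a topology \<Rightarrow> 'a chart set \<Rightarrow> bool" where
  "smooth_manifold n X \<A> \<longleftrightarrow>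
     Hausdorff_space X \<and> second_countable X \<and>
     \<Union>(fst ` \<A>) = topspace X \<and>
     (\<forall>(U, \<phi>)\<in>\<A>. openin X U \<and> openin (Euclidean_space n) (\<phi> ` U) \<and>
        homeomorphic_map (subtopology X U) (subtopology (Euclidean_space n) (\<phi> ` U)) \<phi>) \<and>
     (\<forall>(U, \<phi>)\<in>\<A>. \<forall>(V, \<psi>)\<in>\<A>. \<forall>i<n. Cinf_on n (\<phi> ` (U \<inter> V)) (\<lambda>u. \<psi> (inv_into U \<phi> u) i))"

text \<open>The standard diffeology: the plots are the smooth maps from open subsets of Euclidean spaces.\<close>

definition manifold_diff :: "'a set \<Rightarrow> 'a chart set \<Rightarrow> 'a diffsp" where
  "manifold_diff M \<A> = Diffsp M
     (\<lambda>k U p. openin (Euclidean_space k) U \<and> p \<in> U \<rightarrow> M \<and>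
        (\<forall>u\<in>U. \<exists>W. \<exists>(V, \<psi>)\<in>\<A>. openin (Euclidean_space k) W \<and> u \<in> W \<and> W \<subseteq> U \<and>
           p \<in> W \<rightarrow> V \<and> (\<forall>i. Cinf_on k W (\<lambda>w. \<psi> (p w) i))))"

definition simply_connected_top :: "'a topology \<Rightarrow> bool" where
  "simply_connected_top X \<longleftrightarrow> path_connected_space X \<and>
     (\<forall>p. pathin X p \<and> p 0 = p 1 \<longrightarrow>
        homotopic_with (\<lambda>r. r 0 = p 0 \<and> r 1 = p 0) (top_of_set {0..1}) X p (\<lambda>_. p 0))"


section \<open>Quotient by a free action of a finite group\<close>

text \<open>
  The points of M/G are the orbits.  Its smooth structure is the one that makes the projection
  p a local diffeomorphism: on every open W contained in a chart domain and mapped injectively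
  by p, the chart is transported along p.
\<close>

definition quotient_atlas ::
    "('g, 'c) monoid_scheme \<Rightarrow> ('g \<Rightarrow> 'a \<Rightarrow> 'a) \<Rightarrow> 'a topology \<Rightarrow> 'a chart set \<Rightarrow> 'a set chart set" where
  "quotient_atlas G act X \<A> =
     {(orbit G act ` W, \<phi> \<circ> inv_into W (orbit G act)) | W \<phi>.
        openin X W \<and> (\<exists>U. W \<subseteq> U \<and> (U, \<phi>) \<in> \<A>) \<and> inj_on (orbit G act) W}"

definition quotient_diff ::
    "('g, 'c) monoid_scheme \<Rightarrow> ('g \<Rightarrow> 'a \<Rightarrow> 'a) \<Rightarrow> 'a topology \<Rightarrow> 'a chart set \<Rightarrow> 'a set diffsp" where
  "quotient_diff G act X \<A> = manifold_diff (orbits G (topspace X) act) (quotient_atlas G act X \<A>)"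


section \<open>Path spaces\<close>

definition loop_space :: "'a diffsp \<Rightarrow> (real \<Rightarrow> 'a) diffsp" where
  "loop_space N = subspace_diff (map_diff unit_interval N) {\<gamma>. \<gamma> 0 = \<gamma> 1}"

definition twisted_paths :: "('g \<Rightarrow> 'a \<Rightarrow> 'a) \<Rightarrow> 'a diffsp \<Rightarrow> 'g \<Rightarrow> (real \<Rightarrow> 'a) diffsp" where
  "twisted_paths act M g = subspace_diff (map_diff unit_interval M) {\<gamma>. \<gamma> 1 = act g (\<gamma> 0)}"

definition PG_space ::
    "('g, 'c) monoid_scheme \<Rightarrow> ('g \<Rightarrow> 'a \<Rightarrow> 'a) \<Rightarrow> 'a diffsp \<Rightarrow> ((real \<Rightarrow> 'a) \<times> 'g) diffsp" where
  "PG_space G act M = coprod_diff (carrier G) (twisted_paths act M)"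

definition PG_act ::
    "('g, 'c) monoid_scheme \<Rightarrow> ('g \<Rightarrow> 'a \<Rightarrow> 'a) \<Rightarrow> 'g \<Rightarrow> (real \<Rightarrow> 'a) \<times> 'g \<Rightarrow> (real \<Rightarrow> 'a) \<times> 'g" where
  "PG_act G act h = (\<lambda>(\<gamma>, g). (compose {0..1} (act h) \<gamma>, h \<otimes>\<^bsub>G\<^esub> g \<otimes>\<^bsub>G\<^esub> inv\<^bsub>G\<^esub> h))"

definition p_tilde ::
    "('g, 'c) monoid_scheme \<Rightarrow> ('g \<Rightarrow> 'a \<Rightarrow> 'a) \<Rightarrow> (real \<Rightarrow> 'a) \<times> 'g \<Rightarrow> real \<Rightarrow> 'a set" where
  "p_tilde G act = (\<lambda>(\<gamma>, g). compose {0..1} (orbit G act) \<gamma>)"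


section \<open>Smooth singular simplices\<close>

text \<open>Kihara's diffeology on the standard simplex.\<close>

definition kihara_map :: "nat \<Rightarrow> (nat \<Rightarrow> real) \<times> real \<Rightarrow> nat \<Rightarrow> real" where
  "kihara_map i = (\<lambda>(x, t). \<lambda>j. (1 - t) * (if j = i then 1 else 0) + t * simplical_face i x j)"

fun std_simplex :: "nat \<Rightarrow> (nat \<Rightarrow> real) diffsp" where
  "std_simplex 0 = subspace_diff (euclid 1) (standard_simplex 0)"
| "std_simplex (Suc 0) = subspace_diff (euclid 2) (standard_simplex 1)"
| "std_simplex (Suc (Suc n)) =
     final_diff (standard_simplex (Suc (Suc n))) {..Suc (Suc n)}
       (\<lambda>i. prod_diff (std_simplex (Suc n)) (subspace_diff real_line {0..<1})) kihara_map"

definition sing :: "'x diffsp \<Rightarrow> nat \<Rightarrow> ((nat \<Rightarrow> real) \<Rightarrow> 'x) set" where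
  "sing X n = {s \<in> extensional (standard_simplex n). smooth (std_simplex n) X s}"

text \<open>The affine map with \<open>v_i \<mapsto> v_(a i)\<close> induced by \<open>a : {0..m} \<rightarrow> {0..n}\<close>.\<close>

definition vertex_map :: "nat \<Rightarrow> (nat \<Rightarrow> nat) \<Rightarrow> (nat \<Rightarrow> real) \<Rightarrow> nat \<Rightarrow> real" where
  "vertex_map m a x = (\<lambda>j. \<Sum>i | i \<le> m \<and> a i = j. x i)"


section \<open>Differential forms on affine simplices\<close>

text \<open>
  \<open>aff n\<close> is the affine space A^n and \<open>aff_dir n\<close> its space of directions.  A form is a
  function of a point x and a list of directions; the homogeneous component of degree q
  is the restriction to lists of length q, so these are elements of the direct sum over all q.
  Forms are extended by 0 outside \<open>aff n\<close> and outside lists of directions.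
\<close>

definition aff :: "nat \<Rightarrow> (nat \<Rightarrow> real) set" where
  "aff n = {x \<in> topspace (Euclidean_space (Suc n)). (\<Sum>i\<le>n. x i) = 1}"

definition aff_dir :: "nat \<Rightarrow> (nat \<Rightarrow> real) set" where
  "aff_dir n = {v \<in> topspace (Euclidean_space (Suc n)). (\<Sum>i\<le>n. v i) = 0}"

type_synonym form = "(nat \<Rightarrow> real) \<Rightarrow> (nat \<Rightarrow> real) list \<Rightarrow> real"

definition forms :: "nat \<Rightarrow> form set" where
  "forms n = {\<omega>.
     (\<forall>x vs. \<not> (x \<in> aff n \<and> set vs \<subseteq> aff_dir n) \<longrightarrow> \<omega> x vs = 0) \<and>
     (\<forall>vs. set vs \<subseteq> aff_dir n \<longrightarrow>
        smooth (subspace_diff (euclid (Suc n)) (aff n)) real_line (\<lambda>x. \<omega> x vs)) \<and>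
     (\<forall>x\<in>aff n. \<forall>vs. set vs \<subseteq> aff_dir n \<longrightarrow>
        (\<forall>i<length vs. \<forall>v\<in>aff_dir n. \<forall>w\<in>aff_dir n. \<forall>r.
           \<omega> x (vs[i := (\<lambda>k. r * v k + w k)]) = r * \<omega> x (vs[i := v]) + \<omega> x (vs[i := w])) \<and>
        (\<forall>i<length vs. \<forall>j<length vs. i \<noteq> j \<and> vs ! i = vs ! j \<longrightarrow> \<omega> x vs = 0))}"

definition form_one :: "nat \<Rightarrow> form" where
  "form_one n x vs = (if x \<in> aff n \<and> vs = [] then 1 else 0)"

definition wedge :: "form \<Rightarrow> form \<Rightarrow> form" where
  "wedge \<alpha> \<beta> x vs = (let k = length vs in
     \<Sum>p\<le>k. (1 / (fact p * fact (k - p))) *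
       (\<Sum>\<sigma> | \<sigma> permutes {..<k}. of_int (sign \<sigma>) *
          \<alpha> x (map (\<lambda>i. vs ! \<sigma> i) [0..<p]) * \<beta> x (map (\<lambda>i. vs ! \<sigma> i) [p..<k])))"

text \<open>The invariant formula for d on constant vector fields, whose Lie brackets vanish.\<close>

definition form_d :: "nat \<Rightarrow> form \<Rightarrow> form" where
  "form_d n \<omega> x vs = (if x \<in> aff n \<and> set vs \<subseteq> aff_dir n
     then \<Sum>i<length vs. (-1) ^ i *
       deriv (\<lambda>t. \<omega> (\<lambda>k. x k + t * (vs ! i) k) (take i vs @ drop (Suc i) vs)) 0
     else 0)"

definition form_pullback :: "nat \<Rightarrow> (nat \<Rightarrow> nat) \<Rightarrow> form \<Rightarrow> form" where
  "form_pullback m a \<omega> x vs = (if x \<in> aff m \<and> set vs \<subseteq> aff_dir m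
     then \<omega> (vertex_map m a x) (map (vertex_map m a) vs) else 0)"


section \<open>Singular de Rham cohomology\<close>

text \<open>
  Elements of the de Rham algebra of the simplicial set of smooth singular simplices: simplicial
  maps into the simplicial algebra of forms, extended by 0 to functions that are not
  smooth simplices.  Boundedness of the degree makes this the direct sum
  (not the product) of the homogeneous parts.
\<close>

type_synonym 'x cochain = "nat \<Rightarrow> ((nat \<Rightarrow> real) \<Rightarrow> 'x) \<Rightarrow> form"

definition DR_cochains :: "'x diffsp \<Rightarrow> 'x cochain set" where
  "DR_cochains X = {c.
     (\<forall>n s. s \<in> sing X n \<longrightarrow> c n s \<in> forms n) \<and>
     (\<forall>n s. s \<notin> sing X n \<longrightarrow> c n s = (\<lambda>x vs. 0)) \<and>
     (\<forall>m n a s. mono_on {..m} a \<and> a \<in> {..m} \<rightarrow> {..n} \<and> s \<in> sing X n \<longrightarrow>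
        c m (compose (standard_simplex m) s (vertex_map m a)) = form_pullback m a (c n s)) \<and>
     (\<exists>N. \<forall>n s x vs. N < length vs \<longrightarrow> c n s x vs = 0)}"

definition DR_algebra :: "'x diffsp \<Rightarrow> (real, 'x cochain) module" where
  "DR_algebra X =
     \<lparr>carrier = DR_cochains X,
      mult = (\<lambda>c e n s. wedge (c n s) (e n s)),
      one = (\<lambda>n s. if s \<in> sing X n then form_one n else (\<lambda>x vs. 0)),
      ring.zero = (\<lambda>n s x vs. 0),
      add = (\<lambda>c e n s x vs. c n s x vs + e n s x vs),
      smult = (\<lambda>r c n s x vs. r * c n s x vs)\<rparr>"

definition DR_d :: "'x cochain \<Rightarrow> 'x cochain" where
  "DR_d c n s = form_d n (c n s)"

definition DR_cocycles :: "'x diffsp \<Rightarrow> (real, 'x cochain) module" where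
  "DR_cocycles X = (DR_algebra X)\<lparr>carrier := {c \<in> DR_cochains X. DR_d c = \<zero>\<^bsub>DR_algebra X\<^esub>}\<rparr>"

definition DR_coboundaries :: "'x diffsp \<Rightarrow> 'x cochain set" where
  "DR_coboundaries X = DR_d ` DR_cochains X"

definition homogeneous :: "nat \<Rightarrow> 'x cochain \<Rightarrow> bool" where
  "homogeneous q c \<longleftrightarrow> (\<forall>n s x vs. length vs \<noteq> q \<longrightarrow> c n s x vs = 0)"

text \<open>Graded real algebras, with the homogeneous parts as subsets of the carrier.\<close>

record 'h galgebra = "(real, 'h) module" +
  degree_part :: "nat \<Rightarrow> 'h set"

definition galgebra_iso ::
    "('h, 'u) galgebra_scheme \<Rightarrow> ('k, 'v) galgebra_scheme \<Rightarrow> ('h \<Rightarrow> 'k) set" where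
  "galgebra_iso A B = {f \<in> ring_iso A B.
     (\<forall>r. \<forall>x\<in>carrier A. f (r \<odot>\<^bsub>A\<^esub> x) = r \<odot>\<^bsub>B\<^esub> f x) \<and>
     (\<forall>q. f ` degree_part A q = degree_part B q)}"

text \<open>
  Cocycles modulo coboundaries.  A scalar acts on a class through representatives; the union in
  \<open>smult\<close>, as in \<open>H_pullback\<close> below, is a single coset exactly when the choice of the
  representative does not matter.
\<close>

definition H_DR :: "'x diffsp \<Rightarrow> 'x cochain set galgebra" where
  "H_DR X =
     (let Z = DR_cocycles X; B = DR_coboundaries X; H = Z Quot B in
      \<lparr>carrier = carrier H, mult = mult H, one = one H, ring.zero = ring.zero H, add = add H,
       smult = (\<lambda>r C. \<Union>c\<in>C. B +>\<^bsub>Z\<^esub> (r \<odot>\<^bsub>Z\<^esub> c)),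
       degree_part = (\<lambda>q. {B +>\<^bsub>Z\<^esub> c | c. c \<in> carrier Z \<and> homogeneous q c})\<rparr>)"

definition cochain_pullback :: "'x diffsp \<Rightarrow> ('x \<Rightarrow> 'y) \<Rightarrow> 'y cochain \<Rightarrow> 'x cochain" where
  "cochain_pullback X f c n s =
     (if s \<in> sing X n then c n (compose (standard_simplex n) f s) else (\<lambda>x vs. 0))"

text \<open>The map \<open>f\<^sup>* : H_DR Y \<rightarrow> H_DR X\<close> induced by \<open>f : X \<rightarrow> Y\<close>.\<close>

definition H_pullback :: "'x diffsp \<Rightarrow> ('x \<Rightarrow> 'y) \<Rightarrow> 'y cochain set \<Rightarrow> 'x cochain set" where
  "H_pullback X f C =
     (\<Union>c\<in>C. DR_coboundaries X +>\<^bsub>DR_cocycles X\<^esub> cochain_pullback X f c)"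


section \<open>Cotensor product\<close>

text \<open>
  For finite G, the dual of the group algebra is the space of functions on G, and
  its tensor product with H is the space of functions from G to H, where f tensor x is the
  function \<open>h \<mapsto> f h \<cdot> x\<close>.  The coaction of the comodule H is the map
  \<open>H(X) \<rightarrow> H(G \<times> X) = H(G) \<otimes> H(X)\<close> induced by the action \<open>G \<times> X \<rightarrow> X\<close>, i.e. the sum over
  h in G of \<open>\<delta>_h \<otimes> h\<^sup>*x\<close>.
\<close>

definition dual_tensor ::
    "('g, 'c) monoid_scheme \<Rightarrow> ('h, 'u) galgebra_scheme \<Rightarrow> ('g \<Rightarrow> real) \<Rightarrow> 'h \<Rightarrow> 'g \<Rightarrow> 'h" where
  "dual_tensor G A f x = (\<lambda>h\<in>carrier G. f h \<odot>\<^bsub>A\<^esub> x)"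

definition coaction ::
    "('g, 'c) monoid_scheme \<Rightarrow> 'x diffsp \<Rightarrow> ('g \<Rightarrow> 'x \<Rightarrow> 'x) \<Rightarrow> 'x cochain set \<Rightarrow> 'g \<Rightarrow> 'x cochain set" where
  "coaction G X a x = (\<lambda>h\<in>carrier G. H_pullback X (a h) x)"

definition cotensor ::
    "('g, 'c) monoid_scheme \<Rightarrow> 'x diffsp \<Rightarrow> ('g \<Rightarrow> 'x \<Rightarrow> 'x) \<Rightarrow> 'x cochain set galgebra" where
  "cotensor G X a =
     (let K = {x \<in> carrier (H_DR X). coaction G X a x = dual_tensor G (H_DR X) (\<lambda>_. 1) x} in
      (H_DR X)\<lparr>carrier := K, degree_part := \<lambda>q. degree_part (H_DR X) q \<inter> K\<rparr>)"

end

theory Submission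
  imports Defs "HOL-Library.Function_Algebras"
begin

text \<open>
  The projection p from M to N = M/G is a covering, so a smooth simplex of loops in N, read as a
  map on the product of a simplex and an interval, lifts to M. Over each loop the lift is a path
  whose end point is a translate of its starting point by some g in G, and g does not vary
  because the simplex is connected. A lift is therefore a smooth simplex of twisted paths, and
  any two lifts of the same simplex differ by the action of one element of G. Hence every
  cochain on the twisted paths that is invariant under G takes the same value on all lifts of a
  simplex of loops: pulling back along the map \<open>(\<gamma>, g) \<mapsto> p \<circ>
  \<gamma>\<close> identifies the de Rham cochains of the loop space with the G-invariant de
  Rham cochains of the twisted paths (\<open>pull_inject\<close>,
  \<open>invariant_cochain_descends\<close>).

  The cohomology of the invariant cochains is the invariant part of the cohomology, because G is
  finite and the coefficients are real: averaging over G is a chain map onto the invariant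
  cochains, it fixes them, and it does not change a class that is invariant
  (\<open>DR_d_average\<close>, \<open>average_invariant\<close>,
  \<open>average_cohomologous\<close>). The elements x of H with \<open>\<nabla>(x) = 1
  \<otimes> x\<close> are exactly the invariant classes, so this is the cotensor product. These
  arguments make up \<open>H_pullback_iso\<close>.

  The product of classes is defined as a union of cosets, so its compatibility with pullback
  needs that it is computed by representatives. This is the Leibniz rule
  (\<open>form_d_wedge\<close>), proved together with dd = 0 (\<open>form_d_form_d\<close>) by
  writing d and the wedge product as alternations.

  The lifts come from covering space theory, for which continuity in the Euclidean topology of
  the simplex is needed. Kihara's diffeology on the simplex may have fewer plots than the
  subspace diffeology, but enough to detect this topology: a map on a simplex times an interval
  is continuous as soon as its composites with all plots are
  (\<open>continuous_on_simplex_times_interval\<close>). Existence of lifts is the homotopy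
  lifting property applied to a contraction of the simplex times the interval
  (\<open>lift_homotopy\<close>, \<open>lift_contractible\<close>), uniqueness is
  \<open>lifts_differ_by_translate\<close>. Since p is a local diffeomorphism, a continuous lift
  of a plot of N is a plot of M (\<open>continuous_lift_of_plot\<close>), and so continuous
  lifts of smooth simplices are smooth (\<open>lift_sing\<close>).
\<close>

section \<open>Calculus of smooth functions\<close>

lemma Euclidean_space_eq_top_of_set:
  "Euclidean_space n = top_of_set {x. \<forall>i\<ge>n. x i = 0}"
  by (simp add: Euclidean_space_def euclidean_product_topology)

lemma topspace_Euclidean_space_iff [simp]:
  "x \<in> topspace (Euclidean_space n) \<longleftrightarrow> (\<forall>i\<ge>n. x i = 0)"
  by (simp add: topspace_Euclidean_space)

lemma openin_Euclidean_space_subset: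
  "openin (Euclidean_space n) U \<Longrightarrow> x \<in> U \<Longrightarrow> i \<ge> n \<Longrightarrow> x i = 0"
  using openin_subset by (fastforce simp: topspace_Euclidean_space)

lemma continuous_map_subtopology_Euclidean_space:
  assumes "openin (Euclidean_space n) U"
  shows "subtopology (Euclidean_space n) U = top_of_set U"
  using openin_subset[OF assms]
  by (simp add: Euclidean_space_eq_top_of_set subtopology_subtopology inf.absorb2)

lemma eventually_update_mem:
  assumes "openin (Euclidean_space n) U" "x \<in> U" "i < n"
  shows "\<forall>\<^sub>F t in nhds (x i). x(i := t) \<in> U"
proof -
  obtain O' where O': "open O'" "U = {x. \<forall>i\<ge>n. x i = 0} \<inter> O'"
    using assms(1) by (auto simp: Euclidean_space_eq_top_of_set openin_open)
  have "continuous_on UNIV (\<lambda>t. x(i := t))"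
  proof (rule continuous_on_coordinatewise_then_product)
    show "continuous_on UNIV (\<lambda>t. (x(i := t)) j)" for j
    proof (cases "j = i")
      case True
      then have "(\<lambda>t. (x(i := t)) j) = (\<lambda>t. t)" by auto
      then show ?thesis by (simp only: continuous_on_id)
    next
      case False
      then have "(\<lambda>t. (x(i := t)) j) = (\<lambda>t. x j)" by auto
      then show ?thesis by (simp only: continuous_on_const)
    qed
  qed
  then have "open ((\<lambda>t. x(i := t)) -` O')"
    using O'(1) by (simp add: open_vimage)
  moreover have "x i \<in> (\<lambda>t. x(i := t)) -` O'"
    using assms(2) O'(2) by simp
  ultimately have "\<forall>\<^sub>F t in nhds (x i). t \<in> (\<lambda>t. x(i := t)) -` O'"
    by (rule eventually_nhds_in_open)
  then show ?thesis
    by eventually_elim (use assms O'(2) in auto)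
qed

lemma continuous_on_coordinate: "continuous_on S (\<lambda>x::nat \<Rightarrow> real. x i)"
  by (rule continuous_on_subset[OF continuous_on_product_coordinates subset_UNIV])

lemma continuous_on_update_coordinate: "continuous_on S (\<lambda>x::nat \<Rightarrow> real. x(n := c))"
proof (rule continuous_on_coordinatewise_then_product)
  show "continuous_on S (\<lambda>x. (x(n := c)) i)" for i
  proof (cases "i = n")
    case True
    then have "(\<lambda>x. (x(n := c)) i) = (\<lambda>x. c)" by auto
    then show ?thesis by (simp only: continuous_on_const)
  next
    case False
    then have "(\<lambda>x. (x(n := c)) i) = (\<lambda>x. x i)" by auto
    then show ?thesis by (simp only: continuous_on_coordinate)
  qed
qed

lemma Ck_on_continuous:
  "Ck_on n k U f \<Longrightarrow> continuous_map (subtopology (Euclidean_space n) U) euclideanreal f"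
  by (cases k) auto

lemma Ck_on_SucE:
  assumes "Ck_on n (Suc k) U f" "i < n"
  obtains g where "Ck_on n k U g"
    "\<forall>x\<in>U. ((\<lambda>t. f (x(i := t))) has_real_derivative g x) (at (x i))"
  using assms by auto

lemma Ck_on_subset:
  "Ck_on n k U f \<Longrightarrow> W \<subseteq> U \<Longrightarrow> Ck_on n k W f"
  by (induction k arbitrary: f) (fastforce intro: continuous_map_from_subtopology_mono)+

lemma Ck_on_SucD: "Ck_on n (Suc k) U f \<Longrightarrow> Ck_on n k U f"
proof (induction k arbitrary: f)
  case (Suc k)
  then show ?case
    by (metis Ck_on.simps(2))
qed auto

lemma Ck_on_cong:
  assumes "openin (Euclidean_space n) U"
  shows "Ck_on n k U f \<Longrightarrow> (\<And>x. x \<in> U \<Longrightarrow> f x = g x) \<Longrightarrow> Ck_on n k U g"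
proof (induction k arbitrary: f g)
  case 0
  then show ?case
    by (auto intro: continuous_map_eq)
next
  case (Suc k)
  have "\<exists>h. Ck_on n k U h \<and> (\<forall>x\<in>U. ((\<lambda>t. g (x(i := t))) has_real_derivative h x) (at (x i)))"
    if i: "i < n" for i
  proof -
    obtain h where h: "Ck_on n k U h"
      "\<forall>x\<in>U. ((\<lambda>t. f (x(i := t))) has_real_derivative h x) (at (x i))"
      using Ck_on_SucE[OF Suc.prems(1) i] .
    have "((\<lambda>t. g (x(i := t))) has_real_derivative h x) (at (x i))" if "x \<in> U" for x
    proof -
      have "\<forall>\<^sub>F t in nhds (x i). f (x(i := t)) = g (x(i := t))"
        using eventually_update_mem[OF assms that i]
        by eventually_elim (use Suc.prems in auto)
      then show ?thesis
        by (rule iffD1[OF DERIV_cong_ev[OF refl _ refl] bspec[OF h(2) that]])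
    qed
    with h show ?thesis by blast
  qed
  moreover have "continuous_map (subtopology (Euclidean_space n) U) euclideanreal g"
    using Suc.prems by (auto intro: continuous_map_eq)
  ultimately show ?case
    unfolding Ck_on.simps by (intro conjI allI impI)
qed

lemma Ck_on_const: "Ck_on n k U (\<lambda>x. c)"
proof (induction k arbitrary: c)
  case (Suc k)
  have "Ck_on n k U (\<lambda>x. 0) \<and> (\<forall>x\<in>U. ((\<lambda>t. c) has_real_derivative 0) (at (x i)))" for i
    using Suc by auto
  then show ?case by auto
qed auto

lemma Ck_on_add: "Ck_on n k U f \<Longrightarrow> Ck_on n k U g \<Longrightarrow> Ck_on n k U (\<lambda>x. f x + g x)"
proof (induction k arbitrary: f g)
  case (Suc k)
  have "\<exists>h. Ck_on n k U h \<and> (\<forall>x\<in>U. ((\<lambda>t. f (x(i := t)) + g (x(i := t))) has_real_derivative h x) (at (x i)))"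
    if i: "i < n" for i
  proof -
    obtain f' where f': "Ck_on n k U f'"
      "\<forall>x\<in>U. ((\<lambda>t. f (x(i := t))) has_real_derivative f' x) (at (x i))"
      using Ck_on_SucE[OF Suc.prems(1) i] .
    obtain g' where g': "Ck_on n k U g'"
      "\<forall>x\<in>U. ((\<lambda>t. g (x(i := t))) has_real_derivative g' x) (at (x i))"
      using Ck_on_SucE[OF Suc.prems(2) i] .
    have "((\<lambda>t. f (x(i := t)) + g (x(i := t))) has_real_derivative f' x + g' x) (at (x i))"
      if "x \<in> U" for x
      using DERIV_add[OF bspec[OF f'(2) that] bspec[OF g'(2) that]] .
    then show ?thesis
      using Suc.IH[OF f'(1) g'(1)] by (intro exI[of _ "\<lambda>x. f' x + g' x"] conjI ballI)
  qed
  then show ?case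
    using Suc.prems by (auto intro: continuous_intros)
qed (auto intro: continuous_intros)

lemma Ck_on_mult: "Ck_on n k U f \<Longrightarrow> Ck_on n k U g \<Longrightarrow> Ck_on n k U (\<lambda>x. f x * g x)"
proof (induction k arbitrary: f g)
  case (Suc k)
  have "\<exists>h. Ck_on n k U h \<and> (\<forall>x\<in>U. ((\<lambda>t. f (x(i := t)) * g (x(i := t))) has_real_derivative h x) (at (x i)))"
    if i: "i < n" for i
  proof -
    obtain f' where f': "Ck_on n k U f'"
      "\<forall>x\<in>U. ((\<lambda>t. f (x(i := t))) has_real_derivative f' x) (at (x i))"
      using Ck_on_SucE[OF Suc.prems(1) i] .
    obtain g' where g': "Ck_on n k U g'"
      "\<forall>x\<in>U. ((\<lambda>t. g (x(i := t))) has_real_derivative g' x) (at (x i))"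
      using Ck_on_SucE[OF Suc.prems(2) i] .
    have "((\<lambda>t. f (x(i := t)) * g (x(i := t))) has_real_derivative f' x * g x + g' x * f x) (at (x i))"
      if "x \<in> U" for x
      using DERIV_mult[OF bspec[OF f'(2) that] bspec[OF g'(2) that]] by simp
    moreover have "Ck_on n k U (\<lambda>x. f' x * g x + g' x * f x)"
      using Ck_on_add[OF Suc.IH[OF f'(1) Ck_on_SucD[OF Suc.prems(2)]] Suc.IH[OF g'(1) Ck_on_SucD[OF Suc.prems(1)]]] .
    ultimately show ?thesis
      by (intro exI[of _ "\<lambda>x. f' x * g x + g' x * f x"] conjI ballI)
  qed
  then show ?case
    using Suc.prems by (auto intro: continuous_intros)
qed (auto intro: continuous_intros)

lemma Ck_on_coordinate: "Ck_on n k U (\<lambda>x. x j)"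
proof -
  have cont: "continuous_map (subtopology (Euclidean_space n) U) euclideanreal (\<lambda>x. x j)"
    unfolding Euclidean_space_eq_top_of_set subtopology_subtopology continuous_map_iff_continuous
    by (rule continuous_on_coordinate)
  have der: "\<exists>h. Ck_on n k' U h \<and> (\<forall>x\<in>U. ((\<lambda>t. (x(i := t)) j) has_real_derivative h x) (at (x i)))"
    for i k'
  proof (cases "i = j")
    case True
    have "Ck_on n k' U (\<lambda>_. 1) \<and> (\<forall>x\<in>U. ((\<lambda>t. (x(i := t)) j) has_real_derivative 1) (at (x i)))"
      using True by (simp add: Ck_on_const)
    then show ?thesis by (intro exI[of _ "\<lambda>_. 1"])
  next
    case False
    have "Ck_on n k' U (\<lambda>_. 0) \<and> (\<forall>x\<in>U. ((\<lambda>t. (x(i := t)) j) has_real_derivative 0) (at (x i)))"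
      using False by (simp add: Ck_on_const)
    then show ?thesis by (intro exI[of _ "\<lambda>_. 0"])
  qed
  show ?thesis
  proof (cases k)
    case 0
    show ?thesis unfolding 0 Ck_on.simps by (rule cont)
  next
    case (Suc k')
    show ?thesis unfolding Suc Ck_on.simps by (intro conjI allI impI cont der)
  qed
qed

lemma Cinf_on_subset:
  "Cinf_on n U f \<Longrightarrow> openin (Euclidean_space n) W \<Longrightarrow> W \<subseteq> U \<Longrightarrow> Cinf_on n W f"
  by (auto simp: Cinf_on_def intro: Ck_on_subset)

lemma Cinf_on_cong:
  "Cinf_on n U f \<Longrightarrow> (\<And>x. x \<in> U \<Longrightarrow> f x = g x) \<Longrightarrow> Cinf_on n U g"
  by (auto simp: Cinf_on_def intro: Ck_on_cong)

lemma Cinf_on_const: "openin (Euclidean_space n) U \<Longrightarrow> Cinf_on n U (\<lambda>x. c)"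
  by (simp add: Cinf_on_def Ck_on_const)

lemma Cinf_on_coordinate: "openin (Euclidean_space n) U \<Longrightarrow> Cinf_on n U (\<lambda>x. x j)"
  by (simp add: Cinf_on_def Ck_on_coordinate)

lemma Cinf_on_add: "Cinf_on n U f \<Longrightarrow> Cinf_on n U g \<Longrightarrow> Cinf_on n U (\<lambda>x. f x + g x)"
  by (simp add: Cinf_on_def Ck_on_add)

lemma Cinf_on_mult: "Cinf_on n U f \<Longrightarrow> Cinf_on n U g \<Longrightarrow> Cinf_on n U (\<lambda>x. f x * g x)"
  by (simp add: Cinf_on_def Ck_on_mult)

lemma Cinf_on_cmult: "Cinf_on n U f \<Longrightarrow> Cinf_on n U (\<lambda>x. c * f x)"
  by (intro Cinf_on_mult Cinf_on_const) (auto simp: Cinf_on_def)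

lemma Cinf_on_diff: "Cinf_on n U f \<Longrightarrow> Cinf_on n U g \<Longrightarrow> Cinf_on n U (\<lambda>x. f x - g x)"
  using Cinf_on_add[OF _ Cinf_on_cmult[of n U g "-1"], of f] by simp

lemma Cinf_on_continuous_on:
  assumes "Cinf_on n U f" shows "continuous_on U f"
proof -
  have U: "openin (Euclidean_space n) U" and "Ck_on n 0 U f"
    using assms by (auto simp only: Cinf_on_def)
  then show ?thesis
    by (simp only: Ck_on.simps(1) continuous_map_subtopology_Euclidean_space[OF U] continuous_map_iff_continuous)
qed

lemmas Cinf_on_intros = Cinf_on_const Cinf_on_coordinate Cinf_on_add Cinf_on_mult Cinf_on_diff

text \<open>
  A directional derivative will be obtained as a partial derivative in an additional coordinate.
  The new coordinate has index n; setting it to 0 projects to the old space, and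
  \<open>Ck_on_slice\<close> restricts back to the points where it is 0.
\<close>

lemma Ck_on_cylinder:
  assumes "openin (Euclidean_space n) U"
  shows "Ck_on n k U f \<Longrightarrow> Ck_on (Suc n) k {x \<in> topspace (Euclidean_space (Suc n)). x(n := 0) \<in> U} (\<lambda>x. f (x(n := 0)))"
proof (induction k arbitrary: f)
  case 0
  let ?V = "{x \<in> topspace (Euclidean_space (Suc n)). x(n := 0) \<in> U}"
  have "continuous_map (subtopology (Euclidean_space (Suc n)) ?V) (top_of_set U) (\<lambda>x. x(n := 0))"
    unfolding Euclidean_space_eq_top_of_set
    by (auto simp: subtopology_subtopology continuous_on_update_coordinate)
  from continuous_map_compose[OF this, of euclideanreal f] 0 assms
  show ?case
    by (simp only: continuous_map_subtopology_Euclidean_space o_def Ck_on.simps(1))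
next
  case (Suc k)
  let ?V = "{x \<in> topspace (Euclidean_space (Suc n)). x(n := 0) \<in> U}"
  have "\<exists>h. Ck_on (Suc n) k ?V h \<and>
      (\<forall>x\<in>?V. ((\<lambda>t. f ((x(i := t))(n := 0))) has_real_derivative h x) (at (x i)))" if "i < Suc n" for i
  proof (cases "i = n")
    case True
    then show ?thesis by (intro exI[of _ "\<lambda>_. 0"]) (simp add: Ck_on_const)
  next
    case False
    with that have "i < n" by simp
    obtain h where h: "Ck_on n k U h"
      "\<forall>x\<in>U. ((\<lambda>t. f (x(i := t))) has_real_derivative h x) (at (x i))"
      using Ck_on_SucE[OF Suc.prems \<open>i < n\<close>] .
    have "((\<lambda>t. f ((x(i := t))(n := 0))) has_real_derivative h (x(n := 0))) (at (x i))" if "x \<in> ?V" for x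
      using bspec[OF h(2), of "x(n := 0)"] that \<open>i < n\<close> by (simp add: fun_upd_twist)
    then show ?thesis
      using Suc.IH[OF h(1)] by (intro exI[of _ "\<lambda>x. h (x(n := 0))"] conjI ballI)
  qed
  moreover have "continuous_map (subtopology (Euclidean_space (Suc n)) ?V) euclideanreal (\<lambda>x. f (x(n := 0)))"
    using Ck_on_continuous[OF Suc.IH[OF Ck_on_SucD[OF Suc.prems]]] .
  ultimately show ?case
    unfolding Ck_on.simps by (intro conjI allI impI)
qed

lemma openin_cylinder:
  assumes "openin (Euclidean_space n) U"
  shows "openin (Euclidean_space (Suc n)) {x \<in> topspace (Euclidean_space (Suc n)). x(n := 0) \<in> U}"
proof (rule openin_continuous_map_preimage[OF _ assms])
  show "continuous_map (Euclidean_space (Suc n)) (Euclidean_space n) (\<lambda>x. x(n := 0))"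
    unfolding Euclidean_space_eq_top_of_set
    by (auto simp: continuous_on_update_coordinate)
qed

lemma Cinf_on_cylinder:
  "Cinf_on n U f \<Longrightarrow> Cinf_on (Suc n) {x \<in> topspace (Euclidean_space (Suc n)). x(n := 0) \<in> U} (\<lambda>x. f (x(n := 0)))"
  unfolding Cinf_on_def using Ck_on_cylinder openin_cylinder by blast

lemma Ck_on_slice:
  assumes "Ck_on (Suc n) k V g" "U \<subseteq> V" "U \<subseteq> topspace (Euclidean_space n)"
  shows "Ck_on n k U g"
  using assms(1)
proof (induction k arbitrary: g)
  case 0
  have "subtopology (Euclidean_space n) U = subtopology (subtopology (Euclidean_space (Suc n)) V) U"
    using assms(2,3) unfolding Euclidean_space_eq_top_of_set
    by (simp add: subtopology_subtopology) (rule arg_cong[of _ _ top_of_set], auto)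
  then show ?case
    using 0 continuous_map_from_subtopology[of "subtopology (Euclidean_space (Suc n)) V" euclideanreal g U]
    by (simp only: Ck_on.simps(1))
next
  case (Suc k)
  have "\<exists>h. Ck_on n k U h \<and> (\<forall>x\<in>U. ((\<lambda>t. g (x(i := t))) has_real_derivative h x) (at (x i)))" if i: "i < n" for i
  proof -
    obtain h where h: "Ck_on (Suc n) k V h"
      "\<forall>x\<in>V. ((\<lambda>t. g (x(i := t))) has_real_derivative h x) (at (x i))"
      using Ck_on_SucE[OF Suc.prems less_SucI[OF i]] .
    show ?thesis
      using Suc.IH[OF h(1)] h(2) assms(2) by (intro exI[of _ h]) blast
  qed
  moreover have "continuous_map (subtopology (Euclidean_space n) U) euclideanreal g"
    using Ck_on_continuous[OF Suc.IH[OF Ck_on_SucD[OF Suc.prems]]] .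
  ultimately show ?case
    unfolding Ck_on.simps by (intro conjI allI impI)
qed


section \<open>Directional derivatives on affine spaces\<close>

abbreviation aff_diff :: "nat \<Rightarrow> (nat \<Rightarrow> real) diffsp" where
  "aff_diff n \<equiv> subspace_diff (euclid (Suc n)) (aff n)"

abbreviation translate :: "(nat \<Rightarrow> real) \<Rightarrow> real \<Rightarrow> (nat \<Rightarrow> real) \<Rightarrow> nat \<Rightarrow> real" where
  "translate x t v \<equiv> (\<lambda>k. x k + t * v k)"

definition dir_deriv :: "(nat \<Rightarrow> real) \<Rightarrow> ((nat \<Rightarrow> real) \<Rightarrow> real) \<Rightarrow> (nat \<Rightarrow> real) \<Rightarrow> real" where
  "dir_deriv v f x = deriv (\<lambda>t. f (translate x t v)) 0"

lemma aff_translate: "x \<in> aff n \<Longrightarrow> v \<in> aff_dir n \<Longrightarrow> translate x t v \<in> aff n"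
  by (simp add: aff_def aff_dir_def sum.distrib flip: sum_distrib_left)

lemma aff_dir_add_scaled: "v \<in> aff_dir n \<Longrightarrow> w \<in> aff_dir n \<Longrightarrow> (\<lambda>k. r * v k + w k) \<in> aff_dir n"
  by (simp add: aff_dir_def sum.distrib flip: sum_distrib_left)

lemma plot_aff_iff:
  "plot (aff_diff n) m U p \<longleftrightarrow>
     openin (Euclidean_space m) U \<and> p \<in> U \<rightarrow> aff n \<and> (\<forall>i<Suc n. Cinf_on m U (\<lambda>u. p u i))"
  by (auto simp: subspace_diff_def euclid_def aff_def Pi_iff)

lemma smooth_aff_iff:
  "smooth (aff_diff n) real_line f \<longleftrightarrow> (\<forall>m U p. plot (aff_diff n) m U p \<longrightarrow> Cinf_on m U (\<lambda>u. f (p u)))"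
  by (simp add: smooth_def real_line_def o_def)

text \<open>The parameter t of the translation by v becomes one more coordinate of the plot.\<close>

lemma plot_aff_extend:
  assumes p: "plot (aff_diff n) m U p" and v: "v \<in> aff_dir n"
  shows "plot (aff_diff n) (Suc m) {x \<in> topspace (Euclidean_space (Suc m)). x(m := 0) \<in> U}
           (\<lambda>x. translate (p (x(m := 0))) (x m) v)"
proof -
  let ?V = "{x \<in> topspace (Euclidean_space (Suc m)). x(m := 0) \<in> U}"
  have U: "openin (Euclidean_space m) U" and pU: "p \<in> U \<rightarrow> aff n"
    and pi: "\<And>i. i < Suc n \<Longrightarrow> Cinf_on m U (\<lambda>u. p u i)"
    using p unfolding plot_aff_iff by auto
  have V: "openin (Euclidean_space (Suc m)) ?V"
    using openin_cylinder[OF U] .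
  have "Cinf_on (Suc m) ?V (\<lambda>x. translate (p (x(m := 0))) (x m) v i)" if "i < Suc n" for i
    by (intro Cinf_on_add Cinf_on_mult Cinf_on_coordinate Cinf_on_const V Cinf_on_cylinder[OF pi[OF that]])
  moreover have "(\<lambda>x. translate (p (x(m := 0))) (x m) v) \<in> ?V \<rightarrow> aff n"
    using pU v by (auto intro!: aff_translate)
  ultimately show ?thesis
    unfolding plot_aff_iff using V by blast
qed

text \<open>
  By \<open>plot_aff_extend\<close> the derivative along v is a partial derivative of a smooth
  function on an open subset of a space of one dimension more, so iterated partial derivatives
  exist and are continuous.
\<close>

lemma dir_deriv_along_plot:
  assumes f: "smooth (aff_diff n) real_line f" and p: "plot (aff_diff n) m U p" and v: "v \<in> aff_dir n"
  obtains g where "Ck_on m k U g"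
    "\<forall>x\<in>U. ((\<lambda>t. f (translate (p x) t v)) has_real_derivative g x) (at 0)"
proof -
  let ?V = "{x \<in> topspace (Euclidean_space (Suc m)). x(m := 0) \<in> U}"
  let ?F = "\<lambda>x. f (translate (p (x(m := 0))) (x m) v)"
  have U: "openin (Euclidean_space m) U"
    using p unfolding plot_aff_iff by simp
  have UV: "U \<subseteq> ?V"
  proof
    fix x assume x: "x \<in> U"
    then have "\<forall>i\<ge>m. x i = 0"
      using openin_Euclidean_space_subset[OF U] by blast
    then have "x(m := 0) = x" by auto
    with x \<open>\<forall>i\<ge>m. x i = 0\<close> show "x \<in> ?V" by simp
  qed
  have "Cinf_on (Suc m) ?V ?F"
    using f plot_aff_extend[OF p v] unfolding smooth_aff_iff by blast
  then have F: "Ck_on (Suc m) (Suc k) ?V ?F"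
    by (simp only: Cinf_on_def)
  obtain g where g: "Ck_on (Suc m) k ?V g"
    "\<forall>x\<in>?V. ((\<lambda>t. ?F (x(m := t))) has_real_derivative g x) (at (x m))"
    using Ck_on_SucE[OF F lessI] .
  show ?thesis
  proof (rule that)
    show "Ck_on m k U g"
      using Ck_on_slice[OF g(1) UV openin_subset[OF U]] .
    show "\<forall>x\<in>U. ((\<lambda>t. f (translate (p x) t v)) has_real_derivative g x) (at 0)"
    proof
      fix x assume x: "x \<in> U"
      then have "x m = 0"
        using openin_Euclidean_space_subset[OF U] by blast
      then have x0: "x(m := 0) = x" by auto
      have "x \<in> ?V" using x UV by blast
      from bspec[OF g(2) this] show "((\<lambda>t. f (translate (p x) t v)) has_real_derivative g x) (at 0)"
        by (simp only: fun_upd_upd fun_upd_same x0 \<open>x m = 0\<close>)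
    qed
  qed
qed

lemma plot_aff_const:
  assumes "openin (Euclidean_space m) U" "x \<in> aff n"
  shows "plot (aff_diff n) m U (\<lambda>_. x)"
  using assms by (simp add: plot_aff_iff Cinf_on_const)

lemma has_dir_deriv_0:
  assumes f: "smooth (aff_diff n) real_line f" and x: "x \<in> aff n" and v: "v \<in> aff_dir n"
  shows "((\<lambda>t. f (translate x t v)) has_real_derivative dir_deriv v f x) (at 0)"
proof -
  let ?U = "topspace (Euclidean_space 0)"
  obtain g where g: "\<forall>y\<in>?U. ((\<lambda>t. f (translate x t v)) has_real_derivative g y) (at 0)"
    using dir_deriv_along_plot[OF f plot_aff_const[OF openin_topspace x] v, of 0 0] .
  have "(\<lambda>_. 0) \<in> ?U" by simp
  from bspec[OF g this] have D: "((\<lambda>t. f (translate x t v)) has_real_derivative g (\<lambda>_. 0)) (at 0)" .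
  show ?thesis
    unfolding dir_deriv_def DERIV_imp_deriv[OF D] by (rule D)
qed

lemma has_dir_deriv:
  assumes f: "smooth (aff_diff n) real_line f" and x: "x \<in> aff n" and v: "v \<in> aff_dir n"
  shows "((\<lambda>t. f (translate x t v)) has_real_derivative dir_deriv v f (translate x s v)) (at s)"
proof -
  have "((\<lambda>t. f (translate (translate x s v) t v)) has_real_derivative dir_deriv v f (translate x s v)) (at 0)"
    by (rule has_dir_deriv_0[OF f aff_translate[OF x v] v])
  moreover have "(\<lambda>t. f (translate (translate x s v) t v)) = (\<lambda>t. f (translate x (t + s) v))"
    by (simp add: algebra_simps)
  ultimately show ?thesis
    using DERIV_shift[of "\<lambda>t. f (translate x t v)" "dir_deriv v f (translate x s v)" 0 s] by simp
qed

lemma smooth_dir_deriv: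
  assumes f: "smooth (aff_diff n) real_line f" and v: "v \<in> aff_dir n"
  shows "smooth (aff_diff n) real_line (dir_deriv v f)"
  unfolding smooth_aff_iff
proof (intro allI impI)
  fix m U p assume p: "plot (aff_diff n) m U p"
  have U: "openin (Euclidean_space m) U" and pU: "p \<in> U \<rightarrow> aff n"
    using p unfolding plot_aff_iff by auto
  have "Ck_on m k U (\<lambda>u. dir_deriv v f (p u))" for k
  proof -
    obtain g where g: "Ck_on m k U g"
      "\<forall>x\<in>U. ((\<lambda>t. f (translate (p x) t v)) has_real_derivative g x) (at 0)"
      using dir_deriv_along_plot[OF f p v] .
    show ?thesis
    proof (rule Ck_on_cong[OF U g(1)])
      show "g x = dir_deriv v f (p x)" if "x \<in> U" for x
        using DERIV_imp_deriv[OF bspec[OF g(2) that]] by (simp add: dir_deriv_def)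
    qed
  qed
  then show "Cinf_on m U (\<lambda>u. dir_deriv v f (p u))"
    using U by (simp add: Cinf_on_def)
qed

lemma continuous_on_aff_plane:
  assumes f: "smooth (aff_diff n) real_line f" and x: "x \<in> aff n"
    and v: "v \<in> aff_dir n" and w: "w \<in> aff_dir n"
  shows "continuous_on UNIV (\<lambda>(s, t). f (translate (translate x s v) t w))"
proof -
  let ?U = "topspace (Euclidean_space 2)"
  let ?p = "\<lambda>u. translate (translate x (u 0) v) (u 1) w"
  have "plot (aff_diff n) 2 ?U ?p"
    unfolding plot_aff_iff
    by (auto intro!: aff_translate x v w Cinf_on_intros)
  then have "Cinf_on 2 ?U (\<lambda>u. f (?p u))"
    using f unfolding smooth_aff_iff by blast
  then have 1: "continuous_on ?U (\<lambda>u. f (?p u))"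
    by (rule Cinf_on_continuous_on)
  let ?q = "\<lambda>st::real \<times> real. (\<lambda>i::nat. if i = 0 then fst st else if i = 1 then snd st else 0)"
  have 2: "continuous_on UNIV ?q"
  proof (rule continuous_on_coordinatewise_then_product)
    fix i :: nat
    consider "i = 0" | "i = 1" | "i > 1" by linarith
    then show "continuous_on UNIV (\<lambda>st. ?q st i)"
      by cases (simp_all add: continuous_on_fst continuous_on_snd continuous_on_id)
  qed
  have 3: "?q ` UNIV \<subseteq> ?U" by auto
  have "continuous_on UNIV ((\<lambda>u. f (?p u)) \<circ> ?q)"
    using continuous_on_compose[OF 2 continuous_on_subset[OF 1 3]] .
  then show ?thesis
    by (simp add: o_def case_prod_unfold)
qed

text \<open>
  The function \<open>(s, t) \<mapsto> f (x + s v + t w)\<close> has continuous partial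
  derivatives, so it is differentiable at 0, and the chain rule along the line \<open>t
  \<mapsto> (r t, t)\<close> gives linearity in the direction.
\<close>

lemma dir_deriv_linear:
  assumes f: "smooth (aff_diff n) real_line f" and x: "x \<in> aff n"
    and v: "v \<in> aff_dir n" and w: "w \<in> aff_dir n"
  shows "dir_deriv (\<lambda>k. r * v k + w k) f x = r * dir_deriv v f x + dir_deriv w f x"
proof -
  let ?\<phi> = "\<lambda>s t. f (translate (translate x s v) t w)"
  let ?D = "\<lambda>s t. dir_deriv w f (translate (translate x s v) t w)"
  have "((\<lambda>(s, t). ?\<phi> s t) has_derivative
      (\<lambda>(ts, tt). dir_deriv v f x * ts + blinfun_apply (blinfun_mult_right (?D 0 0)) tt)) (at (0, 0) within UNIV \<times> UNIV)"
  proof (rule has_derivative_partialsI[where f = ?\<phi> and fx = "(*) (dir_deriv v f x)"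
        and fy = "\<lambda>s t. blinfun_mult_right (?D s t)"])
    show "((\<lambda>s. ?\<phi> s 0) has_derivative (*) (dir_deriv v f x)) (at 0 within UNIV)"
      using has_dir_deriv_0[OF f x v] by (simp add: has_field_derivative_def)
    show "((\<lambda>t. ?\<phi> s t) has_derivative blinfun_apply (blinfun_mult_right (?D s t))) (at t within UNIV)" for s t
      using has_dir_deriv[OF f aff_translate[OF x v] w, of s t]
      by (simp add: has_field_derivative_def)
    have "continuous_on UNIV (\<lambda>(s, t). ?D s t)"
      by (rule continuous_on_aff_plane[OF smooth_dir_deriv[OF f w] x v w])
    then have "continuous (at (0, 0)) (\<lambda>st. case st of (s, t) \<Rightarrow> ?D s t)"
      by (simp add: continuous_on_eq_continuous_at)
    then have "continuous (at (0, 0)) (\<lambda>st. blinfun_mult_right (case st of (s, t) \<Rightarrow> ?D s t))"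
      by (rule bounded_linear.continuous[OF bounded_linear_blinfun_mult_right])
    then show "continuous (at (0, 0) within UNIV \<times> UNIV) (\<lambda>(s, t). blinfun_mult_right (?D s t))"
      by (simp add: case_prod_unfold)
  qed auto
  then have "((\<lambda>(s, t). ?\<phi> s t) has_derivative
      (\<lambda>(ts, tt). dir_deriv v f x * ts + ?D 0 0 * tt)) (at (0, 0))"
    by simp
  moreover have "((\<lambda>t. (t * r, t)) has_derivative (\<lambda>t. (t * r, t))) (at (0::real))"
    by (intro derivative_eq_intros) auto
  ultimately have "((\<lambda>(s, t). ?\<phi> s t) \<circ> (\<lambda>t. (t * r, t)) has_derivative
      (\<lambda>(ts, tt). dir_deriv v f x * ts + ?D 0 0 * tt) \<circ> (\<lambda>t. (t * r, t))) (at 0)"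
    by (intro diff_chain_at) (auto simp: zero_prod_def)
  moreover have "(\<lambda>(s, t). ?\<phi> s t) \<circ> (\<lambda>t. (t * r, t)) = (\<lambda>t. f (translate x t (\<lambda>k. r * v k + w k)))"
    by (auto simp: algebra_simps)
  moreover have "(\<lambda>(ts, tt). dir_deriv v f x * ts + ?D 0 0 * tt) \<circ> (\<lambda>t. (t * r, t))
      = (*) (r * dir_deriv v f x + dir_deriv w f x)"
    by (auto simp: algebra_simps)
  ultimately have "((\<lambda>t. f (translate x t (\<lambda>k. r * v k + w k))) has_real_derivative
      r * dir_deriv v f x + dir_deriv w f x) (at 0)"
    by (simp add: has_field_derivative_def)
  then show ?thesis
    unfolding dir_deriv_def[of "\<lambda>k. r * v k + w k"] by (rule DERIV_imp_deriv)
qed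

text \<open>The mean value theorem in each of the two directions.\<close>

lemma second_difference_eq:
  assumes f: "smooth (aff_diff n) real_line f" and x: "x \<in> aff n"
    and v: "v \<in> aff_dir n" and w: "w \<in> aff_dir n" and h: "h > 0"
  shows "\<exists>\<xi> \<eta>. 0 < \<xi> \<and> \<xi> < h \<and> 0 < \<eta> \<and> \<eta> < h \<and>
    f (translate (translate x h v) h w) - f (translate x h v) - f (translate x h w) + f x =
    h * h * dir_deriv w (dir_deriv v f) (translate (translate x \<xi> v) \<eta> w)"
proof -
  let ?g = "\<lambda>s. f (translate (translate x s v) h w) - f (translate x s v)"
  let ?g' = "\<lambda>s. dir_deriv v f (translate (translate x s v) h w) - dir_deriv v f (translate x s v)"
  have swap: "translate (translate x s v) t w = translate (translate x t w) s v" for s t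
    by (simp add: algebra_simps)
  have "(?g has_real_derivative ?g' s) (at s)" for s
  proof (rule DERIV_diff)
    show "((\<lambda>s. f (translate (translate x s v) h w)) has_real_derivative
        dir_deriv v f (translate (translate x s v) h w)) (at s)"
      unfolding swap[of _ h] by (rule has_dir_deriv[OF f aff_translate[OF x w] v])
  qed (rule has_dir_deriv[OF f x v])
  then obtain \<xi> where \<xi>: "0 < \<xi>" "\<xi> < h" "?g h - ?g 0 = (h - 0) * ?g' \<xi>"
    using MVT2[OF h, of ?g ?g'] by blast
  have "((\<lambda>t. dir_deriv v f (translate (translate x \<xi> v) t w)) has_real_derivative
      dir_deriv w (dir_deriv v f) (translate (translate x \<xi> v) t w)) (at t)" for t
    by (rule has_dir_deriv[OF smooth_dir_deriv[OF f v] aff_translate[OF x v] w])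
  then obtain \<eta> where \<eta>: "0 < \<eta>" "\<eta> < h"
    "dir_deriv v f (translate (translate x \<xi> v) h w) - dir_deriv v f (translate (translate x \<xi> v) 0 w)
     = (h - 0) * dir_deriv w (dir_deriv v f) (translate (translate x \<xi> v) \<eta> w)"
    using MVT2[OF h, of "\<lambda>t. dir_deriv v f (translate (translate x \<xi> v) t w)"
        "\<lambda>t. dir_deriv w (dir_deriv v f) (translate (translate x \<xi> v) t w)"] by blast
  have "f (translate (translate x h v) h w) - f (translate x h v) - f (translate x h w) + f x
      = ?g h - ?g 0"
    by simp
  also have "\<dots> = h * h * dir_deriv w (dir_deriv v f) (translate (translate x \<xi> v) \<eta> w)"
    using \<xi>(3) \<eta>(3) by simp
  finally show ?thesis
    using \<xi> \<eta> by blast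
qed

text \<open>
  Schwarz's theorem: the second difference quotient of f over a small parallelogram is symmetric
  in the two directions, and by \<open>second_difference_eq\<close> both mixed derivatives are
  close to it.
\<close>

lemma dir_deriv_commute:
  assumes f: "smooth (aff_diff n) real_line f" and x: "x \<in> aff n"
    and v: "v \<in> aff_dir n" and w: "w \<in> aff_dir n"
  shows "dir_deriv v (dir_deriv w f) x = dir_deriv w (dir_deriv v f) x"
proof (rule ccontr)
  assume neq: "\<not> ?thesis"
  have lim: "\<exists>d>0. \<forall>s t. 0 < s \<and> s < d \<and> 0 < t \<and> t < d \<longrightarrow>
      \<bar>dir_deriv b (dir_deriv a f) (translate (translate x s a) t b) - dir_deriv b (dir_deriv a f) x\<bar> < e"
    if "e > 0" and a: "a \<in> aff_dir n" and b: "b \<in> aff_dir n" for e a b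
  proof -
    have "continuous_on UNIV (\<lambda>(s, t). dir_deriv b (dir_deriv a f) (translate (translate x s a) t b))"
      by (rule continuous_on_aff_plane[OF smooth_dir_deriv[OF smooth_dir_deriv[OF f a] b] x a b])
    then obtain d where d: "d > 0" "\<And>st. dist st (0, 0) < d \<Longrightarrow>
       dist (case st of (s, t) \<Rightarrow> dir_deriv b (dir_deriv a f) (translate (translate x s a) t b))
         (dir_deriv b (dir_deriv a f) x) < e"
      unfolding continuous_on_iff using \<open>e > 0\<close> by fastforce
    have "dist (s, t) (0, 0) < d" if "0 < s" "s < d/2" "0 < t" "t < d/2" for s t :: real
    proof -
      have "dist (s, t) (0, 0) \<le> \<bar>s\<bar> + \<bar>t\<bar>"
        using sqrt_sum_squares_le_sum_abs[of s t] by (simp add: dist_prod_def dist_real_def)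
      then show ?thesis using that by simp
    qed
    then show ?thesis
      using d by (intro exI[of _ "d/2"]) (fastforce simp: dist_real_def)
  qed
  define e where "e = \<bar>dir_deriv v (dir_deriv w f) x - dir_deriv w (dir_deriv v f) x\<bar> / 2"
  have e: "e > 0" using neq by (simp add: e_def)
  obtain d1 where d1: "d1 > 0" "\<And>s t. 0 < s \<Longrightarrow> s < d1 \<Longrightarrow> 0 < t \<Longrightarrow> t < d1 \<Longrightarrow>
      \<bar>dir_deriv w (dir_deriv v f) (translate (translate x s v) t w) - dir_deriv w (dir_deriv v f) x\<bar> < e"
    using lim[OF e v w] by blast
  obtain d2 where d2: "d2 > 0" "\<And>s t. 0 < s \<Longrightarrow> s < d2 \<Longrightarrow> 0 < t \<Longrightarrow> t < d2 \<Longrightarrow>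
      \<bar>dir_deriv v (dir_deriv w f) (translate (translate x s w) t v) - dir_deriv v (dir_deriv w f) x\<bar> < e"
    using lim[OF e w v] by blast
  define h where "h = min d1 d2"
  have h: "h > 0" "h \<le> d1" "h \<le> d2" using d1 d2 by (auto simp: h_def)
  obtain \<xi> \<eta> where 1: "0 < \<xi>" "\<xi> < h" "0 < \<eta>" "\<eta> < h"
    "f (translate (translate x h v) h w) - f (translate x h v) - f (translate x h w) + f x =
     h * h * dir_deriv w (dir_deriv v f) (translate (translate x \<xi> v) \<eta> w)"
    using second_difference_eq[OF f x v w h(1)] by blast
  obtain \<xi>' \<eta>' where 2: "0 < \<xi>'" "\<xi>' < h" "0 < \<eta>'" "\<eta>' < h"
    "f (translate (translate x h w) h v) - f (translate x h w) - f (translate x h v) + f x =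
     h * h * dir_deriv v (dir_deriv w f) (translate (translate x \<xi>' w) \<eta>' v)"
    using second_difference_eq[OF f x w v h(1)] by blast
  define a where "a = dir_deriv w (dir_deriv v f) (translate (translate x \<xi> v) \<eta> w)"
  define a' where "a' = dir_deriv v (dir_deriv w f) (translate (translate x \<xi>' w) \<eta>' v)"
  define b where "b = dir_deriv w (dir_deriv v f) x"
  define b' where "b' = dir_deriv v (dir_deriv w f) x"
  have "translate (translate x h w) h v = translate (translate x h v) h w"
    by (simp add: algebra_simps)
  then have eq: "f (translate (translate x h w) h v) = f (translate (translate x h v) h w)"
    by (rule arg_cong)
  have "h * h * a = h * h * a'"
    using 1(5) 2(5) unfolding a_def[symmetric] a'_def[symmetric] eq by linarith
  then have "a = a'"
    using h(1) by simp
  moreover have "\<bar>a - b\<bar> < e"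
    unfolding a_def b_def by (rule d1(2)) (use 1 h in linarith)+
  moreover have "\<bar>a' - b'\<bar> < e"
    unfolding a'_def b'_def by (rule d2(2)) (use 2 h in linarith)+
  moreover have "e = \<bar>b' - b\<bar> / 2"
    unfolding b_def b'_def by (rule e_def)
  moreover have "\<bar>b' - b\<bar> \<le> \<bar>a - b\<bar> + \<bar>a - b'\<bar>"
    using abs_triangle_ineq4[of "a - b" "a - b'"] by simp
  ultimately show False
    by simp
qed

section \<open>Alternating forms\<close>

definition alternation :: "('v list \<Rightarrow> real) \<Rightarrow> 'v list \<Rightarrow> real" where
  "alternation F vs = (\<Sum>\<sigma> | \<sigma> permutes {..<length vs}. of_int (sign \<sigma>) * F (permute_list \<sigma> vs))"

text \<open>
  Multilinearity and the vanishing on repeated arguments for all degrees at once, as in the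
  definition of a form at a fixed point.
\<close>

definition alternating :: "nat \<Rightarrow> ((nat \<Rightarrow> real) list \<Rightarrow> real) \<Rightarrow> bool" where
  "alternating n F \<longleftrightarrow> (\<forall>vs. set vs \<subseteq> aff_dir n \<longrightarrow>
     (\<forall>i<length vs. \<forall>v\<in>aff_dir n. \<forall>w\<in>aff_dir n. \<forall>r.
        F (vs[i := (\<lambda>k. r * v k + w k)]) = r * F (vs[i := v]) + F (vs[i := w])) \<and>
     (\<forall>i<length vs. \<forall>j<length vs. i \<noteq> j \<and> vs ! i = vs ! j \<longrightarrow> F vs = 0))"

lemma forms_iff:
  "\<omega> \<in> forms n \<longleftrightarrow>
     (\<forall>x vs. \<not> (x \<in> aff n \<and> set vs \<subseteq> aff_dir n) \<longrightarrow> \<omega> x vs = 0) \<and>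
     (\<forall>vs. set vs \<subseteq> aff_dir n \<longrightarrow> smooth (aff_diff n) real_line (\<lambda>x. \<omega> x vs)) \<and>
     (\<forall>x\<in>aff n. alternating n (\<omega> x))"
  by (simp only: forms_def mem_Collect_eq alternating_def)

lemma sign_square: "of_int (sign \<sigma>) * of_int (sign \<sigma>) = (1::real)"
  by (simp add: sign_def)

lemma sign_comp:
  assumes "\<sigma> permutes {..<k::nat}" "\<tau> permutes {..<k}"
  shows "sign (\<sigma> \<circ> \<tau>) = sign \<sigma> * sign \<tau>"
  by (rule sign_compose) (use assms permutes_imp_permutation[OF finite_lessThan] in blast)+

lemma alternation_cong:
  assumes "\<And>us. length us = length vs \<Longrightarrow> set us = set vs \<Longrightarrow> F us = F' us"
  shows "alternation F vs = alternation F' vs"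
  unfolding alternation_def
  by (rule sum.cong) (auto simp: assms)

lemma alternation_cmult: "alternation (\<lambda>us. c * F us) vs = c * alternation F vs"
  unfolding alternation_def by (simp add: sum_distrib_left mult.left_commute)

lemma alternation_add: "alternation (\<lambda>us. F us + F' us) vs = alternation F vs + alternation F' vs"
  unfolding alternation_def by (simp add: distrib_left sum.distrib)

lemma alternation_sum: "alternation (\<lambda>us. \<Sum>i\<in>I. F i us) vs = (\<Sum>i\<in>I. alternation (F i) vs)"
  unfolding alternation_def by (simp add: sum_distrib_left) (rule sum.swap)

lemma alternation_permute:
  assumes \<tau>: "\<tau> permutes {..<length vs}"
  shows "alternation (\<lambda>us. F (permute_list \<tau> us)) vs = of_int (sign \<tau>) * alternation F vs"
proof -
  let ?P = "{\<sigma>. \<sigma> permutes {..<length vs}}"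
  have "of_int (sign \<tau>) * alternation F vs
      = (\<Sum>\<sigma>\<in>?P. of_int (sign \<tau>) * (of_int (sign (\<sigma> \<circ> \<tau>)) * F (permute_list (\<sigma> \<circ> \<tau>) vs)))"
    unfolding alternation_def sum_distrib_left
    by (subst sum_permutations_compose_right[OF \<tau>]) simp
  also have "\<dots> = (\<Sum>\<sigma>\<in>?P. of_int (sign \<sigma>) * F (permute_list \<tau> (permute_list \<sigma> vs)))"
  proof (rule sum.cong[OF refl])
    fix \<sigma> assume "\<sigma> \<in> ?P"
    then have \<sigma>: "\<sigma> permutes {..<length vs}" by simp
    have "of_int (sign \<tau>) * of_int (sign (\<sigma> \<circ> \<tau>)) = (of_int (sign \<sigma>) :: real)"
      using sign_square[of \<tau>] by (simp add: sign_comp[OF \<sigma> \<tau>])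
    moreover have "permute_list (\<sigma> \<circ> \<tau>) vs = permute_list \<tau> (permute_list \<sigma> vs)"
      by (rule permute_list_compose[OF \<tau>])
    ultimately show "of_int (sign \<tau>) * (of_int (sign (\<sigma> \<circ> \<tau>)) * F (permute_list (\<sigma> \<circ> \<tau>) vs))
        = of_int (sign \<sigma>) * F (permute_list \<tau> (permute_list \<sigma> vs))"
      by (simp only: mult.assoc[symmetric])
  qed
  finally show ?thesis
    by (simp add: alternation_def)
qed

lemma sign_transpose_real: "a \<noteq> b \<Longrightarrow> of_int (sign (Transposition.transpose a b)) = (-1::real)"
  by (simp add: sign_swap_id)

text \<open>
  Alternating over a function that is symmetric in two arguments gives a number equal to its
  negative.
\<close>

lemma alternation_eq_0_if_symmetric:
  assumes ij: "i < length vs" "j < length vs" "i \<noteq> j"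
    and sym: "\<And>us. length us = length vs \<Longrightarrow> set us = set vs \<Longrightarrow> F (permute_list (Transposition.transpose i j) us) = F us"
  shows "alternation F vs = 0"
proof -
  have "Transposition.transpose i j permutes {..<length vs}"
    using ij by (intro permutes_swap_id) auto
  from alternation_permute[OF this, of F] have "alternation F vs = - alternation F vs"
    using alternation_cong[of vs "\<lambda>us. F (permute_list (Transposition.transpose i j) us)" F] sym
    by (simp add: sign_transpose_real[OF ij(3)])
  then show ?thesis by simp
qed

text \<open>Swapping the two equal entries matches the permutations in pairs of opposite sign.\<close>

lemma alternation_eq_0_if_repeated:
  assumes ij: "i < length vs" "j < length vs" "i \<noteq> j" and eq: "vs ! i = vs ! j"
  shows "alternation F vs = 0"
proof -
  let ?t = "Transposition.transpose i j"
  let ?P = "{\<sigma>. \<sigma> permutes {..<length vs}}"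
  have t: "?t permutes {..<length vs}"
    using ij by (intro permutes_swap_id) auto
  have "alternation F vs = (\<Sum>\<sigma>\<in>?P. of_int (sign (?t \<circ> \<sigma>)) * F (permute_list (?t \<circ> \<sigma>) vs))"
    unfolding alternation_def by (rule setum_permutations_compose_left[OF t])
  also have "\<dots> = (\<Sum>\<sigma>\<in>?P. - (of_int (sign \<sigma>) * F (permute_list \<sigma> vs)))"
  proof (rule sum.cong[OF refl])
    fix \<sigma> assume "\<sigma> \<in> ?P"
    then have \<sigma>: "\<sigma> permutes {..<length vs}" by simp
    have "vs ! ?t k = vs ! k" for k
      using eq by (simp add: Transposition.transpose_def)
    then have "permute_list (?t \<circ> \<sigma>) vs = permute_list \<sigma> vs"
      by (simp add: permute_list_def)
    then show "of_int (sign (?t \<circ> \<sigma>)) * F (permute_list (?t \<circ> \<sigma>) vs) = - (of_int (sign \<sigma>) * F (permute_list \<sigma> vs))"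
      using sign_comp[OF t \<sigma>] ij(3) by (simp add: sign_swap_id)
  qed
  finally have "alternation F vs = - alternation F vs"
    by (simp add: alternation_def sum_negf)
  then show ?thesis by simp
qed

lemma permute_list_adjacent:
  assumes "Suc j < length us"
  shows "permute_list (Transposition.transpose j (Suc j)) us = take j us @ us ! Suc j # us ! j # drop (Suc (Suc j)) us"
proof (rule nth_equalityI)
  fix i assume "i < length (permute_list (Transposition.transpose j (Suc j)) us)"
  then show "permute_list (Transposition.transpose j (Suc j)) us ! i = (take j us @ us ! Suc j # us ! j # drop (Suc (Suc j)) us) ! i"
    using assms
    by (auto simp: permute_list_def nth_append Transposition.transpose_def nth_Cons' min_def
        intro!: arg_cong[of _ _ "(!) us"])
qed (use assms in auto)

text \<open>
  The j adjacent transpositions that bring the j-th argument to the front each contribute a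
  sign.
\<close>

lemma alternation_move_to_front:
  assumes "j < length vs"
  shows "alternation (\<lambda>us. F (us ! j # take j us @ drop (Suc j) us)) vs = (-1) ^ j * alternation F vs"
  using assms
proof (induction j)
  case 0
  have "alternation (\<lambda>us. F (us ! 0 # take 0 us @ drop (Suc 0) us)) vs = alternation F vs"
  proof (rule alternation_cong)
    fix us :: "'a list" assume "length us = length vs"
    with 0 show "F (us ! 0 # take 0 us @ drop (Suc 0) us) = F us"
      by (cases us) auto
  qed
  then show ?case by simp
next
  case (Suc j)
  let ?t = "Transposition.transpose j (Suc j)"
  let ?F = "\<lambda>us. F (us ! j # take j us @ drop (Suc j) us)"
  have t: "?t permutes {..<length vs}"
    using Suc.prems by (intro permutes_swap_id) auto
  have "alternation (\<lambda>us. F (us ! Suc j # take (Suc j) us @ drop (Suc (Suc j)) us)) vs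
      = alternation (\<lambda>us. ?F (permute_list ?t us)) vs"
  proof (rule alternation_cong)
    fix us :: "'a list" assume l: "length us = length vs"
    have "take (Suc j) us = take j us @ [us ! j]"
      using Suc.prems l by (simp add: take_Suc_conv_app_nth)
    then show "F (us ! Suc j # take (Suc j) us @ drop (Suc (Suc j)) us) = ?F (permute_list ?t us)"
      using Suc.prems l by (simp add: permute_list_adjacent nth_append)
  qed
  also have "\<dots> = - alternation ?F vs"
    using alternation_permute[OF t, of ?F] by (simp add: sign_transpose_real)
  finally show ?case
    using Suc by simp
qed

text \<open>
  A permutation of the tail is a permutation of the whole list that fixes the first argument,
  with the same sign; the induction on transpositions avoids computing the sign of the
  extension.
\<close>

lemma alternation_permute_tail:
  assumes \<sigma>: "\<sigma> permutes {..<k}" and l: "length vs = Suc k"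
  shows "alternation (\<lambda>us. F (hd us # permute_list \<sigma> (tl us))) vs = of_int (sign \<sigma>) * alternation F vs"
  using \<sigma> finite_lessThan
proof (induction rule: permutes_induct)
  case id
  have "alternation (\<lambda>us. F (hd us # permute_list id (tl us))) vs = alternation F vs"
  proof (rule alternation_cong)
    fix us :: "'a list" assume "length us = length vs"
    with l show "F (hd us # permute_list id (tl us)) = F us"
      by (cases us) auto
  qed
  then show ?case by simp
next
  case (swap a b p)
  let ?H = "\<lambda>us. F (hd us # permute_list p (tl us))"
  have ab: "a < k" "b < k" "a \<noteq> b" using swap by auto
  have t: "Transposition.transpose a b permutes {..<k}"
    using ab by (intro permutes_swap_id) auto
  have T: "Transposition.transpose (Suc a) (Suc b) permutes {..<length vs}"
    using ab l by (intro permutes_swap_id) auto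
  have "alternation (\<lambda>us. F (hd us # permute_list (Transposition.transpose a b \<circ> p) (tl us))) vs
      = alternation (\<lambda>us. ?H (permute_list (Transposition.transpose (Suc a) (Suc b)) us)) vs"
  proof (rule alternation_cong)
    fix us :: "'a list" assume "length us = length vs"
    then obtain u ws where us: "us = u # ws" "length ws = k"
      using l by (cases us) auto
    have "permute_list (Transposition.transpose (Suc a) (Suc b)) us = u # permute_list (Transposition.transpose a b) ws"
    proof (rule nth_equalityI)
      fix i assume "i < length (permute_list (Transposition.transpose (Suc a) (Suc b)) us)"
      then show "permute_list (Transposition.transpose (Suc a) (Suc b)) us ! i = (u # permute_list (Transposition.transpose a b) ws) ! i"
        using ab us by (cases i) (auto simp: permute_list_def Transposition.transpose_def simp del: upt_Suc)
    qed (use us in simp)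
    moreover have "permute_list (Transposition.transpose a b \<circ> p) ws = permute_list p (permute_list (Transposition.transpose a b) ws)"
      using swap us by (intro permute_list_compose) auto
    ultimately show "F (hd us # permute_list (Transposition.transpose a b \<circ> p) (tl us))
        = ?H (permute_list (Transposition.transpose (Suc a) (Suc b)) us)"
      by (simp add: us)
  qed
  also have "\<dots> = - alternation ?H vs"
    using alternation_permute[OF T, of ?H] ab by (simp add: sign_transpose_real)
  also have "\<dots> = of_int (sign (Transposition.transpose a b \<circ> p)) * alternation F vs"
    using swap ab sign_comp[OF t] by (simp add: sign_swap_id)
  finally show ?case .
qed

subsection \<open>Permuting the arguments of alternating forms\<close>

lemma alternating_linear:
  assumes "alternating n F" "set vs \<subseteq> aff_dir n" "i < length vs" "v \<in> aff_dir n" "w \<in> aff_dir n"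
  shows "F (vs[i := (\<lambda>k. r * v k + w k)]) = r * F (vs[i := v]) + F (vs[i := w])"
  using assms unfolding alternating_def by blast

lemma alternating_repeated:
  assumes "alternating n F" "set vs \<subseteq> aff_dir n" "i < length vs" "j < length vs" "i \<noteq> j" "vs ! i = vs ! j"
  shows "F vs = 0"
  using assms unfolding alternating_def by blast

text \<open>Polarization: put the sum of both arguments in both places.\<close>

lemma alternating_swap:
  assumes F: "alternating n F" and vs: "set vs \<subseteq> aff_dir n"
    and ij: "i < length vs" "j < length vs" "i \<noteq> j"
  shows "F (permute_list (Transposition.transpose i j) vs) = - F vs"
proof -
  define v w where "v = vs ! i" and "w = vs ! j"
  have vw: "v \<in> aff_dir n" "w \<in> aff_dir n"
    using vs ij by (auto simp: v_def w_def)
  let ?s = "\<lambda>k. 1 * v k + w k"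
  have s: "?s \<in> aff_dir n" by (rule aff_dir_add_scaled[OF vw])
  have mem: "set (vs[j := a]) \<subseteq> aff_dir n" "set (vs[i := a]) \<subseteq> aff_dir n" if "a \<in> aff_dir n" for a
    using vs that set_update_subset_insert by fastforce+
  have lin_i: "F (vs[j := a, i := ?s]) = F (vs[j := a, i := v]) + F (vs[j := a, i := w])" if "a \<in> aff_dir n" for a
    using alternating_linear[OF F mem(1)[OF that], of i v w 1] vw ij by simp
  have lin_j: "F (vs[i := a, j := ?s]) = F (vs[i := a, j := v]) + F (vs[i := a, j := w])" if "a \<in> aff_dir n" for a
    using alternating_linear[OF F mem(2)[OF that], of j v w 1] vw ij by simp
  have comm: "vs[j := a, i := b] = vs[i := b, j := a]" for a b
    using ij(3) by (rule list_update_swap[symmetric])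
  have rep: "F (vs[i := a, j := a]) = 0" if "a \<in> aff_dir n" for a
  proof (rule alternating_repeated[OF F _ _ _ ij(3)])
    show "set (vs[i := a, j := a]) \<subseteq> aff_dir n"
      using vs that set_update_subset_insert[of "vs[i := a]" j a] set_update_subset_insert[of vs i a] by blast
  qed (use ij in auto)
  have "F (vs[i := ?s, j := ?s]) = F (vs[i := v, j := w]) + F (vs[i := w, j := v])"
    using lin_j[OF s] lin_i[OF vw(1)] lin_i[OF vw(2)] rep[OF vw(1)] rep[OF vw(2)]
    unfolding comm by simp
  then have "F (vs[i := w, j := v]) = - F (vs[i := v, j := w])"
    using rep[OF s] by linarith
  moreover have "vs[i := v, j := w] = vs"
    by (simp add: v_def w_def)
  moreover have "permute_list (Transposition.transpose i j) vs = vs[i := w, j := v]"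
  proof (rule nth_equalityI)
    fix k assume "k < length (permute_list (Transposition.transpose i j) vs)"
    then show "permute_list (Transposition.transpose i j) vs ! k = vs[i := w, j := v] ! k"
      using ij by (auto simp: permute_list_def Transposition.transpose_def nth_list_update v_def w_def)
  qed simp
  ultimately show ?thesis by simp
qed

lemma alternating_permute:
  assumes F: "alternating n F" and vs: "set vs \<subseteq> aff_dir n"
    and \<sigma>: "\<sigma> permutes {..<length vs}"
  shows "F (permute_list \<sigma> vs) = of_int (sign \<sigma>) * F vs"
  using finite_lessThan \<sigma>
proof (induction rule: permutes_rev_induct)
  case id
  then show ?case by simp
next
  case (swap a b p)
  have ab: "a < length vs" "b < length vs" "a \<noteq> b" using swap by auto
  have t: "Transposition.transpose a b permutes {..<length vs}"
    using ab by (intro permutes_swap_id) auto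
  have "permute_list (p \<circ> Transposition.transpose a b) vs = permute_list (Transposition.transpose a b) (permute_list p vs)"
    by (rule permute_list_compose[OF t])
  moreover have "F (permute_list (Transposition.transpose a b) (permute_list p vs)) = - F (permute_list p vs)"
    using swap ab vs by (intro alternating_swap[OF F]) auto
  moreover have "of_int (sign (p \<circ> Transposition.transpose a b)) = - (of_int (sign p) :: real)"
    using sign_comp[OF _ t, of p] swap ab by (simp add: sign_swap_id)
  ultimately show ?case
    by (simp only: mult_minus_left mult_minus_right swap.IH)
qed

lemma alternation_alternating:
  assumes F: "alternating n F" and vs: "set vs \<subseteq> aff_dir n"
  shows "alternation F vs = fact (length vs) * F vs"
proof -
  have "alternation F vs = (\<Sum>\<sigma> | \<sigma> permutes {..<length vs}. F vs)"
    unfolding alternation_def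
  proof (rule sum.cong[OF refl])
    fix \<sigma> assume "\<sigma> \<in> {\<sigma>. \<sigma> permutes {..<length vs}}"
    then show "of_int (sign \<sigma>) * F (permute_list \<sigma> vs) = F vs"
      using alternating_permute[OF F vs] sign_square[of \<sigma>] by (simp flip: mult.assoc)
  qed
  then show ?thesis
    by (simp add: card_permutations)
qed

lemma alternating_move:
  assumes F: "alternating n F"
  shows "set (ps @ a # qs @ rs) \<subseteq> aff_dir n \<Longrightarrow> F (ps @ a # qs @ rs) = (-1) ^ length qs * F (ps @ qs @ a # rs)"
proof (induction qs arbitrary: ps)
  case (Cons q qs)
  let ?us = "ps @ q # a # qs @ rs"
  have "permute_list (Transposition.transpose (length ps) (Suc (length ps))) ?us = ps @ a # q # qs @ rs"
    by (subst permute_list_adjacent) (auto simp: nth_append)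
  then have "F (ps @ a # q # qs @ rs) = - F ?us"
    using alternating_swap[OF F, of ?us "length ps" "Suc (length ps)"] Cons.prems by auto
  also have "F ?us = (-1) ^ length qs * F ((ps @ [q]) @ qs @ a # rs)"
    using Cons.IH[of "ps @ [q]"] Cons.prems by simp
  finally show ?case by simp
qed simp


subsection \<open>Directional derivatives of sums and products\<close>

lemma smooth_aff_add:
  "smooth (aff_diff n) real_line f \<Longrightarrow> smooth (aff_diff n) real_line g \<Longrightarrow>
   smooth (aff_diff n) real_line (\<lambda>x. f x + g x)"
  unfolding smooth_aff_iff by (auto intro!: Cinf_on_add)

lemma smooth_aff_mult:
  "smooth (aff_diff n) real_line f \<Longrightarrow> smooth (aff_diff n) real_line g \<Longrightarrow>
   smooth (aff_diff n) real_line (\<lambda>x. f x * g x)"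
  unfolding smooth_aff_iff by (auto intro!: Cinf_on_mult)

lemma smooth_aff_const: "smooth (aff_diff n) real_line (\<lambda>x. c)"
  unfolding smooth_aff_iff plot_aff_iff by (blast intro: Cinf_on_const)

lemma smooth_aff_cmult:
  "smooth (aff_diff n) real_line f \<Longrightarrow> smooth (aff_diff n) real_line (\<lambda>x. c * f x)"
  by (rule smooth_aff_mult[OF smooth_aff_const])

lemma smooth_aff_sum:
  "(\<And>i. i \<in> I \<Longrightarrow> smooth (aff_diff n) real_line (f i)) \<Longrightarrow>
   smooth (aff_diff n) real_line (\<lambda>x. \<Sum>i\<in>I. f i x)"
proof (induction I rule: infinite_finite_induct)
  case (insert i I)
  then show ?case by (simp add: smooth_aff_add)
qed (simp_all add: smooth_aff_const)

lemma smooth_aff_alternation: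
  assumes "\<And>us. length us = length vs \<Longrightarrow> set us = set vs \<Longrightarrow> smooth (aff_diff n) real_line (\<lambda>x. F x us)"
  shows "smooth (aff_diff n) real_line (\<lambda>x. alternation (F x) vs)"
  unfolding alternation_def
proof (rule smooth_aff_sum)
  fix \<sigma> assume "\<sigma> \<in> {\<sigma>. \<sigma> permutes {..<length vs}}"
  then show "smooth (aff_diff n) real_line (\<lambda>x. of_int (sign \<sigma>) * F x (permute_list \<sigma> vs))"
    by (intro smooth_aff_cmult assms) auto
qed

lemma dir_deriv_cong:
  assumes "\<And>y. y \<in> aff n \<Longrightarrow> f y = g y" "x \<in> aff n" "v \<in> aff_dir n"
  shows "dir_deriv v f x = dir_deriv v g x"
proof -
  have "(\<lambda>t. f (translate x t v)) = (\<lambda>t. g (translate x t v))"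
    using assms(1)[OF aff_translate[OF assms(2,3)]] by blast
  then show ?thesis by (simp only: dir_deriv_def)
qed

lemma dir_deriv_const: "dir_deriv v (\<lambda>x. c) x = 0"
  by (simp add: dir_deriv_def)

lemma dir_deriv_eqI:
  "((\<lambda>t. f (translate x t v)) has_real_derivative d) (at 0) \<Longrightarrow> dir_deriv v f x = d"
  unfolding dir_deriv_def by (rule DERIV_imp_deriv)

lemma dir_deriv_add:
  assumes "smooth (aff_diff n) real_line f" "smooth (aff_diff n) real_line g" "x \<in> aff n" "v \<in> aff_dir n"
  shows "dir_deriv v (\<lambda>x. f x + g x) x = dir_deriv v f x + dir_deriv v g x"
  by (rule dir_deriv_eqI) (rule DERIV_add[OF has_dir_deriv_0[OF assms(1,3,4)] has_dir_deriv_0[OF assms(2-4)]])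

lemma dir_deriv_mult:
  assumes "smooth (aff_diff n) real_line f" "smooth (aff_diff n) real_line g" "x \<in> aff n" "v \<in> aff_dir n"
  shows "dir_deriv v (\<lambda>x. f x * g x) x = dir_deriv v f x * g x + f x * dir_deriv v g x"
proof (rule dir_deriv_eqI)
  show "((\<lambda>t. f (translate x t v) * g (translate x t v)) has_real_derivative
      dir_deriv v f x * g x + f x * dir_deriv v g x) (at 0)"
    using DERIV_mult[OF has_dir_deriv_0[OF assms(1,3,4)] has_dir_deriv_0[OF assms(2-4)]]
    by (simp only: mult_zero_left add_0_right mult.commute)
qed

lemma dir_deriv_cmult:
  assumes "smooth (aff_diff n) real_line f" "x \<in> aff n" "v \<in> aff_dir n"
  shows "dir_deriv v (\<lambda>x. c * f x) x = c * dir_deriv v f x"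
  by (rule dir_deriv_eqI) (rule DERIV_cmult[OF has_dir_deriv_0[OF assms]])

lemma dir_deriv_sum:
  assumes "\<And>i. i \<in> I \<Longrightarrow> smooth (aff_diff n) real_line (f i)" "x \<in> aff n" "v \<in> aff_dir n"
  shows "dir_deriv v (\<lambda>x. \<Sum>i\<in>I. f i x) x = (\<Sum>i\<in>I. dir_deriv v (f i) x)"
  by (rule dir_deriv_eqI) (rule DERIV_sum[OF has_dir_deriv_0[OF assms]])

text \<open>
  Inside an alternation over all arguments, an alternation over all but the first repeats each
  term once for every permutation of the tail. This removes the inner alternations in dd = 0 and
  in the Leibniz rule.
\<close>

lemma alternation_dir_deriv:
  assumes F: "\<And>us. length us = k \<Longrightarrow> set us \<subseteq> aff_dir n \<Longrightarrow> smooth (aff_diff n) real_line (\<lambda>x. F x us)"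
    and x: "x \<in> aff n" and vs: "set vs \<subseteq> aff_dir n" "length vs = Suc k"
  shows "alternation (\<lambda>us. dir_deriv (hd us) (\<lambda>y. alternation (F y) (tl us)) x) vs
       = fact k * alternation (\<lambda>us. dir_deriv (hd us) (\<lambda>y. F y (tl us)) x) vs"
proof -
  let ?P = "{\<sigma>. \<sigma> permutes {..<k}}"
  let ?D = "\<lambda>us. dir_deriv (hd us) (\<lambda>y. F y (tl us)) x"
  have "alternation (\<lambda>us. dir_deriv (hd us) (\<lambda>y. alternation (F y) (tl us)) x) vs
      = alternation (\<lambda>us. \<Sum>\<sigma>\<in>?P. of_int (sign \<sigma>) * ?D (hd us # permute_list \<sigma> (tl us))) vs"
  proof (rule alternation_cong)
    fix us :: "(nat \<Rightarrow> real) list" assume us: "length us = length vs" "set us = set vs"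
    then obtain u ws where [simp]: "us = u # ws" and ws: "length ws = k"
      using vs by (cases us) auto
    have u: "u \<in> aff_dir n" "set ws \<subseteq> aff_dir n"
      using us vs by auto
    have sm: "smooth (aff_diff n) real_line (\<lambda>y. F y (permute_list \<sigma> ws))" if "\<sigma> \<in> ?P" for \<sigma>
      using that u ws by (intro F) auto
    have "dir_deriv u (\<lambda>y. alternation (F y) ws) x
        = (\<Sum>\<sigma>\<in>?P. dir_deriv u (\<lambda>y. of_int (sign \<sigma>) * F y (permute_list \<sigma> ws)) x)"
      unfolding alternation_def ws
      by (rule dir_deriv_sum[OF smooth_aff_cmult[OF sm] x u(1)])
    also have "\<dots> = (\<Sum>\<sigma>\<in>?P. of_int (sign \<sigma>) * dir_deriv u (\<lambda>y. F y (permute_list \<sigma> ws)) x)"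
      by (rule sum.cong[OF refl]) (rule dir_deriv_cmult[OF sm x u(1)])
    finally show "dir_deriv (hd us) (\<lambda>y. alternation (F y) (tl us)) x
        = (\<Sum>\<sigma>\<in>?P. of_int (sign \<sigma>) * ?D (hd us # permute_list \<sigma> (tl us)))"
      by simp
  qed
  also have "\<dots> = (\<Sum>\<sigma>\<in>?P. of_int (sign \<sigma>) * (of_int (sign \<sigma>) * alternation ?D vs))"
    unfolding alternation_sum alternation_cmult
  proof (rule sum.cong[OF refl])
    fix \<sigma> assume "\<sigma> \<in> ?P"
    then have "\<sigma> permutes {..<k}" by simp
    from alternation_permute_tail[OF this vs(2), of ?D]
    show "of_int (sign \<sigma>) * alternation (\<lambda>us. ?D (hd us # permute_list \<sigma> (tl us))) vs
        = of_int (sign \<sigma>) * (of_int (sign \<sigma>) * alternation ?D vs)"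
      by (simp only:)
  qed
  also have "\<dots> = (\<Sum>\<sigma>\<in>?P. alternation ?D vs)"
    by (simp only: mult.assoc[symmetric] sign_square mult_1)
  also have "\<dots> = fact k * alternation ?D vs"
    by (simp add: card_permutations)
  finally show ?thesis .
qed

section \<open>Wedge product and exterior derivative\<close>

lemma
  assumes "\<omega> \<in> forms n"
  shows forms_smooth: "set vs \<subseteq> aff_dir n \<Longrightarrow> smooth (aff_diff n) real_line (\<lambda>x. \<omega> x vs)"
    and forms_alternating: "x \<in> aff n \<Longrightarrow> alternating n (\<omega> x)"
    and forms_outside: "\<not> (x \<in> aff n \<and> set vs \<subseteq> aff_dir n) \<Longrightarrow> \<omega> x vs = 0"
  using assms unfolding forms_iff by blast+

lemma wedge_alternation:
  "wedge \<alpha> \<beta> x vs = (\<Sum>p\<le>length vs. (1 / (fact p * fact (length vs - p))) *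
     alternation (\<lambda>us. \<alpha> x (take p us) * \<beta> x (drop p us)) vs)"
  unfolding wedge_def Let_def alternation_def
proof (rule sum.cong[OF refl])
  fix p assume p: "p \<in> {..length vs}"
  have "of_int (sign \<sigma>) * \<alpha> x (map (\<lambda>i. vs ! \<sigma> i) [0..<p]) * \<beta> x (map (\<lambda>i. vs ! \<sigma> i) [p..<length vs])
      = of_int (sign \<sigma>) * (\<alpha> x (take p (permute_list \<sigma> vs)) * \<beta> x (drop p (permute_list \<sigma> vs)))" for \<sigma>
  proof -
    have "map (\<lambda>i. vs ! \<sigma> i) [0..<p] = take p (permute_list \<sigma> vs)"
      using p by (simp add: permute_list_def take_map)
    moreover have "map (\<lambda>i. vs ! \<sigma> i) [p..<length vs] = drop p (permute_list \<sigma> vs)"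
      by (simp add: permute_list_def drop_map)
    ultimately show ?thesis
      by (simp only: mult.assoc)
  qed
  then show "(1 / (fact p * fact (length vs - p))) *
       (\<Sum>\<sigma> | \<sigma> permutes {..<length vs}. of_int (sign \<sigma>) *
          \<alpha> x (map (\<lambda>i. vs ! \<sigma> i) [0..<p]) * \<beta> x (map (\<lambda>i. vs ! \<sigma> i) [p..<length vs])) =
      (1 / (fact p * fact (length vs - p))) * (\<Sum>\<sigma> | \<sigma> permutes {..<length vs}. of_int (sign \<sigma>) *
          (\<alpha> x (take p (permute_list \<sigma> vs)) * \<beta> x (drop p (permute_list \<sigma> vs))))"
    by (simp only:)
qed

lemma form_d_dir_deriv:
  assumes "x \<in> aff n" "set vs \<subseteq> aff_dir n"
  shows "form_d n \<omega> x vs = (\<Sum>i<length vs. (-1) ^ i * dir_deriv (vs ! i) (\<lambda>y. \<omega> y (take i vs @ drop (Suc i) vs)) x)"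
  using assms by (simp add: form_d_def dir_deriv_def)


lemma set_take_drop: "set vs \<subseteq> A \<Longrightarrow> set (take p vs) \<subseteq> A \<and> set (drop p vs) \<subseteq> A"
  by (meson order_trans set_drop_subset set_take_subset)

lemma wedge_outside:
  assumes \<alpha>: "\<And>vs. \<not> (x \<in> aff n \<and> set vs \<subseteq> aff_dir n) \<Longrightarrow> \<alpha> x vs = 0"
    and \<beta>: "\<And>vs. \<not> (x \<in> aff n \<and> set vs \<subseteq> aff_dir n) \<Longrightarrow> \<beta> x vs = 0"
    and out: "\<not> (x \<in> aff n \<and> set vs \<subseteq> aff_dir n)"
  shows "wedge \<alpha> \<beta> x vs = 0"
proof -
  have "alternation (\<lambda>us. \<alpha> x (take p us) * \<beta> x (drop p us)) vs = alternation (\<lambda>us. 0) vs" for p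
  proof (rule alternation_cong)
    fix us :: "(nat \<Rightarrow> real) list" assume "set us = set vs"
    then have "\<not> (x \<in> aff n \<and> set (take p us) \<subseteq> aff_dir n) \<or> \<not> (x \<in> aff n \<and> set (drop p us) \<subseteq> aff_dir n)"
      using out by (metis append_take_drop_id le_sup_iff set_append)
    then show "\<alpha> x (take p us) * \<beta> x (drop p us) = 0"
      using \<alpha> \<beta> by fastforce
  qed
  then show ?thesis
    by (simp add: wedge_alternation alternation_def)
qed

lemma smooth_wedge_summand:
  assumes \<alpha>: "\<alpha> \<in> forms n" and \<beta>: "\<beta> \<in> forms n" and us: "set us \<subseteq> aff_dir n"
  shows "smooth (aff_diff n) real_line (\<lambda>x. \<alpha> x (take p us) * \<beta> x (drop p us))"
  using set_take_drop[OF us] by (intro smooth_aff_mult forms_smooth[OF \<alpha>] forms_smooth[OF \<beta>]) auto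

lemma permute_list_update:
  assumes \<sigma>: "\<sigma> permutes {..<length vs}" and i: "i < length vs"
  shows "permute_list \<sigma> (vs[i := v]) = (permute_list \<sigma> vs)[inv_into UNIV \<sigma> i := v]"
proof (rule nth_equalityI)
  fix k assume "k < length (permute_list \<sigma> (vs[i := v]))"
  then have k: "k < length vs" by simp
  then have "\<sigma> k < length vs"
    using permutes_in_image[OF \<sigma>, of k] by simp
  moreover have "\<sigma> k = i \<longleftrightarrow> inv_into UNIV \<sigma> i = k"
    using permutes_inv_eq[OF \<sigma>] by auto
  ultimately show "permute_list \<sigma> (vs[i := v]) ! k = (permute_list \<sigma> vs)[inv_into UNIV \<sigma> i := v] ! k"
    using k by (auto simp: permute_list_def nth_list_update)
qed simp

text \<open>Each summand is an alternation of a function that is linear in every argument.\<close>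

lemma wedge_in_forms:
  assumes \<alpha>: "\<alpha> \<in> forms n" and \<beta>: "\<beta> \<in> forms n"
  shows "wedge \<alpha> \<beta> \<in> forms n"
  unfolding forms_iff
proof (intro conjI allI impI ballI)
  fix x vs assume "\<not> (x \<in> aff n \<and> set vs \<subseteq> aff_dir n)"
  with forms_outside[OF \<alpha>] forms_outside[OF \<beta>] show "wedge \<alpha> \<beta> x vs = 0"
    by (rule wedge_outside)
next
  fix vs assume vs: "set vs \<subseteq> aff_dir n"
  show "smooth (aff_diff n) real_line (\<lambda>x. wedge \<alpha> \<beta> x vs)"
    unfolding wedge_alternation using vs
    by (intro smooth_aff_sum smooth_aff_cmult smooth_aff_alternation smooth_wedge_summand[OF \<alpha> \<beta>]) simp
next
  fix x assume x: "x \<in> aff n"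
  let ?F = "\<lambda>p us. \<alpha> x (take p us) * \<beta> x (drop p us)"
  have lin: "?F p (us[m := (\<lambda>k. r * v k + w k)]) = r * ?F p (us[m := v]) + ?F p (us[m := w])"
    if us: "set us \<subseteq> aff_dir n" "m < length us" and v: "v \<in> aff_dir n" and w: "w \<in> aff_dir n" for p us m v w r
  proof (cases "m < p")
    case True
    have "\<alpha> x ((take p us)[m := (\<lambda>k. r * v k + w k)]) = r * \<alpha> x ((take p us)[m := v]) + \<alpha> x ((take p us)[m := w])"
      using us True set_take_drop[OF us(1)] by (intro alternating_linear[OF forms_alternating[OF \<alpha> x] _ _ v w]) auto
    then show ?thesis
      using True by (simp add: take_update_swap drop_update_cancel distrib_right)
  next
    case False
    have "\<beta> x ((drop p us)[m - p := (\<lambda>k. r * v k + w k)]) = r * \<beta> x ((drop p us)[m - p := v]) + \<beta> x ((drop p us)[m - p := w])"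
      using us False set_take_drop[OF us(1)] by (intro alternating_linear[OF forms_alternating[OF \<beta> x] _ _ v w]) auto
    then show ?thesis
      using False by (simp add: drop_update_swap take_update_cancel distrib_left mult.left_commute)
  qed
  have alt: "alternation (?F p) (vs[i := (\<lambda>k. r * v k + w k)]) = r * alternation (?F p) (vs[i := v]) + alternation (?F p) (vs[i := w])"
    if vs: "set vs \<subseteq> aff_dir n" "i < length vs" and v: "v \<in> aff_dir n" and w: "w \<in> aff_dir n" for p vs i v w r
  proof -
    let ?P = "{\<sigma>. \<sigma> permutes {..<length vs}}"
    have "alternation (?F p) (vs[i := (\<lambda>k. r * v k + w k)])
        = (\<Sum>\<sigma>\<in>?P. r * (of_int (sign \<sigma>) * ?F p (permute_list \<sigma> (vs[i := v]))) + of_int (sign \<sigma>) * ?F p (permute_list \<sigma> (vs[i := w])))"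
      unfolding alternation_def length_list_update
    proof (rule sum.cong[OF refl])
      fix \<sigma> assume "\<sigma> \<in> ?P"
      then have \<sigma>: "\<sigma> permutes {..<length vs}" by simp
      have "inv_into UNIV \<sigma> i < length vs"
        using permutes_in_image[OF permutes_inv[OF \<sigma>], of i] vs by simp
      then have "?F p (permute_list \<sigma> (vs[i := (\<lambda>k. r * v k + w k)]))
          = r * ?F p (permute_list \<sigma> (vs[i := v])) + ?F p (permute_list \<sigma> (vs[i := w]))"
        unfolding permute_list_update[OF \<sigma> vs(2)]
        by (intro lin v w) (use \<sigma> vs in auto)
      then show "of_int (sign \<sigma>) * ?F p (permute_list \<sigma> (vs[i := (\<lambda>k. r * v k + w k)])) =
          r * (of_int (sign \<sigma>) * ?F p (permute_list \<sigma> (vs[i := v]))) + of_int (sign \<sigma>) * ?F p (permute_list \<sigma> (vs[i := w]))"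
        by (simp only: distrib_left mult.left_commute)
    qed
    then show ?thesis
      unfolding alternation_def length_list_update sum.distrib sum_distrib_left[symmetric] .
  qed
  show "alternating n (wedge \<alpha> \<beta> x)"
    unfolding alternating_def
  proof (intro allI impI conjI ballI)
    fix vs :: "(nat \<Rightarrow> real) list" and i v w r
    assume "set vs \<subseteq> aff_dir n" "i < length vs" "v \<in> aff_dir n" "w \<in> aff_dir n"
    note * = alt[OF this]
    show "wedge \<alpha> \<beta> x (vs[i := (\<lambda>k. r * v k + w k)]) = r * wedge \<alpha> \<beta> x (vs[i := v]) + wedge \<alpha> \<beta> x (vs[i := w])"
      unfolding wedge_alternation length_list_update * distrib_left sum.distrib sum_distrib_left
      by (simp only: mult.left_commute)
  next
    fix vs :: "(nat \<Rightarrow> real) list" and i j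
    assume "i < length vs" "j < length vs" "i \<noteq> j \<and> vs ! i = vs ! j"
    then show "wedge \<alpha> \<beta> x vs = 0"
      unfolding wedge_alternation using alternation_eq_0_if_repeated[of i vs j] by simp
  qed
qed

definition remove_nth :: "nat \<Rightarrow> 'v list \<Rightarrow> 'v list" where
  "remove_nth i vs = take i vs @ drop (Suc i) vs"

lemma set_remove_nth: "set vs \<subseteq> A \<Longrightarrow> set (remove_nth i vs) \<subseteq> A"
  unfolding remove_nth_def using set_take_drop by fastforce

lemma length_remove_nth: "i < length vs \<Longrightarrow> length (remove_nth i vs) = length vs - 1"
  by (simp add: remove_nth_def)

lemma remove_nth_update_same: "remove_nth i (vs[i := v]) = remove_nth i vs"
  by (simp add: remove_nth_def)

lemma remove_nth_update:
  assumes "l < length vs" "i < length vs" "i \<noteq> l"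
  shows "remove_nth l (vs[i := v]) = (remove_nth l vs)[(if i < l then i else i - 1) := v]"
proof (cases "i < l")
  case True
  then show ?thesis
    using assms by (simp add: remove_nth_def take_update_swap drop_update_cancel list_update_append)
next
  case False
  with assms have "i - 1 - l = i - Suc l" "\<not> i - 1 < l" by auto
  then show ?thesis
    using assms False by (simp add: remove_nth_def drop_update_swap take_update_cancel list_update_append)
qed

lemma nth_remove_nth:
  assumes "l < length vs" "i < length vs" "i \<noteq> l"
  shows "remove_nth l vs ! (if i < l then i else i - 1) = vs ! i"
  using assms by (auto simp: remove_nth_def nth_append min_def)

lemma form_d_remove_nth:
  assumes "x \<in> aff n" "set vs \<subseteq> aff_dir n"
  shows "form_d n \<omega> x vs = (\<Sum>i<length vs. (-1) ^ i * dir_deriv (vs ! i) (\<lambda>y. \<omega> y (remove_nth i vs)) x)"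
  using assms by (simp add: form_d_def dir_deriv_def remove_nth_def)

lemma form_d_outside: "\<not> (x \<in> aff n \<and> set vs \<subseteq> aff_dir n) \<Longrightarrow> form_d n \<omega> x vs = 0"
  by (simp only: form_d_def if_False)

lemma form_d_Nil: "form_d n \<omega> x [] = 0"
  by (simp add: form_d_def)

lemma smooth_aff_cong:
  assumes "smooth (aff_diff n) real_line f" "\<And>x. x \<in> aff n \<Longrightarrow> f x = g x"
  shows "smooth (aff_diff n) real_line g"
  unfolding smooth_aff_iff
proof (intro allI impI)
  fix m U p assume p: "plot (aff_diff n) m U p"
  show "Cinf_on m U (\<lambda>u. g (p u))"
  proof (rule Cinf_on_cong)
    show "Cinf_on m U (\<lambda>u. f (p u))"
      using assms(1) p unfolding smooth_aff_iff by blast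
    show "f (p u) = g (p u)" if "u \<in> U" for u
      using p that assms(2) unfolding plot_aff_iff by blast
  qed
qed

text \<open>
  If two arguments at places i < j coincide, then only the terms that omit one of them survive;
  these two terms differ by a cyclic shift of the arguments between i and j and cancel.
  Linearity in the direction of differentiation is \<open>dir_deriv_linear\<close>.
\<close>

lemma form_d_in_forms:
  assumes \<omega>: "\<omega> \<in> forms n"
  shows "form_d n \<omega> \<in> forms n"
  unfolding forms_iff
proof (intro conjI allI impI ballI)
  fix x vs assume "\<not> (x \<in> aff n \<and> set vs \<subseteq> aff_dir n)"
  then show "form_d n \<omega> x vs = 0"
    by (rule form_d_outside)
next
  fix vs assume vs: "set vs \<subseteq> aff_dir n"
  show "smooth (aff_diff n) real_line (\<lambda>x. form_d n \<omega> x vs)"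
  proof (rule smooth_aff_cong)
    show "smooth (aff_diff n) real_line (\<lambda>x. \<Sum>i<length vs. (-1) ^ i * dir_deriv (vs ! i) (\<lambda>y. \<omega> y (remove_nth i vs)) x)"
      using vs by (intro smooth_aff_sum smooth_aff_cmult smooth_dir_deriv forms_smooth[OF \<omega>] set_remove_nth) auto
  qed (rule form_d_remove_nth[OF _ vs, symmetric])
next
  fix x assume x: "x \<in> aff n"
  let ?T = "\<lambda>vs l. (-1) ^ l * dir_deriv (vs ! l) (\<lambda>y. \<omega> y (remove_nth l vs)) x"
  have T: "?T (vs[i := (\<lambda>k. r * v k + w k)]) l = r * ?T (vs[i := v]) l + ?T (vs[i := w]) l"
    if vs: "set vs \<subseteq> aff_dir n" "i < length vs" "l < length vs" and v: "v \<in> aff_dir n" and w: "w \<in> aff_dir n"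
    for vs i l v w r
  proof (cases "l = i")
    case True
    show ?thesis
      using dir_deriv_linear[OF forms_smooth[OF \<omega> set_remove_nth[OF vs(1)]] x v w, of r i] vs
      by (simp add: True remove_nth_update_same algebra_simps)
  next
    case False
    let ?m = "if i < l then i else i - 1"
    let ?R = "remove_nth l vs"
    have m: "?m < length ?R"
      using vs False by (auto simp: length_remove_nth)
    have R: "set ?R \<subseteq> aff_dir n"
      by (rule set_remove_nth[OF vs(1)])
    have u: "vs ! l \<in> aff_dir n"
      using vs by auto
    have sm: "smooth (aff_diff n) real_line (\<lambda>y. \<omega> y (?R[?m := a]))" if "a \<in> aff_dir n" for a
      by (rule forms_smooth[OF \<omega>]) (use R that set_update_subset_insert in fastforce)
    have "dir_deriv (vs ! l) (\<lambda>y. \<omega> y (?R[?m := (\<lambda>k. r * v k + w k)])) x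
        = dir_deriv (vs ! l) (\<lambda>y. r * \<omega> y (?R[?m := v]) + \<omega> y (?R[?m := w])) x"
      by (rule dir_deriv_cong[OF _ x u]) (rule alternating_linear[OF forms_alternating[OF \<omega>] R m v w])
    also have "\<dots> = r * dir_deriv (vs ! l) (\<lambda>y. \<omega> y (?R[?m := v])) x + dir_deriv (vs ! l) (\<lambda>y. \<omega> y (?R[?m := w])) x"
      unfolding dir_deriv_add[OF smooth_aff_cmult[OF sm[OF v]] sm[OF w] x u] dir_deriv_cmult[OF sm[OF v] x u] ..
    finally show ?thesis
      using remove_nth_update[OF vs(3,2)] False
      by (simp only: nth_list_update_neq not_sym[OF False] distrib_left mult.left_commute simp_thms False)
  qed
  show "alternating n (form_d n \<omega> x)"
    unfolding alternating_def
  proof (intro allI impI conjI ballI)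
    fix vs :: "(nat \<Rightarrow> real) list" and i v w r
    assume vs: "set vs \<subseteq> aff_dir n" "i < length vs" and v: "v \<in> aff_dir n" and w: "w \<in> aff_dir n"
    have mem: "set (vs[i := a]) \<subseteq> aff_dir n" if "a \<in> aff_dir n" for a
      using vs that set_update_subset_insert by fastforce
    show "form_d n \<omega> x (vs[i := (\<lambda>k. r * v k + w k)]) = r * form_d n \<omega> x (vs[i := v]) + form_d n \<omega> x (vs[i := w])"
      unfolding form_d_remove_nth[OF x mem[OF aff_dir_add_scaled[OF v w]]] form_d_remove_nth[OF x mem[OF v]]
        form_d_remove_nth[OF x mem[OF w]] length_list_update sum_distrib_left sum.distrib[symmetric]
      by (rule sum.cong[OF refl]) (use T[OF vs _ v w] in blast)
  next
    have key: "form_d n \<omega> x vs = 0"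
      if vs: "set vs \<subseteq> aff_dir n" and ij: "i < j" "j < length vs" "vs ! i = vs ! j" for vs :: "(nat \<Rightarrow> real) list" and i j
    proof -
      have "form_d n \<omega> x vs = (\<Sum>l<length vs. ?T vs l)"
        by (rule form_d_remove_nth[OF x vs])
      also have "\<dots> = (\<Sum>l\<in>{i, j}. ?T vs l)"
      proof (rule sum.mono_neutral_right)
        show "\<forall>l\<in>{..<length vs} - {i, j}. ?T vs l = 0"
        proof
          fix l assume "l \<in> {..<length vs} - {i, j}"
          then have l: "l < length vs" "i \<noteq> l" "j \<noteq> l" by auto
          have "dir_deriv (vs ! l) (\<lambda>y. \<omega> y (remove_nth l vs)) x = dir_deriv (vs ! l) (\<lambda>y. 0) x"
          proof (rule dir_deriv_cong[OF _ x])
            fix y assume y: "y \<in> aff n"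
            show "\<omega> y (remove_nth l vs) = 0"
            proof (rule alternating_repeated[OF forms_alternating[OF \<omega> y] set_remove_nth[OF vs]])
              show "remove_nth l vs ! (if i < l then i else i - 1) = remove_nth l vs ! (if j < l then j else j - 1)"
                using nth_remove_nth l ij by (metis order_less_trans)
            qed (use l ij in \<open>auto simp: length_remove_nth\<close>)
          qed (use l vs in auto)
          then show "?T vs l = 0" by (simp add: dir_deriv_const)
        qed
      qed (use ij in auto)
      also have "\<dots> = 0"
      proof -
        define a ps qs rs where "a = vs ! i" and "ps = take i vs"
          and "qs = take (j - Suc i) (drop (Suc i) vs)" and "rs = drop (Suc j) vs"
        have "drop (Suc i) vs = qs @ a # rs"
        proof -
          have "drop (Suc i) vs = take (j - Suc i) (drop (Suc i) vs) @ drop (Suc i) vs ! (j - Suc i) # drop (Suc (j - Suc i)) (drop (Suc i) vs)"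
            using ij by (intro id_take_nth_drop) auto
          moreover have "drop (Suc i) vs ! (j - Suc i) = a" "drop (Suc (j - Suc i)) (drop (Suc i) vs) = rs"
            using ij by (auto simp: a_def rs_def)
          ultimately show ?thesis
            by (simp only: qs_def)
        qed
        moreover have "vs = ps @ a # drop (Suc i) vs"
          unfolding ps_def a_def by (rule id_take_nth_drop) (use ij in simp)
        ultimately have v: "vs = ps @ a # qs @ a # rs" by simp
        have l: "length ps = i" "length qs = j - Suc i"
          using ij by (auto simp: ps_def qs_def)
        have Ri: "remove_nth i vs = ps @ qs @ a # rs"
          unfolding remove_nth_def v using l ij by simp
        have "take j vs = ps @ a # qs"
          using l ij by (subst v) (simp add: take_Cons')
        then have Rj: "remove_nth j vs = ps @ a # qs @ rs"
          by (simp add: remove_nth_def rs_def)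
        have a: "a \<in> aff_dir n" using vs v by (metis in_set_conv_decomp subsetD)
        have "dir_deriv a (\<lambda>y. \<omega> y (remove_nth j vs)) x
            = dir_deriv a (\<lambda>y. (-1) ^ length qs * \<omega> y (remove_nth i vs)) x"
        proof (rule dir_deriv_cong[OF _ x a])
          fix y assume y: "y \<in> aff n"
          show "\<omega> y (remove_nth j vs) = (-1) ^ length qs * \<omega> y (remove_nth i vs)"
            unfolding Ri Rj using vs v by (intro alternating_move[OF forms_alternating[OF \<omega> y]]) auto
        qed
        also have "\<dots> = (-1) ^ length qs * dir_deriv a (\<lambda>y. \<omega> y (remove_nth i vs)) x"
          by (rule dir_deriv_cmult[OF forms_smooth[OF \<omega> set_remove_nth[OF vs]] x a])
        finally have "?T vs j = (-1) ^ (j + length qs) * dir_deriv a (\<lambda>y. \<omega> y (remove_nth i vs)) x"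
          using ij by (simp add: a_def power_add)
        moreover have "j + length qs = Suc i + 2 * length qs"
          using l ij by simp
        ultimately have "?T vs j = - ?T vs i"
          by (simp add: a_def power_add)
        then show ?thesis
          using ij by simp
      qed
      finally show ?thesis .
    qed
    fix vs :: "(nat \<Rightarrow> real) list" and i j
    assume "set vs \<subseteq> aff_dir n" "i < length vs" "j < length vs" "i \<noteq> j \<and> vs ! i = vs ! j"
    then show "form_d n \<omega> x vs = 0"
      using key[of vs i j] key[of vs j i] by (cases "i < j") auto
  qed
qed

text \<open>
  The sum over the omitted argument is an alternation in which the permutations of the remaining
  arguments have been carried out already, since \<open>\<omega>\<close> is alternating.
\<close>

lemma form_d_alternation:
  assumes \<omega>: "\<omega> \<in> forms n" and x: "x \<in> aff n" and vs: "set vs \<subseteq> aff_dir n" "length vs = Suc k"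
  shows "form_d n \<omega> x vs = (1 / fact k) * alternation (\<lambda>us. dir_deriv (hd us) (\<lambda>y. \<omega> y (tl us)) x) vs"
proof -
  let ?D = "\<lambda>us. dir_deriv (hd us) (\<lambda>y. \<omega> y (tl us)) x"
  have "fact (Suc k) * form_d n \<omega> x vs = alternation (form_d n \<omega> x) vs"
    using alternation_alternating[OF forms_alternating[OF form_d_in_forms[OF \<omega>] x] vs(1)] vs(2) by simp
  also have "\<dots> = alternation (\<lambda>us. \<Sum>i<Suc k. (-1) ^ i * ?D (us ! i # take i us @ drop (Suc i) us)) vs"
  proof (rule alternation_cong)
    fix us :: "(nat \<Rightarrow> real) list" assume "length us = length vs" "set us = set vs"
    then show "form_d n \<omega> x us = (\<Sum>i<Suc k. (-1) ^ i * ?D (us ! i # take i us @ drop (Suc i) us))"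
      using form_d_dir_deriv[OF x, of us \<omega>] vs by simp
  qed
  also have "\<dots> = (\<Sum>i<Suc k. (-1) ^ i * ((-1) ^ i * alternation ?D vs))"
    unfolding alternation_sum alternation_cmult
  proof (rule sum.cong[OF refl])
    fix i assume "i \<in> {..<Suc k}"
    then have "i < length vs" using vs by simp
    from alternation_move_to_front[OF this, of ?D]
    show "(-1) ^ i * alternation (\<lambda>us. ?D (us ! i # take i us @ drop (Suc i) us)) vs = (-1) ^ i * ((-1) ^ i * alternation ?D vs)"
      by (simp only:)
  qed
  also have "\<dots> = real (Suc k) * alternation ?D vs"
    by (simp flip: mult.assoc power_mult_distrib)
  finally have "real (Suc k) * (fact k * form_d n \<omega> x vs) = real (Suc k) * alternation ?D vs"
    by (simp only: fact_Suc mult.assoc)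
  then have "fact k * form_d n \<omega> x vs = alternation ?D vs"
    by (simp only: mult_cancel_left of_nat_eq_0_iff nat.distinct simp_thms)
  then show ?thesis
    by (simp add: field_simps)
qed

text \<open>
  By \<open>form_d_alternation\<close>, dd is the alternation of an iterated directional
  derivative, which is symmetric in its two directions.
\<close>

lemma form_d_form_d:
  assumes \<omega>: "\<omega> \<in> forms n"
  shows "form_d n (form_d n \<omega>) = (\<lambda>x vs. 0)"
proof (intro ext)
  fix x vs
  show "form_d n (form_d n \<omega>) x vs = 0"
  proof (cases "x \<in> aff n \<and> set vs \<subseteq> aff_dir n")
    case False
    then show ?thesis by (rule form_d_outside)
  next
    case True
    then have x: "x \<in> aff n" and vs: "set vs \<subseteq> aff_dir n" by auto
    consider "vs = []" | "length vs = Suc 0" | k where "length vs = Suc (Suc k)"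
      by (metis length_0_conv not0_implies_Suc)
    then show ?thesis
    proof cases
      case 1
      then show ?thesis by (simp add: form_d_Nil)
    next
      case 2
      then obtain v where "vs = [v]" by (auto simp: length_Suc_conv)
      then show ?thesis
        using form_d_remove_nth[OF x vs] by (simp add: remove_nth_def form_d_Nil dir_deriv_const)
    next
      case 3
      let ?F = "\<lambda>y ws. dir_deriv (hd ws) (\<lambda>z. \<omega> z (tl ws)) y"
      let ?D = "\<lambda>us. dir_deriv (hd us) (\<lambda>y. ?F y (tl us)) x"
      have sm: "smooth (aff_diff n) real_line (\<lambda>y. ?F y ws)" if ws: "length ws = Suc k" "set ws \<subseteq> aff_dir n" for ws
      proof -
        obtain w ws' where "ws = w # ws'" using ws by (cases ws) auto
        then show ?thesis
          using ws by (auto intro!: smooth_dir_deriv forms_smooth[OF \<omega>])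
      qed
      have sma: "smooth (aff_diff n) real_line (\<lambda>y. alternation (?F y) ws)" if "length ws = Suc k" "set ws \<subseteq> aff_dir n" for ws
        by (rule smooth_aff_alternation) (use that in \<open>intro sm; simp\<close>)
      have "form_d n (form_d n \<omega>) x vs
          = (1 / fact (Suc k)) * alternation (\<lambda>us. dir_deriv (hd us) (\<lambda>y. form_d n \<omega> y (tl us)) x) vs"
        by (rule form_d_alternation[OF form_d_in_forms[OF \<omega>] x vs 3])
      also have "alternation (\<lambda>us. dir_deriv (hd us) (\<lambda>y. form_d n \<omega> y (tl us)) x) vs
          = alternation (\<lambda>us. (1 / fact k) * dir_deriv (hd us) (\<lambda>y. alternation (?F y) (tl us)) x) vs"
      proof (rule alternation_cong)
        fix us :: "(nat \<Rightarrow> real) list" assume us: "length us = length vs" "set us = set vs"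
        then obtain u ws where [simp]: "us = u # ws" and ws: "length ws = Suc k"
          using 3 by (cases us) auto
        have u: "u \<in> aff_dir n" "set ws \<subseteq> aff_dir n"
          using us vs by auto
        have "dir_deriv u (\<lambda>y. form_d n \<omega> y ws) x = dir_deriv u (\<lambda>y. (1 / fact k) * alternation (?F y) ws) x"
          by (rule dir_deriv_cong[OF _ x u(1)]) (rule form_d_alternation[OF \<omega> _ u(2) ws])
        also have "\<dots> = (1 / fact k) * dir_deriv u (\<lambda>y. alternation (?F y) ws) x"
          by (rule dir_deriv_cmult[OF sma[OF ws u(2)] x u(1)])
        finally show "dir_deriv (hd us) (\<lambda>y. form_d n \<omega> y (tl us)) x
            = (1 / fact k) * dir_deriv (hd us) (\<lambda>y. alternation (?F y) (tl us)) x"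
          by simp
      qed
      also have "\<dots> = (1 / fact k) * (fact (Suc k) * alternation ?D vs)"
        unfolding alternation_cmult
        by (rule arg_cong[OF alternation_dir_deriv[OF sm x vs 3]])
      also have "alternation ?D vs = 0"
      proof (rule alternation_eq_0_if_symmetric[of 0 vs 1])
        fix us :: "(nat \<Rightarrow> real) list" assume us: "length us = length vs" "set us = set vs"
        then obtain u v ws where [simp]: "us = u # v # ws"
          using 3 by (metis length_Suc_conv)
        have uv: "u \<in> aff_dir n" "v \<in> aff_dir n" "set ws \<subseteq> aff_dir n"
          using us vs by auto
        have "permute_list (Transposition.transpose 0 1) us = v # u # ws"
          using permute_list_adjacent[of 0 us] by simp
        then show "?D (permute_list (Transposition.transpose 0 1) us) = ?D us"
          using dir_deriv_commute[OF forms_smooth[OF \<omega> uv(3)] x uv(2,1)] by simp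
      qed (use 3 in auto)
      finally show ?thesis by simp
    qed
  qed
qed

text \<open>
  The sign \<open>(-1)^p\<close> of the Leibniz rule; a form may have components of several
  degrees, and p is the length of the list of arguments.
\<close>

definition sign_by_degree :: "form \<Rightarrow> form" where
  "sign_by_degree \<omega> x vs = (-1) ^ length vs * \<omega> x vs"

lemma sign_by_degree_in_forms:
  assumes \<omega>: "\<omega> \<in> forms n"
  shows "sign_by_degree \<omega> \<in> forms n"
  unfolding forms_iff
proof (intro conjI allI impI ballI)
  show "sign_by_degree \<omega> x vs = 0" if "\<not> (x \<in> aff n \<and> set vs \<subseteq> aff_dir n)" for x vs
    unfolding sign_by_degree_def using forms_outside[OF \<omega> that] by simp
  show "smooth (aff_diff n) real_line (\<lambda>x. sign_by_degree \<omega> x vs)" if "set vs \<subseteq> aff_dir n" for vs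
    unfolding sign_by_degree_def by (rule smooth_aff_cmult[OF forms_smooth[OF \<omega> that]])
  fix x assume x: "x \<in> aff n"
  show "alternating n (sign_by_degree \<omega> x)"
    unfolding alternating_def
  proof (intro allI impI conjI ballI)
    fix vs :: "(nat \<Rightarrow> real) list" and i v w r
    assume "set vs \<subseteq> aff_dir n" "i < length vs" "v \<in> aff_dir n" "w \<in> aff_dir n"
    from alternating_linear[OF forms_alternating[OF \<omega> x] this]
    show "sign_by_degree \<omega> x (vs[i := (\<lambda>k. r * v k + w k)])
        = r * sign_by_degree \<omega> x (vs[i := v]) + sign_by_degree \<omega> x (vs[i := w])"
      by (simp only: sign_by_degree_def length_list_update distrib_left mult.left_commute)
  next
    fix vs :: "(nat \<Rightarrow> real) list" and i j
    assume "set vs \<subseteq> aff_dir n" "i < length vs" "j < length vs" "i \<noteq> j \<and> vs ! i = vs ! j"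
    then have "\<omega> x vs = 0"
      using alternating_repeated[OF forms_alternating[OF \<omega> x]] by blast
    then show "sign_by_degree \<omega> x vs = 0"
      by (simp add: sign_by_degree_def)
  qed
qed

text \<open>
  Writing d and the wedge product as alternations reduces the Leibniz rule to the product rule
  for \<open>\<alpha> (take p us) * \<beta> (drop p us)\<close>. The derivative falls on
  \<open>\<alpha>\<close> or on \<open>\<beta>\<close>, and bringing its direction to the front
  costs p transpositions in the second case, whence the sign.
\<close>

lemma form_d_wedge:
  assumes \<alpha>: "\<alpha> \<in> forms n" and \<beta>: "\<beta> \<in> forms n"
  shows "form_d n (wedge \<alpha> \<beta>) x vs = wedge (form_d n \<alpha>) \<beta> x vs + wedge (sign_by_degree \<alpha>) (form_d n \<beta>) x vs"
proof -
  consider (out) "\<not> (x \<in> aff n \<and> set vs \<subseteq> aff_dir n)" | (Nil) "vs = []"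
    | (Suc) k where "x \<in> aff n" "set vs \<subseteq> aff_dir n" "length vs = Suc k"
    by (metis length_0_conv not0_implies_Suc)
  then show ?thesis
  proof cases
    case out
    note \<alpha>\<beta> = \<alpha> \<beta> form_d_in_forms[OF \<alpha>] form_d_in_forms[OF \<beta>] sign_by_degree_in_forms[OF \<alpha>]
    show ?thesis
      using forms_outside[OF form_d_in_forms[OF wedge_in_forms[OF \<alpha>\<beta>(1,2)]] out]
        forms_outside[OF wedge_in_forms[OF \<alpha>\<beta>(3,2)] out] forms_outside[OF wedge_in_forms[OF \<alpha>\<beta>(5,4)] out]
      by simp
  next
    case Nil
    then show ?thesis
      by (simp add: form_d_Nil wedge_alternation alternation_def)
  next
    case (Suc k)
    note x = Suc(1) and vs = Suc(2,3)
    let ?F = "\<lambda>p y ws. \<alpha> y (take p ws) * \<beta> y (drop p ws)"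
    let ?G1 = "\<lambda>p us. dir_deriv (hd us) (\<lambda>y. \<alpha> y (take p (tl us))) x * \<beta> x (drop p (tl us))"
    let ?G2 = "\<lambda>p us. \<alpha> x (take p (tl us)) * dir_deriv (hd us) (\<lambda>y. \<beta> y (drop p (tl us))) x"
    let ?A1 = "\<lambda>p. alternation (?G1 p) vs" and ?A2 = "\<lambda>p. alternation (?G2 p) vs"
    let ?c = "\<lambda>p. 1 / (fact p * fact (k - p)) :: real"
    have sm: "smooth (aff_diff n) real_line (\<lambda>y. ?F p y ws)" if "set ws \<subseteq> aff_dir n" for p ws
      by (rule smooth_wedge_summand[OF \<alpha> \<beta> that])
    have sma: "smooth (aff_diff n) real_line (\<lambda>y. alternation (?F p y) ws)" if "set ws \<subseteq> aff_dir n" for p ws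
      by (rule smooth_aff_alternation) (use that in \<open>intro sm; simp\<close>)
    have product: "alternation (\<lambda>us. dir_deriv (hd us) (\<lambda>y. ?F p y (tl us)) x) vs = ?A1 p + ?A2 p" for p
      unfolding alternation_add[symmetric]
    proof (rule alternation_cong)
      fix us :: "(nat \<Rightarrow> real) list" assume us: "length us = length vs" "set us = set vs"
      then have u: "hd us \<in> aff_dir n" "set (tl us) \<subseteq> aff_dir n"
        using vs by (cases us; auto)+
      show "dir_deriv (hd us) (\<lambda>y. ?F p y (tl us)) x = ?G1 p us + ?G2 p us"
        using set_take_drop[OF u(2)] by (intro dir_deriv_mult[OF forms_smooth[OF \<alpha>] forms_smooth[OF \<beta>] x u(1)]) auto
    qed
    have "form_d n (wedge \<alpha> \<beta>) x vs
        = (1 / fact k) * alternation (\<lambda>us. dir_deriv (hd us) (\<lambda>y. wedge \<alpha> \<beta> y (tl us)) x) vs"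
      by (rule form_d_alternation[OF wedge_in_forms[OF \<alpha> \<beta>] x vs])
    also have "alternation (\<lambda>us. dir_deriv (hd us) (\<lambda>y. wedge \<alpha> \<beta> y (tl us)) x) vs
        = alternation (\<lambda>us. \<Sum>p\<le>k. ?c p * dir_deriv (hd us) (\<lambda>y. alternation (?F p y) (tl us)) x) vs"
    proof (rule alternation_cong)
      fix us :: "(nat \<Rightarrow> real) list" assume us: "length us = length vs" "set us = set vs"
      then have u: "hd us \<in> aff_dir n" "set (tl us) \<subseteq> aff_dir n" "length (tl us) = k"
        using vs by (cases us; auto)+
      have "dir_deriv (hd us) (\<lambda>y. wedge \<alpha> \<beta> y (tl us)) x
          = (\<Sum>p\<le>k. dir_deriv (hd us) (\<lambda>y. ?c p * alternation (?F p y) (tl us)) x)"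
        unfolding wedge_alternation u(3)
        by (rule dir_deriv_sum[OF smooth_aff_cmult[OF sma[OF u(2)]] x u(1)])
      also have "\<dots> = (\<Sum>p\<le>k. ?c p * dir_deriv (hd us) (\<lambda>y. alternation (?F p y) (tl us)) x)"
        by (rule sum.cong[OF refl]) (rule dir_deriv_cmult[OF sma[OF u(2)] x u(1)])
      finally show "dir_deriv (hd us) (\<lambda>y. wedge \<alpha> \<beta> y (tl us)) x
          = (\<Sum>p\<le>k. ?c p * dir_deriv (hd us) (\<lambda>y. alternation (?F p y) (tl us)) x)" .
    qed
    also have "\<dots> = (\<Sum>p\<le>k. ?c p * (fact k * (?A1 p + ?A2 p)))"
      unfolding alternation_sum alternation_cmult product[symmetric]
      by (rule sum.cong[OF refl], rule arg_cong[OF alternation_dir_deriv[OF sm x vs]])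
    also have "(1 / fact k) * (\<Sum>p\<le>k. ?c p * (fact k * (?A1 p + ?A2 p))) = (\<Sum>p\<le>k. ?c p * ?A1 p + ?c p * ?A2 p)"
    proof -
      have "(1 / f) * (c * (f * (a + b))) = c * a + c * b" if "f \<noteq> 0" for f c a b :: real
        using that by (simp add: field_simps)
      from this[OF fact_nonzero] show ?thesis
        unfolding sum_distrib_left by (rule sum.cong[OF refl])
    qed
    finally have L: "form_d n (wedge \<alpha> \<beta>) x vs = (\<Sum>p\<le>k. ?c p * ?A1 p) + (\<Sum>p\<le>k. ?c p * ?A2 p)"
      by (simp only: sum.distrib)

    \<comment> \<open>Each of the p + 1 choices of the argument in which \<open>\<alpha>\<close> is differentiated gives the same alternation;
      the factor turns 1 / (p + 1)! into 1 / p!.\<close>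
    have 1: "alternation (\<lambda>us. form_d n \<alpha> x (take (Suc p) us) * \<beta> x (drop (Suc p) us)) vs = real (Suc p) * ?A1 p"
      if p: "p \<le> k" for p
    proof -
      have "alternation (\<lambda>us. form_d n \<alpha> x (take (Suc p) us) * \<beta> x (drop (Suc p) us)) vs
          = alternation (\<lambda>us. \<Sum>i<Suc p. (-1) ^ i * ?G1 p (us ! i # take i us @ drop (Suc i) us)) vs"
      proof (rule alternation_cong)
        fix us :: "(nat \<Rightarrow> real) list" assume us: "length us = length vs" "set us = set vs"
        have "set (take (Suc p) us) \<subseteq> aff_dir n" and l: "length (take (Suc p) us) = Suc p"
          using set_take_drop[of us "aff_dir n" "Suc p"] us vs p by auto
        then have "form_d n \<alpha> x (take (Suc p) us) * \<beta> x (drop (Suc p) us)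
            = (\<Sum>i<Suc p. ((-1) ^ i * dir_deriv (take (Suc p) us ! i) (\<lambda>y. \<alpha> y (remove_nth i (take (Suc p) us))) x) * \<beta> x (drop (Suc p) us))"
          by (simp only: form_d_remove_nth[OF x] sum_distrib_right)
        also have "\<dots> = (\<Sum>i<Suc p. (-1) ^ i * ?G1 p (us ! i # take i us @ drop (Suc i) us))"
        proof (rule sum.cong[OF refl])
          fix i assume i: "i \<in> {..<Suc p}"
          then have "take (Suc p) us ! i = us ! i" by simp
          moreover have "remove_nth i (take (Suc p) us) = take p (take i us @ drop (Suc i) us)"
            using i us vs p by (cases "i = p") (auto simp: remove_nth_def min_def drop_take)
          moreover have "drop (Suc p) us = drop p (take i us @ drop (Suc i) us)"
            using i us vs p by (cases "i = p") (auto simp: min_def)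
          ultimately show "((-1) ^ i * dir_deriv (take (Suc p) us ! i) (\<lambda>y. \<alpha> y (remove_nth i (take (Suc p) us))) x) * \<beta> x (drop (Suc p) us)
              = (-1) ^ i * ?G1 p (us ! i # take i us @ drop (Suc i) us)"
            by (simp only: list.sel mult.assoc)
        qed
        finally show "form_d n \<alpha> x (take (Suc p) us) * \<beta> x (drop (Suc p) us)
            = (\<Sum>i<Suc p. (-1) ^ i * ?G1 p (us ! i # take i us @ drop (Suc i) us))" .
      qed
      also have "\<dots> = (\<Sum>i<Suc p. (-1) ^ i * ((-1) ^ i * ?A1 p))"
        unfolding alternation_sum alternation_cmult
      proof (rule sum.cong[OF refl])
        fix i assume "i \<in> {..<Suc p}"
        then have "i < length vs" using vs p by simp
        from alternation_move_to_front[OF this, of "?G1 p"]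
        show "(-1) ^ i * alternation (\<lambda>us. ?G1 p (us ! i # take i us @ drop (Suc i) us)) vs = (-1) ^ i * ((-1) ^ i * ?A1 p)"
          by (simp only:)
      qed
      also have "\<dots> = real (Suc p) * ?A1 p"
        by (simp flip: mult.assoc power_mult_distrib)
      finally show ?thesis .
    qed
    \<comment> \<open>The same for \<open>\<beta>\<close>, with the sign of moving the direction of differentiation past the p arguments of \<open>\<alpha>\<close>.\<close>
    have 2: "alternation (\<lambda>us. sign_by_degree \<alpha> x (take p us) * form_d n \<beta> x (drop p us)) vs = real (Suc k - p) * ?A2 p"
      if p: "p \<le> k" for p
    proof -
      have "alternation (\<lambda>us. sign_by_degree \<alpha> x (take p us) * form_d n \<beta> x (drop p us)) vs
          = alternation (\<lambda>us. \<Sum>i<Suc k - p. (-1) ^ (p + i) * ?G2 p (us ! (p + i) # take (p + i) us @ drop (Suc (p + i)) us)) vs"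
      proof (rule alternation_cong)
        fix us :: "(nat \<Rightarrow> real) list" assume us: "length us = length vs" "set us = set vs"
        have "set (drop p us) \<subseteq> aff_dir n" and l: "length (drop p us) = Suc k - p" and l': "length (take p us) = p"
          using set_take_drop[of us "aff_dir n" p] us vs p by auto
        then have "sign_by_degree \<alpha> x (take p us) * form_d n \<beta> x (drop p us)
            = (\<Sum>i<Suc k - p. ((-1) ^ p * \<alpha> x (take p us)) * ((-1) ^ i * dir_deriv (drop p us ! i) (\<lambda>y. \<beta> y (remove_nth i (drop p us))) x))"
          by (simp only: form_d_remove_nth[OF x] sum_distrib_left sign_by_degree_def)
        also have "\<dots> = (\<Sum>i<Suc k - p. (-1) ^ (p + i) * ?G2 p (us ! (p + i) # take (p + i) us @ drop (Suc (p + i)) us))"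
        proof (rule sum.cong[OF refl])
          fix i assume i: "i \<in> {..<Suc k - p}"
          then have "drop p us ! i = us ! (p + i)" using us vs p by simp
          moreover have "remove_nth i (drop p us) = drop p (take (p + i) us @ drop (Suc (p + i)) us)"
            using i us vs p by (simp add: remove_nth_def drop_take add.commute)
          moreover have "take p us = take p (take (p + i) us @ drop (Suc (p + i)) us)"
            using i us vs p by (simp add: min_def)
          ultimately show "((-1) ^ p * \<alpha> x (take p us)) * ((-1) ^ i * dir_deriv (drop p us ! i) (\<lambda>y. \<beta> y (remove_nth i (drop p us))) x)
              = (-1) ^ (p + i) * ?G2 p (us ! (p + i) # take (p + i) us @ drop (Suc (p + i)) us)"
            by (simp only: list.sel power_add mult_ac)
        qed
        finally show "sign_by_degree \<alpha> x (take p us) * form_d n \<beta> x (drop p us)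
            = (\<Sum>i<Suc k - p. (-1) ^ (p + i) * ?G2 p (us ! (p + i) # take (p + i) us @ drop (Suc (p + i)) us))" .
      qed
      also have "\<dots> = (\<Sum>i<Suc k - p. (-1) ^ (p + i) * ((-1) ^ (p + i) * ?A2 p))"
        unfolding alternation_sum alternation_cmult
      proof (rule sum.cong[OF refl])
        fix i assume "i \<in> {..<Suc k - p}"
        then have "p + i < length vs" using vs p by simp
        from alternation_move_to_front[OF this, of "?G2 p"]
        show "(-1) ^ (p + i) * alternation (\<lambda>us. ?G2 p (us ! (p + i) # take (p + i) us @ drop (Suc (p + i)) us)) vs
            = (-1) ^ (p + i) * ((-1) ^ (p + i) * ?A2 p)"
          by (simp only:)
      qed
      also have "\<dots> = real (Suc k - p) * ?A2 p"
        by (simp flip: mult.assoc power_mult_distrib)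
      finally show ?thesis .
    qed
    have "wedge (form_d n \<alpha>) \<beta> x vs
        = (\<Sum>p\<le>k. (1 / (fact (Suc p) * fact (k - p))) * (real (Suc p) * ?A1 p))"
      unfolding wedge_alternation vs(2) sum.atMost_Suc_shift
      by (simp add: form_d_Nil alternation_def 1[unfolded alternation_def])
    also have "\<dots> = (\<Sum>p\<le>k. ?c p * ?A1 p)"
    proof (rule sum.cong[OF refl])
      fix p assume "p \<in> {..k}"
      have "(1 / ((s * f) * g)) * (s * a) = (1 / (f * g)) * a" if "s \<noteq> 0" for s f g a :: real
        using that by (simp add: field_simps)
      from this[of "real (Suc p)"]
      show "(1 / (fact (Suc p) * fact (k - p))) * (real (Suc p) * ?A1 p) = ?c p * ?A1 p"
        unfolding fact_Suc by simp
    qed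
    finally have R1: "wedge (form_d n \<alpha>) \<beta> x vs = (\<Sum>p\<le>k. ?c p * ?A1 p)" .
    have last: "alternation (\<lambda>us. sign_by_degree \<alpha> x (take (Suc k) us) * form_d n \<beta> x (drop (Suc k) us)) vs
        = alternation (\<lambda>us. 0) vs"
      by (rule alternation_cong) (simp add: vs form_d_Nil)
    have "wedge (sign_by_degree \<alpha>) (form_d n \<beta>) x vs
        = (\<Sum>p\<le>k. (1 / (fact p * fact (Suc k - p))) * (real (Suc k - p) * ?A2 p))"
      unfolding wedge_alternation vs(2) sum.atMost_Suc last
      by (simp add: 2 alternation_def[of "\<lambda>us. 0"] del: of_nat_Suc)
    also have "\<dots> = (\<Sum>p\<le>k. ?c p * ?A2 p)"
    proof (rule sum.cong[OF refl])
      fix p assume "p \<in> {..k}"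
      then have s: "fact (Suc k - p) = real (Suc k - p) * fact (k - p)" "real (Suc k - p) \<noteq> 0"
        by (simp_all add: Suc_diff_le)
      have "(1 / (f * (s * g))) * (s * a) = (1 / (f * g)) * a" if "s \<noteq> 0" for s f g a :: real
        using that by (simp add: field_simps)
      from this[OF s(2)] show "(1 / (fact p * fact (Suc k - p))) * (real (Suc k - p) * ?A2 p) = ?c p * ?A2 p"
        unfolding s(1) .
    qed
    finally show ?thesis
      using L R1 by simp
  qed
qed


subsection \<open>Pullback along vertex maps\<close>

lemma vertex_map_translate:
  "vertex_map m a (translate x t v) = translate (vertex_map m a x) t (vertex_map m a v)"
  by (simp add: vertex_map_def sum.distrib sum_distrib_left)

lemma vertex_map_outside:
  assumes "a \<in> {..m} \<rightarrow> {..n}" "j > n"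
  shows "vertex_map m a x j = 0"
proof -
  have "{i. i \<le> m \<and> a i = j} = {}" using assms by force
  then show ?thesis by (simp only: vertex_map_def sum.empty)
qed

lemma sum_vertex_map:
  assumes "a \<in> {..m} \<rightarrow> {..n}"
  shows "(\<Sum>j\<le>n. vertex_map m a x j) = (\<Sum>i\<le>m. x i)"
  using sum.group[of "{..m}" "{..n}" a x] assms by (auto simp: vertex_map_def)

lemma vertex_map_aff:
  assumes a: "a \<in> {..m} \<rightarrow> {..n}"
  shows "x \<in> aff m \<Longrightarrow> vertex_map m a x \<in> aff n"
    and "v \<in> aff_dir m \<Longrightarrow> vertex_map m a v \<in> aff_dir n"
  using sum_vertex_map[OF a] vertex_map_outside[OF a] by (auto simp: aff_def aff_dir_def)

lemma form_pullback_outside: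
  "\<not> (x \<in> aff m \<and> set vs \<subseteq> aff_dir m) \<Longrightarrow> form_pullback m a \<omega> x vs = 0"
  by (simp only: form_pullback_def if_False)

lemma form_pullback_wedge:
  "form_pullback m a (wedge \<alpha> \<beta>) = wedge (form_pullback m a \<alpha>) (form_pullback m a \<beta>)"
proof (intro ext)
  fix x vs
  show "form_pullback m a (wedge \<alpha> \<beta>) x vs = wedge (form_pullback m a \<alpha>) (form_pullback m a \<beta>) x vs"
  proof (cases "x \<in> aff m \<and> set vs \<subseteq> aff_dir m")
    case False
    have "wedge (form_pullback m a \<alpha>) (form_pullback m a \<beta>) x vs = 0"
      by (rule wedge_outside[where n = m, OF _ _ False]) (rule form_pullback_outside, assumption)+
    then show ?thesis
      by (simp only: form_pullback_outside[OF False])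
  next
    case True
    let ?f = "vertex_map m a"
    have "alternation (\<lambda>us. \<alpha> (?f x) (take p us) * \<beta> (?f x) (drop p us)) (map ?f vs)
        = alternation (\<lambda>us. form_pullback m a \<alpha> x (take p us) * form_pullback m a \<beta> x (drop p us)) vs" for p
      unfolding alternation_def length_map
    proof (rule sum.cong[OF refl])
      fix \<sigma> assume "\<sigma> \<in> {\<sigma>. \<sigma> permutes {..<length vs}}"
      then have \<sigma>: "\<sigma> permutes {..<length vs}" by simp
      have "set (permute_list \<sigma> vs) \<subseteq> aff_dir m" using True \<sigma> by simp
      then show "of_int (sign \<sigma>) * (\<alpha> (?f x) (take p (permute_list \<sigma> (map ?f vs))) * \<beta> (?f x) (drop p (permute_list \<sigma> (map ?f vs))))
          = of_int (sign \<sigma>) * (form_pullback m a \<alpha> x (take p (permute_list \<sigma> vs)) * form_pullback m a \<beta> x (drop p (permute_list \<sigma> vs)))"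
        using True set_take_drop[of "permute_list \<sigma> vs" "aff_dir m" p]
        by (simp add: form_pullback_def permute_list_map[OF \<sigma>] take_map drop_map)
    qed
    then show ?thesis
      using True by (simp only: form_pullback_def[of m a "wedge \<alpha> \<beta>"] wedge_alternation length_map if_True simp_thms)
  qed
qed

text \<open>
  The vertex map is affine, so it carries lines to lines and directional derivatives to
  directional derivatives.
\<close>

lemma form_pullback_form_d:
  assumes a: "a \<in> {..m} \<rightarrow> {..n}"
  shows "form_pullback m a (form_d n \<omega>) = form_d m (form_pullback m a \<omega>)"
proof (intro ext)
  fix x vs
  show "form_pullback m a (form_d n \<omega>) x vs = form_d m (form_pullback m a \<omega>) x vs"
  proof (cases "x \<in> aff m \<and> set vs \<subseteq> aff_dir m")
    case False
    then show ?thesis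
      by (simp only: form_pullback_outside[OF False] form_d_outside[OF False])
  next
    case True
    let ?f = "vertex_map m a"
    have in': "?f x \<in> aff n" "set (map ?f vs) \<subseteq> aff_dir n"
      using True vertex_map_aff[OF a] by auto
    have "dir_deriv (map ?f vs ! i) (\<lambda>y. \<omega> y (remove_nth i (map ?f vs))) (?f x)
        = dir_deriv (vs ! i) (\<lambda>y. form_pullback m a \<omega> y (remove_nth i vs)) x" if i: "i < length vs" for i
    proof -
      have v: "vs ! i \<in> aff_dir m" "set (remove_nth i vs) \<subseteq> aff_dir m"
        using True i set_remove_nth[of vs "aff_dir m" i] by auto
      have "remove_nth i (map ?f vs) = map ?f (remove_nth i vs)"
        by (simp add: remove_nth_def take_map drop_map)
      then have "\<omega> (translate (?f x) t (map ?f vs ! i)) (remove_nth i (map ?f vs))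
          = form_pullback m a \<omega> (translate x t (vs ! i)) (remove_nth i vs)" for t
        using True v aff_translate[of x m "vs ! i" t] i by (simp add: form_pullback_def vertex_map_translate)
      then show ?thesis
        by (simp only: dir_deriv_def)
    qed
    then have "form_d n \<omega> (?f x) (map ?f vs) = form_d m (form_pullback m a \<omega>) x vs"
      using True by (simp add: form_d_remove_nth[OF in'] form_d_remove_nth)
    then show ?thesis
      using True by (simp only: form_pullback_def[of m a "form_d n \<omega>"] if_True simp_thms)
  qed
qed

section \<open>Cochains\<close>

abbreviation scale_cochain :: "real \<Rightarrow> 'x cochain \<Rightarrow> 'x cochain" where
  "scale_cochain r c \<equiv> (\<lambda>n s x vs. r * c n s x vs)"

abbreviation wedge_cochain :: "'x cochain \<Rightarrow> 'x cochain \<Rightarrow> 'x cochain" where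
  "wedge_cochain c e \<equiv> (\<lambda>n s. wedge (c n s) (e n s))"

lemma add_form_apply: "(\<alpha> + \<beta> :: form) x vs = \<alpha> x vs + \<beta> x vs"
  by (simp add: plus_fun_def)

lemma add_cochain_apply: "(c + e :: 'x cochain) n s = c n s + e n s"
  by (simp add: plus_fun_def)

lemma forms_add:
  assumes \<alpha>: "\<alpha> \<in> forms n" and \<beta>: "\<beta> \<in> forms n"
  shows "\<alpha> + \<beta> \<in> forms n"
proof -
  have "(\<lambda>x vs. \<alpha> x vs + \<beta> x vs) \<in> forms n"
    unfolding forms_iff
  proof (intro conjI allI impI ballI)
  show "\<alpha> x vs + \<beta> x vs = 0" if "\<not> (x \<in> aff n \<and> set vs \<subseteq> aff_dir n)" for x vs
    using forms_outside[OF \<alpha> that] forms_outside[OF \<beta> that] by simp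
  show "smooth (aff_diff n) real_line (\<lambda>x. \<alpha> x vs + \<beta> x vs)" if "set vs \<subseteq> aff_dir n" for vs
    by (rule smooth_aff_add[OF forms_smooth[OF \<alpha> that] forms_smooth[OF \<beta> that]])
  fix x assume x: "x \<in> aff n"
  note alt = forms_alternating[OF \<alpha> x] forms_alternating[OF \<beta> x]
  show "alternating n (\<lambda>vs. \<alpha> x vs + \<beta> x vs)"
    unfolding alternating_def
  proof (intro allI impI conjI ballI)
    fix vs :: "(nat \<Rightarrow> real) list" and i v w r
    assume "set vs \<subseteq> aff_dir n" "i < length vs" "v \<in> aff_dir n" "w \<in> aff_dir n"
    note alternating_linear[OF alt(1) this] alternating_linear[OF alt(2) this]
    then show "\<alpha> x (vs[i := \<lambda>k. r * v k + w k]) + \<beta> x (vs[i := \<lambda>k. r * v k + w k]) =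
        r * (\<alpha> x (vs[i := v]) + \<beta> x (vs[i := v])) + (\<alpha> x (vs[i := w]) + \<beta> x (vs[i := w]))"
      by (simp only: distrib_left add_ac)
  next
    fix vs :: "(nat \<Rightarrow> real) list" and i j
    assume "set vs \<subseteq> aff_dir n" "i < length vs" "j < length vs" "i \<noteq> j \<and> vs ! i = vs ! j"
    then show "\<alpha> x vs + \<beta> x vs = 0"
      using alternating_repeated[OF alt(1)] alternating_repeated[OF alt(2)] by (metis add_0)
  qed
qed
  then show ?thesis by (simp only: plus_fun_def)
qed

lemma forms_scale:
  assumes \<alpha>: "\<alpha> \<in> forms n"
  shows "(\<lambda>x vs. r * \<alpha> x vs) \<in> forms n"
  unfolding forms_iff
proof (intro conjI allI impI ballI)
  show "r * \<alpha> x vs = 0" if "\<not> (x \<in> aff n \<and> set vs \<subseteq> aff_dir n)" for x vs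
    using forms_outside[OF \<alpha> that] by simp
  show "smooth (aff_diff n) real_line (\<lambda>x. r * \<alpha> x vs)" if "set vs \<subseteq> aff_dir n" for vs
    by (rule smooth_aff_cmult[OF forms_smooth[OF \<alpha> that]])
  fix x assume x: "x \<in> aff n"
  note alt = forms_alternating[OF \<alpha> x]
  show "alternating n (\<lambda>vs. r * \<alpha> x vs)"
    unfolding alternating_def
  proof (intro allI impI conjI ballI)
    fix vs :: "(nat \<Rightarrow> real) list" and i v w r'
    assume "set vs \<subseteq> aff_dir n" "i < length vs" "v \<in> aff_dir n" "w \<in> aff_dir n"
    note alternating_linear[OF alt(1) this]
    then show "r * \<alpha> x (vs[i := \<lambda>k. r' * v k + w k]) =
        r' * (r * \<alpha> x (vs[i := v])) + r * \<alpha> x (vs[i := w])"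
      by (simp only: distrib_left mult_ac)
  next
    fix vs :: "(nat \<Rightarrow> real) list" and i j
    assume "set vs \<subseteq> aff_dir n" "i < length vs" "j < length vs" "i \<noteq> j \<and> vs ! i = vs ! j"
    then show "r * \<alpha> x vs = 0"
      using alternating_repeated[OF alt(1)] by (metis mult_zero_right)
  qed
qed

lemma form_d_zero: "form_d n (\<lambda>x vs. 0) = (\<lambda>x vs. 0)"
  by (intro ext) (simp add: form_d_def)

lemma form_d_add:
  assumes \<alpha>: "\<alpha> \<in> forms n" and \<beta>: "\<beta> \<in> forms n"
  shows "form_d n (\<alpha> + \<beta>) = form_d n \<alpha> + form_d n \<beta>"
proof (intro ext)
  fix x vs
  show "form_d n (\<alpha> + \<beta>) x vs = (form_d n \<alpha> + form_d n \<beta>) x vs"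
  proof (cases "x \<in> aff n \<and> set vs \<subseteq> aff_dir n")
    case False
    then show ?thesis
      by (simp only: form_d_outside[OF False] add_form_apply add_0)
  next
    case True
    then have x: "x \<in> aff n" and vs: "set vs \<subseteq> aff_dir n" by auto
    show ?thesis
      unfolding add_form_apply form_d_remove_nth[OF x vs] sum.distrib[symmetric] distrib_left[symmetric]
    proof (rule sum.cong[OF refl], rule arg_cong[where f = "(*) _"])
      fix i assume "i \<in> {..<length vs}"
      then have "vs ! i \<in> aff_dir n" using vs by auto
      with forms_smooth[OF \<alpha> set_remove_nth[OF vs]] forms_smooth[OF \<beta> set_remove_nth[OF vs]] x
      show "dir_deriv (vs ! i) (\<lambda>y. \<alpha> y (remove_nth i vs) + \<beta> y (remove_nth i vs)) x
          = dir_deriv (vs ! i) (\<lambda>y. \<alpha> y (remove_nth i vs)) x + dir_deriv (vs ! i) (\<lambda>y. \<beta> y (remove_nth i vs)) x"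
        by (rule dir_deriv_add)
    qed
  qed
qed

lemma form_d_scale:
  assumes \<alpha>: "\<alpha> \<in> forms n"
  shows "form_d n (\<lambda>x vs. r * \<alpha> x vs) = (\<lambda>x vs. r * form_d n \<alpha> x vs)"
proof (intro ext)
  fix x vs
  show "form_d n (\<lambda>x vs. r * \<alpha> x vs) x vs = r * form_d n \<alpha> x vs"
  proof (cases "x \<in> aff n \<and> set vs \<subseteq> aff_dir n")
    case False
    then show ?thesis
      by (simp only: form_d_outside[OF False] mult_zero_right)
  next
    case True
    then have x: "x \<in> aff n" and vs: "set vs \<subseteq> aff_dir n" by auto
    show ?thesis
      unfolding form_d_remove_nth[OF x vs] sum_distrib_left
    proof (rule sum.cong[OF refl])
      fix i assume "i \<in> {..<length vs}"
      then have "vs ! i \<in> aff_dir n" using vs by auto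
      with forms_smooth[OF \<alpha> set_remove_nth[OF vs]] x
      have "dir_deriv (vs ! i) (\<lambda>y. r * \<alpha> y (remove_nth i vs)) x = r * dir_deriv (vs ! i) (\<lambda>y. \<alpha> y (remove_nth i vs)) x"
        by (rule dir_deriv_cmult)
      then show "(-1) ^ i * dir_deriv (vs ! i) (\<lambda>y. r * \<alpha> y (remove_nth i vs)) x =
          r * ((-1) ^ i * dir_deriv (vs ! i) (\<lambda>y. \<alpha> y (remove_nth i vs)) x)"
        by (simp only: mult_ac)
    qed
  qed
qed

lemma wedge_add_left: "wedge (\<alpha> + \<alpha>') \<beta> = wedge \<alpha> \<beta> + wedge \<alpha>' \<beta>"
  by (intro ext) (simp add: add_form_apply wedge_alternation alternation_add distrib_left distrib_right sum.distrib)

lemma wedge_add_right: "wedge \<alpha> (\<beta> + \<beta>') = wedge \<alpha> \<beta> + wedge \<alpha> \<beta>'"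
  by (intro ext) (simp add: add_form_apply wedge_alternation alternation_add distrib_left distrib_right sum.distrib)

lemma wedge_zero: "wedge (\<lambda>x vs. 0) \<beta> = (\<lambda>x vs. 0)" "wedge \<alpha> (\<lambda>x vs. 0) = (\<lambda>x vs. 0)"
  by (intro ext; simp add: wedge_alternation alternation_def)+

lemma DR_cochainsD:
  assumes "c \<in> DR_cochains X"
  shows DR_cochains_forms: "s \<in> sing X n \<Longrightarrow> c n s \<in> forms n"
    and DR_cochains_outside: "s \<notin> sing X n \<Longrightarrow> c n s = (\<lambda>x vs. 0)"
    and DR_cochains_pullback: "mono_on {..m} a \<Longrightarrow> a \<in> {..m} \<rightarrow> {..n} \<Longrightarrow> s \<in> sing X n \<Longrightarrow>
        c m (compose (standard_simplex m) s (vertex_map m a)) = form_pullback m a (c n s)"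
    and DR_cochains_bounded: "\<exists>N. \<forall>n s x vs. N < length vs \<longrightarrow> c n s x vs = 0"
  using assms unfolding DR_cochains_def by blast+

lemma DR_cochainsI:
  assumes "\<And>n s. s \<in> sing X n \<Longrightarrow> c n s \<in> forms n"
    and "\<And>n s. s \<notin> sing X n \<Longrightarrow> c n s = (\<lambda>x vs. 0)"
    and "\<And>m n a s. mono_on {..m} a \<Longrightarrow> a \<in> {..m} \<rightarrow> {..n} \<Longrightarrow> s \<in> sing X n \<Longrightarrow>
        c m (compose (standard_simplex m) s (vertex_map m a)) = form_pullback m a (c n s)"
    and "\<And>n s x vs. N < length vs \<Longrightarrow> c n s x vs = 0"
  shows "c \<in> DR_cochains X"
  unfolding DR_cochains_def using assms by blast

lemma form_pullback_add: "form_pullback m a (\<alpha> + \<beta>) = form_pullback m a \<alpha> + form_pullback m a \<beta>"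
  by (intro ext) (simp add: add_form_apply form_pullback_def)

lemma form_pullback_scale: "form_pullback m a (\<lambda>x vs. r * \<alpha> x vs) = (\<lambda>x vs. r * form_pullback m a \<alpha> x vs)"
  by (intro ext) (simp add: form_pullback_def)

lemma form_pullback_zero: "form_pullback m a (\<lambda>x vs. 0) = (\<lambda>x vs. 0)"
  by (intro ext) (simp add: form_pullback_def)

lemma form_pullback_sign: "form_pullback m a (sign_by_degree \<alpha>) = sign_by_degree (form_pullback m a \<alpha>)"
  by (intro ext) (simp add: form_pullback_def sign_by_degree_def)

lemma zero_form_add: "(\<lambda>x vs. 0) + (\<lambda>x vs. 0) = (\<lambda>x vs. 0 :: real)"
  by (simp add: plus_fun_def)

lemma DR_cochains_add:
  assumes c: "c \<in> DR_cochains X" and e: "e \<in> DR_cochains X"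
  shows "c + e \<in> DR_cochains X"
proof -
  obtain N M where "\<forall>n s x vs. N < length vs \<longrightarrow> c n s x vs = 0" "\<forall>n s x vs. M < length vs \<longrightarrow> e n s x vs = 0"
    using DR_cochains_bounded[OF c] DR_cochains_bounded[OF e] by blast
  then show ?thesis
    by (intro DR_cochainsI[where N = "N + M"])
      (simp_all add: add_cochain_apply forms_add DR_cochainsD[OF c] DR_cochainsD[OF e] form_pullback_add
        zero_form_add add_form_apply)
qed

lemma DR_cochains_scale:
  assumes c: "c \<in> DR_cochains X"
  shows "scale_cochain r c \<in> DR_cochains X"
proof -
  obtain N where "\<forall>n s x vs. N < length vs \<longrightarrow> c n s x vs = 0"
    using DR_cochains_bounded[OF c] by blast
  then show ?thesis
    by (intro DR_cochainsI[where N = N]) (simp_all add: forms_scale DR_cochainsD[OF c] form_pullback_scale)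
qed

lemma DR_cochains_wedge:
  assumes c: "c \<in> DR_cochains X" and e: "e \<in> DR_cochains X"
  shows "wedge_cochain c e \<in> DR_cochains X"
proof -
  obtain N M where N: "\<forall>n s x vs. N < length vs \<longrightarrow> c n s x vs = 0" and M: "\<forall>n s x vs. M < length vs \<longrightarrow> e n s x vs = 0"
    using DR_cochains_bounded[OF c] DR_cochains_bounded[OF e] by blast
  show ?thesis
  proof (rule DR_cochainsI[where N = "N + M"])
    fix n s x and vs :: "(nat \<Rightarrow> real) list" assume l: "N + M < length vs"
    have "alternation (\<lambda>us. c n s x (take p us) * e n s x (drop p us)) vs = alternation (\<lambda>us. 0) vs" for p
    proof (rule alternation_cong)
      fix us :: "(nat \<Rightarrow> real) list" assume "length us = length vs"
      with l have "N < length (take p us) \<or> M < length (drop p us)" by auto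
      with N M show "c n s x (take p us) * e n s x (drop p us) = 0" by (metis mult_zero_left mult_zero_right)
    qed
    then show "wedge (c n s) (e n s) x vs = 0"
      by (simp add: wedge_alternation alternation_def[of "\<lambda>us. 0"])
  qed (simp_all add: wedge_in_forms DR_cochainsD[OF c] DR_cochainsD[OF e] form_pullback_wedge wedge_zero)
qed

lemma DR_cochains_sign:
  assumes c: "c \<in> DR_cochains X"
  shows "(\<lambda>n s. sign_by_degree (c n s)) \<in> DR_cochains X"
proof -
  obtain N where "\<forall>n s x vs. N < length vs \<longrightarrow> c n s x vs = 0"
    using DR_cochains_bounded[OF c] by blast
  then show ?thesis
    by (intro DR_cochainsI[where N = N])
      (simp_all add: sign_by_degree_in_forms DR_cochainsD[OF c] form_pullback_sign,
        simp_all add: sign_by_degree_def fun_eq_iff)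
qed

lemma DR_cochains_d:
  assumes c: "c \<in> DR_cochains X"
  shows "DR_d c \<in> DR_cochains X"
proof -
  obtain N where N: "\<forall>n s x vs. N < length vs \<longrightarrow> c n s x vs = 0"
    using DR_cochains_bounded[OF c] by blast
  show ?thesis
  proof (rule DR_cochainsI[where N = "Suc N"])
    fix n s x and vs :: "(nat \<Rightarrow> real) list" assume "Suc N < length vs"
    then have "c n s y (take i vs @ drop (Suc i) vs) = 0" if "i < length vs" for y i
      using N that by simp
    then show "DR_d c n s x vs = 0"
      by (simp add: DR_d_def form_d_def)
  qed (simp_all add: DR_d_def form_d_in_forms DR_cochainsD[OF c] form_pullback_form_d form_d_zero)
qed

lemma zero_in_DR_cochains: "0 \<in> DR_cochains X"
proof (rule DR_cochainsI[where N = 0])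
  have "(\<lambda>x vs. 0) \<in> forms n" for n
    unfolding forms_iff by (simp add: smooth_aff_const alternating_def)
  then show "(0 :: 'a cochain) n s \<in> forms n" for n s
    by (simp add: zero_fun_def)
qed (simp_all add: zero_fun_def form_pullback_zero)

lemma scale_minus_one: "scale_cochain (-1) c = - c"
  by (simp add: fun_Compl_def)

lemma DR_cochains_diff: "c \<in> DR_cochains X \<Longrightarrow> e \<in> DR_cochains X \<Longrightarrow> c - e \<in> DR_cochains X"
  using DR_cochains_add[OF _ DR_cochains_scale[of e X "-1"]] by (simp only: scale_minus_one diff_conv_add_uminus)

lemma DR_d_add:
  assumes c: "c \<in> DR_cochains X" and e: "e \<in> DR_cochains X"
  shows "DR_d (c + e) = DR_d c + DR_d e"
proof (intro ext)
  fix n s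
  have "form_d n (c n s + e n s) = form_d n (c n s) + form_d n (e n s)"
  proof (cases "s \<in> sing X n")
    case True
    then show ?thesis
      by (intro form_d_add DR_cochains_forms[OF c] DR_cochains_forms[OF e])
  next
    case False
    then show ?thesis
      by (simp add: DR_cochains_outside[OF c] DR_cochains_outside[OF e] form_d_zero zero_form_add)
  qed
  then show "DR_d (c + e) n s x vs = (DR_d c + DR_d e) n s x vs" for x vs
    by (simp only: DR_d_def add_cochain_apply)
qed

lemma DR_d_scale:
  assumes c: "c \<in> DR_cochains X"
  shows "DR_d (scale_cochain r c) = scale_cochain r (DR_d c)"
proof (intro ext)
  fix n s
  have "form_d n (\<lambda>x vs. r * c n s x vs) = (\<lambda>x vs. r * form_d n (c n s) x vs)"
  proof (cases "s \<in> sing X n")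
    case True
    then show ?thesis
      by (intro form_d_scale DR_cochains_forms[OF c])
  next
    case False
    then show ?thesis
      by (simp add: DR_cochains_outside[OF c] form_d_zero)
  qed
  then show "DR_d (scale_cochain r c) n s x vs = r * DR_d c n s x vs" for x vs
    by (simp only: DR_d_def)
qed

lemma DR_d_diff:
  assumes c: "c \<in> DR_cochains X" and e: "e \<in> DR_cochains X"
  shows "DR_d (c - e) = DR_d c - DR_d e"
  using DR_d_add[OF c DR_cochains_scale[OF e, of "-1"]] DR_d_scale[OF e, of "-1"]
  by (simp only: scale_minus_one diff_conv_add_uminus)

lemma DR_d_d:
  assumes c: "c \<in> DR_cochains X"
  shows "DR_d (DR_d c) = 0"
proof (intro ext)
  fix n s
  have "form_d n (form_d n (c n s)) = (\<lambda>x vs. 0)"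
    by (cases "s \<in> sing X n") (simp_all add: form_d_form_d[OF DR_cochains_forms[OF c]] DR_cochains_outside[OF c] form_d_zero)
  then show "DR_d (DR_d c) n s x vs = 0 n s x vs" for x vs
    by (simp add: DR_d_def)
qed

lemma DR_d_wedge:
  assumes c: "c \<in> DR_cochains X" and e: "e \<in> DR_cochains X"
  shows "DR_d (wedge_cochain c e) = wedge_cochain (DR_d c) e + wedge_cochain (\<lambda>n s. sign_by_degree (c n s)) (DR_d e)"
proof (intro ext)
  fix n s x vs
  show "DR_d (wedge_cochain c e) n s x vs
      = (wedge_cochain (DR_d c) e + wedge_cochain (\<lambda>n s. sign_by_degree (c n s)) (DR_d e)) n s x vs"
  proof (cases "s \<in> sing X n")
    case True
    show ?thesis
      using form_d_wedge[OF DR_cochains_forms[OF c True] DR_cochains_forms[OF e True]]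
      by (simp add: DR_d_def)
  next
    case False
    then show ?thesis
      by (simp add: DR_d_def DR_cochains_outside[OF c] DR_cochains_outside[OF e] wedge_zero form_d_zero)
  qed
qed

lemma DR_cochains_sum: "finite I \<Longrightarrow> (\<And>i. i \<in> I \<Longrightarrow> c i \<in> DR_cochains X) \<Longrightarrow> (\<Sum>i\<in>I. c i) \<in> DR_cochains X"
  by (induction I rule: finite_induct) (simp_all add: zero_in_DR_cochains DR_cochains_add)

section \<open>Cohomology classes\<close>

abbreviation cocycle_set :: "'x diffsp \<Rightarrow> 'x cochain set" where
  "cocycle_set X \<equiv> {c \<in> DR_cochains X. DR_d c = 0}"

text \<open>
  The coset of a cocycle, written without the additive group of cocycles;
  \<open>coset_coh_class\<close> identifies the two.
\<close>

definition coh_class :: "'x diffsp \<Rightarrow> 'x cochain \<Rightarrow> 'x cochain set" where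
  "coh_class X c = {b + c | b. b \<in> DR_coboundaries X}"

lemma coboundaryI: "\<beta> \<in> DR_cochains X \<Longrightarrow> DR_d \<beta> = b \<Longrightarrow> b \<in> DR_coboundaries X"
  by (auto simp: DR_coboundaries_def)

lemma coboundaryE:
  assumes "b \<in> DR_coboundaries X"
  obtains \<beta> where "\<beta> \<in> DR_cochains X" "DR_d \<beta> = b"
  using assms by (auto simp: DR_coboundaries_def)

lemma coboundaries_zero: "0 \<in> DR_coboundaries X"
proof -
  have "DR_d 0 = DR_d (0 - 0)" by simp
  also have "\<dots> = 0"
    unfolding DR_d_diff[OF zero_in_DR_cochains zero_in_DR_cochains] by (rule diff_self)
  finally show ?thesis
    by (rule coboundaryI[OF zero_in_DR_cochains])
qed

lemma coboundaries_add: "b \<in> DR_coboundaries X \<Longrightarrow> b' \<in> DR_coboundaries X \<Longrightarrow> b + b' \<in> DR_coboundaries X"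
  by (elim coboundaryE) (rule coboundaryI[OF DR_cochains_add], assumption+, simp only: DR_d_add)

lemma coboundaries_scale: "b \<in> DR_coboundaries X \<Longrightarrow> scale_cochain r b \<in> DR_coboundaries X"
  by (elim coboundaryE) (rule coboundaryI[OF DR_cochains_scale], assumption, simp only: DR_d_scale)

lemma coboundaries_diff: "b \<in> DR_coboundaries X \<Longrightarrow> b' \<in> DR_coboundaries X \<Longrightarrow> b - b' \<in> DR_coboundaries X"
  using coboundaries_add[OF _ coboundaries_scale[of b' X "-1"]] by (simp only: scale_minus_one diff_conv_add_uminus)

lemma coboundaries_sum: "finite I \<Longrightarrow> (\<And>i. i \<in> I \<Longrightarrow> b i \<in> DR_coboundaries X) \<Longrightarrow> (\<Sum>i\<in>I. b i) \<in> DR_coboundaries X"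
  by (induction I rule: finite_induct) (simp_all add: coboundaries_zero coboundaries_add)

lemma coboundaries_cocycles: "b \<in> DR_coboundaries X \<Longrightarrow> b \<in> cocycle_set X"
  by (erule coboundaryE) (auto simp: DR_d_d DR_cochains_d)

lemma mem_coh_class: "e \<in> coh_class X c \<longleftrightarrow> e - c \<in> DR_coboundaries X"
proof
  assume "e - c \<in> DR_coboundaries X"
  moreover have "e = (e - c) + c" by simp
  ultimately show "e \<in> coh_class X c" unfolding coh_class_def by blast
qed (auto simp: coh_class_def)

lemma coh_class_self: "c \<in> coh_class X c"
  by (simp add: mem_coh_class coboundaries_zero)

lemma coh_class_eq_iff: "coh_class X c = coh_class X e \<longleftrightarrow> c - e \<in> DR_coboundaries X"
proof
  assume "coh_class X c = coh_class X e"
  then show "c - e \<in> DR_coboundaries X"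
    using coh_class_self mem_coh_class by blast
next
  assume ce: "c - e \<in> DR_coboundaries X"
  have "u - c \<in> DR_coboundaries X \<longleftrightarrow> u - e \<in> DR_coboundaries X" for u
    using coboundaries_add[OF _ ce, of "u - c"] coboundaries_diff[OF _ ce, of "u - e"] by auto
  then show "coh_class X c = coh_class X e"
    by (auto simp: mem_coh_class)
qed

lemma DR_record:
  "carrier (DR_cocycles X) = cocycle_set X"
  "c \<oplus>\<^bsub>DR_cocycles X\<^esub> e = c + e"
  "c \<otimes>\<^bsub>DR_cocycles X\<^esub> e = wedge_cochain c e"
  "r \<odot>\<^bsub>DR_cocycles X\<^esub> c = scale_cochain r c"
  by (auto simp: DR_cocycles_def DR_algebra_def fun_eq_iff)

lemma coset_coh_class: "DR_coboundaries X +>\<^bsub>DR_cocycles X\<^esub> c = coh_class X c"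
  unfolding a_r_coset_def' coh_class_def DR_record by blast

lemma H_DR_record:
  "carrier (H_DR X) = coh_class X ` cocycle_set X"
  "A \<otimes>\<^bsub>H_DR X\<^esub> B = (\<Union>a\<in>A. \<Union>b\<in>B. coh_class X (wedge_cochain a b))"
  "A \<oplus>\<^bsub>H_DR X\<^esub> B = (\<Union>a\<in>A. \<Union>b\<in>B. {a + b})"
  "\<one>\<^bsub>H_DR X\<^esub> = coh_class X (\<one>\<^bsub>DR_algebra X\<^esub>)"
  "r \<odot>\<^bsub>H_DR X\<^esub> A = (\<Union>c\<in>A. coh_class X (scale_cochain r c))"
  "degree_part (H_DR X) q = {coh_class X c | c. c \<in> cocycle_set X \<and> homogeneous q c}"
  by (auto simp: H_DR_def Let_def FactRing_def A_RCOSETS_def' rcoset_mult_def set_add_def' coset_coh_class DR_record)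
    (auto simp: DR_cocycles_def)

lemma wedge_cochain_add_left: "wedge_cochain (c + c') e = wedge_cochain c e + wedge_cochain c' e"
  by (intro ext) (simp add: add_cochain_apply wedge_add_left)

lemma wedge_cochain_add_right: "wedge_cochain c (e + e') = wedge_cochain c e + wedge_cochain c e'"
  by (intro ext) (simp add: add_cochain_apply wedge_add_right)

lemma form_d_sign_by_degree:
  assumes \<omega>: "\<omega> \<in> forms n"
  shows "form_d n (sign_by_degree \<omega>) x vs = - ((-1) ^ length vs * form_d n \<omega> x vs)"
proof (cases "x \<in> aff n \<and> set vs \<subseteq> aff_dir n")
  case False
  then show ?thesis
    by (simp only: form_d_outside[OF False] mult_zero_right minus_zero)
next
  case True
  then have x: "x \<in> aff n" and vs: "set vs \<subseteq> aff_dir n" by auto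
  show ?thesis
    unfolding form_d_remove_nth[OF x vs] sum_distrib_left sum_negf[symmetric]
  proof (rule sum.cong[OF refl])
    fix i assume "i \<in> {..<length vs}"
    then have i: "i < length vs" and v: "vs ! i \<in> aff_dir n" using vs by auto
    have "(-1) ^ (length vs - 1) = - ((-1) ^ length vs :: real)"
      using i by (cases "length vs") auto
    then have "dir_deriv (vs ! i) (\<lambda>y. sign_by_degree \<omega> y (remove_nth i vs)) x
        = - ((-1) ^ length vs) * dir_deriv (vs ! i) (\<lambda>y. \<omega> y (remove_nth i vs)) x"
      unfolding sign_by_degree_def length_remove_nth[OF i]
      by (simp only: dir_deriv_cmult[OF forms_smooth[OF \<omega> set_remove_nth[OF vs]] x v])
    then show "(-1) ^ i * dir_deriv (vs ! i) (\<lambda>y. sign_by_degree \<omega> y (remove_nth i vs)) x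
        = - ((-1) ^ length vs * ((-1) ^ i * dir_deriv (vs ! i) (\<lambda>y. \<omega> y (remove_nth i vs)) x))"
      by (simp only: mult_minus_left mult_minus_right mult.left_commute)
  qed
qed

lemma DR_d_sign:
  assumes c: "c \<in> cocycle_set X"
  shows "DR_d (\<lambda>n s. sign_by_degree (c n s)) = 0"
proof (intro ext)
  fix n s x vs
  have c': "c \<in> DR_cochains X" and "DR_d c = 0" using c by auto
  then have "DR_d c n s x vs = 0" by simp
  then have d0: "form_d n (c n s) x vs = 0"
    by (simp only: DR_d_def)
  show "DR_d (\<lambda>n s. sign_by_degree (c n s)) n s x vs = 0 n s x vs"
  proof (cases "s \<in> sing X n")
    case True
    show ?thesis
      unfolding DR_d_def form_d_sign_by_degree[OF DR_cochains_forms[OF c' True]] d0 by simp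
  next
    case False
    have "sign_by_degree (\<lambda>x vs. 0) = (\<lambda>x vs. 0)"
      by (intro ext) (simp add: sign_by_degree_def)
    then show ?thesis
      by (simp add: DR_d_def DR_cochains_outside[OF c' False] form_d_zero)
  qed
qed

lemma sign_by_degree_twice: "sign_by_degree (sign_by_degree \<omega>) = \<omega>"
  by (intro ext) (simp add: sign_by_degree_def flip: mult.assoc power_mult_distrib)

text \<open>
  If b = d\<open>\<beta>\<close> and e is a cocycle, then b e = d(\<open>\<beta>\<close> e) by
  the Leibniz rule.
\<close>

lemma wedge_coboundary_left:
  assumes b: "b \<in> DR_coboundaries X" and e: "e \<in> cocycle_set X"
  shows "wedge_cochain b e \<in> DR_coboundaries X"
proof -
  obtain \<beta> where \<beta>: "\<beta> \<in> DR_cochains X" "DR_d \<beta> = b"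
    using b by (rule coboundaryE)
  have e': "e \<in> DR_cochains X" "DR_d e = 0" using e by auto
  have "DR_d (wedge_cochain \<beta> e) = wedge_cochain b e"
    unfolding DR_d_wedge[OF \<beta>(1) e'(1)] e'(2) \<beta>(2)
    by (simp add: zero_fun_def plus_fun_def wedge_zero)
  then show ?thesis
    by (rule coboundaryI[OF DR_cochains_wedge[OF \<beta>(1) e'(1)]])
qed

text \<open>
  If b = d\<open>\<beta>\<close> and c is a cocycle, then c b = d(c' \<open>\<beta>\<close>),
  where c' is c with the sign of its degree: the two signs in the Leibniz rule cancel.
\<close>

lemma wedge_coboundary_right:
  assumes c: "c \<in> cocycle_set X" and b: "b \<in> DR_coboundaries X"
  shows "wedge_cochain c b \<in> DR_coboundaries X"
proof -
  obtain \<beta> where \<beta>: "\<beta> \<in> DR_cochains X" "DR_d \<beta> = b"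
    using b by (rule coboundaryE)
  have c': "c \<in> DR_cochains X" using c by auto
  let ?c = "\<lambda>n s. sign_by_degree (c n s)"
  have "DR_d (wedge_cochain ?c \<beta>) = wedge_cochain c b"
    unfolding DR_d_wedge[OF DR_cochains_sign[OF c'] \<beta>(1)] DR_d_sign[OF c] \<beta>(2) sign_by_degree_twice
    by (simp add: zero_fun_def plus_fun_def wedge_zero)
  then show ?thesis
    by (rule coboundaryI[OF DR_cochains_wedge[OF DR_cochains_sign[OF c'] \<beta>(1)]])
qed

lemma cocycles_add_coboundary:
  assumes "c \<in> cocycle_set X" "c' - c \<in> DR_coboundaries X"
  shows "c' \<in> cocycle_set X"
proof -
  have "c' - c \<in> cocycle_set X" by (rule coboundaries_cocycles[OF assms(2)])
  then have "c' - c + c \<in> DR_cochains X" "DR_d (c' - c + c) = 0"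
    using assms(1) DR_cochains_add[of "c' - c" X c] DR_d_add[of "c' - c" X c] by auto
  then show ?thesis by simp
qed

text \<open>
  The union over all representatives is a single coset because coboundaries form an ideal in the
  cocycles.
\<close>

lemma coh_class_mult:
  assumes c: "c \<in> cocycle_set X" and e: "e \<in> cocycle_set X"
  shows "coh_class X c \<otimes>\<^bsub>H_DR X\<^esub> coh_class X e = coh_class X (wedge_cochain c e)"
proof -
  have "coh_class X (wedge_cochain c' e') = coh_class X (wedge_cochain c e)"
    if "c' \<in> coh_class X c" "e' \<in> coh_class X e" for c' e'
  proof -
    have c': "c' - c \<in> DR_coboundaries X" and e': "e' - e \<in> DR_coboundaries X"
      using that by (auto simp: mem_coh_class)
    have "wedge_cochain c' e' = wedge_cochain ((c' - c) + c) e'" by simp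
    also have "\<dots> = wedge_cochain (c' - c) e' + wedge_cochain c ((e' - e) + e)"
      unfolding wedge_cochain_add_left by simp
    also have "\<dots> = wedge_cochain (c' - c) e' + (wedge_cochain c (e' - e) + wedge_cochain c e)"
      unfolding wedge_cochain_add_right ..
    finally have "wedge_cochain c' e' - wedge_cochain c e = wedge_cochain (c' - c) e' + wedge_cochain c (e' - e)"
      by simp
    moreover have "\<dots> \<in> DR_coboundaries X"
      by (intro coboundaries_add wedge_coboundary_left wedge_coboundary_right c c' e' cocycles_add_coboundary[OF e e'])
    ultimately show ?thesis
      by (simp only: coh_class_eq_iff)
  qed
  then show ?thesis
    unfolding H_DR_record using coh_class_self by blast
qed

lemma coh_class_add:
  "coh_class X c \<oplus>\<^bsub>H_DR X\<^esub> coh_class X e = coh_class X (c + e)"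
proof -
  have "a + b \<in> coh_class X (c + e)" if "a \<in> coh_class X c" "b \<in> coh_class X e" for a b
  proof -
    have "a + b - (c + e) = (a - c) + (b - e)" by simp
    then show ?thesis
      using that coboundaries_add[of "a - c" X "b - e"] by (simp only: mem_coh_class)
  qed
  moreover have "\<exists>a\<in>coh_class X c. \<exists>b\<in>coh_class X e. u = a + b" if "u \<in> coh_class X (c + e)" for u
  proof -
    have "u - e - c = u - (c + e)" by (simp add: algebra_simps)
    then have "u - e \<in> coh_class X c"
      using that by (simp only: mem_coh_class)
    moreover have "u = (u - e) + e" by simp
    ultimately show ?thesis using coh_class_self by blast
  qed
  ultimately show ?thesis
    unfolding H_DR_record by blast
qed

lemma coh_class_scale:
  "r \<odot>\<^bsub>H_DR X\<^esub> coh_class X c = coh_class X (scale_cochain r c)"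
proof -
  have "coh_class X (scale_cochain r c') = coh_class X (scale_cochain r c)" if "c' \<in> coh_class X c" for c'
  proof -
    have "scale_cochain r c' - scale_cochain r c = scale_cochain r (c' - c)"
      by (simp add: fun_diff_def right_diff_distrib)
    then show ?thesis
      using that coboundaries_scale by (simp only: coh_class_eq_iff mem_coh_class)
  qed
  then show ?thesis
    unfolding H_DR_record using coh_class_self by blast
qed


section \<open>Pullback of cochains\<close>

lemma standard_simplex_subset_Euclidean_space: "standard_simplex n \<subseteq> topspace (Euclidean_space (Suc n))"
  by (auto simp: standard_simplex_def)

lemma pts_std_simplex: "pts (std_simplex n) = standard_simplex n"
proof (cases n rule: std_simplex.cases)
  case 1
  then show ?thesis
    using standard_simplex_subset_Euclidean_space[of 0] by (auto simp: subspace_diff_def euclid_def)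
next
  case 2
  then show ?thesis
    using standard_simplex_subset_Euclidean_space[of 1] by (auto simp: subspace_diff_def euclid_def numeral_2_eq_2)
qed (simp add: final_diff_def)

lemma sing_mem: "s \<in> sing X n \<Longrightarrow> x \<in> standard_simplex n \<Longrightarrow> s x \<in> pts X"
  by (auto simp: sing_def smooth_def pts_std_simplex)

lemma sing_extensional: "s \<in> sing X n \<Longrightarrow> s \<in> extensional (standard_simplex n)"
  by (simp add: sing_def)

lemma vertex_map_simplex:
  assumes a: "a \<in> {..m} \<rightarrow> {..n}" and x: "x \<in> standard_simplex m"
  shows "vertex_map m a x \<in> standard_simplex n"
proof -
  have nonneg: "\<And>i. 0 \<le> x i" and sum1: "(\<Sum>i\<le>m. x i) = 1"
    using x by (auto simp: standard_simplex_def)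
  have "vertex_map m a x j \<le> (\<Sum>i\<le>m. x i)" for j
    unfolding vertex_map_def by (rule sum_mono2) (auto simp: nonneg)
  moreover have "0 \<le> vertex_map m a x j" for j
    unfolding vertex_map_def by (rule sum_nonneg) (rule nonneg)
  ultimately show ?thesis
    using sum_vertex_map[OF a, of x] vertex_map_outside[OF a] sum1 by (auto simp: standard_simplex_def)
qed

text \<open>
  Compatibility with vertex maps is required also where a face of s is not a smooth simplex;
  there a cochain is 0. The second assumption makes the faces of s and of g s smooth
  simultaneously, so that both values are 0 together.
\<close>

lemma cochain_pullback_in_DR_cochains:
  assumes maps: "\<And>n s. s \<in> sing X n \<Longrightarrow> compose (standard_simplex n) g s \<in> sing Y n"
    and faces: "\<And>m n a s. a \<in> {..m::nat} \<rightarrow> {..n::nat} \<Longrightarrow> s \<in> sing X n \<Longrightarrow>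
        compose (standard_simplex m) (compose (standard_simplex n) g s) (vertex_map m a) \<in> sing Y m \<Longrightarrow>
        compose (standard_simplex m) s (vertex_map m a) \<in> sing X m"
    and c: "c \<in> DR_cochains Y"
  shows "cochain_pullback X g c \<in> DR_cochains X"
proof -
  obtain N where N: "\<forall>n s x vs. N < length vs \<longrightarrow> c n s x vs = 0"
    using DR_cochains_bounded[OF c] by blast
  show ?thesis
  proof (rule DR_cochainsI[where N = N])
    fix m n a s assume a: "mono_on {..m::nat} a" "a \<in> {..m::nat} \<rightarrow> {..n::nat}" and s: "s \<in> sing X n"
    let ?s = "compose (standard_simplex m) s (vertex_map m a)"
    have eq: "compose (standard_simplex m) g ?s = compose (standard_simplex m) (compose (standard_simplex n) g s) (vertex_map m a)"
      using vertex_map_simplex[OF a(2)] by (auto simp: compose_def fun_eq_iff)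
    have "cochain_pullback X g c m ?s = c m (compose (standard_simplex m) g ?s)"
    proof (cases "?s \<in> sing X m")
      case False
      then have "compose (standard_simplex m) g ?s \<notin> sing Y m"
        using faces[OF a(2) s] eq by auto
      then show ?thesis
        using False by (simp add: cochain_pullback_def DR_cochains_outside[OF c])
    qed (simp add: cochain_pullback_def)
    then show "cochain_pullback X g c m ?s = form_pullback m a (cochain_pullback X g c n s)"
      unfolding eq DR_cochains_pullback[OF c a maps[OF s]] using s by (simp add: cochain_pullback_def)
  qed (use N in \<open>auto simp: cochain_pullback_def DR_cochains_forms[OF c] maps\<close>)
qed

lemma cochain_pullback_add: "cochain_pullback X g (c + e) = cochain_pullback X g c + cochain_pullback X g e"
  by (intro ext) (simp add: cochain_pullback_def)

lemma cochain_pullback_diff: "cochain_pullback X g (c - e) = cochain_pullback X g c - cochain_pullback X g e"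
  by (intro ext) (simp add: cochain_pullback_def)

lemma cochain_pullback_zero: "cochain_pullback X g 0 = 0"
  by (intro ext) (simp add: cochain_pullback_def)

lemma cochain_pullback_scale: "cochain_pullback X g (scale_cochain r c) = scale_cochain r (cochain_pullback X g c)"
  by (intro ext) (simp add: cochain_pullback_def)

lemma cochain_pullback_sum: "finite I \<Longrightarrow> cochain_pullback X g (\<Sum>i\<in>I. c i) = (\<Sum>i\<in>I. cochain_pullback X g (c i))"
proof (induction I rule: finite_induct)
  case empty
  show ?case by (simp only: sum.empty cochain_pullback_zero)
next
  case (insert i I)
  then show ?case by (simp only: sum.insert[OF insert.hyps] cochain_pullback_add)
qed

lemma cochain_pullback_wedge:
  "cochain_pullback X g (wedge_cochain c e) = wedge_cochain (cochain_pullback X g c) (cochain_pullback X g e)"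
  by (intro ext) (simp add: cochain_pullback_def wedge_zero)

lemma cochain_pullback_DR_d: "DR_d (cochain_pullback X g c) = cochain_pullback X g (DR_d c)"
  by (intro ext) (simp add: cochain_pullback_def DR_d_def form_d_zero)

lemma homogeneous_cochain_pullback: "homogeneous q c \<Longrightarrow> homogeneous q (cochain_pullback X g c)"
  by (simp add: homogeneous_def cochain_pullback_def)

lemma H_pullback_coh_class:
  assumes "\<And>c. c \<in> DR_cochains Y \<Longrightarrow> cochain_pullback X g c \<in> DR_cochains X"
  shows "H_pullback X g (coh_class Y c) = coh_class X (cochain_pullback X g c)"
proof -
  have "coh_class X (cochain_pullback X g c') = coh_class X (cochain_pullback X g c)" if c': "c' \<in> coh_class Y c" for c'
  proof -
    obtain \<beta> where \<beta>: "\<beta> \<in> DR_cochains Y" "DR_d \<beta> = c' - c"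
      using c' unfolding mem_coh_class by (rule coboundaryE)
    then have "DR_d (cochain_pullback X g \<beta>) = cochain_pullback X g c' - cochain_pullback X g c"
      by (simp only: cochain_pullback_DR_d cochain_pullback_diff)
    then show ?thesis
      unfolding coh_class_eq_iff using assms[OF \<beta>(1)] coboundaryI by blast
  qed
  then show ?thesis
    unfolding H_pullback_def coset_coh_class using coh_class_self by blast
qed

section \<open>Cohomology of a quotient on the level of simplices\<close>

text \<open>
  The part of the covering situation that the cohomological argument uses: on smooth simplices,
  f is the quotient map for the action of G. The last condition says that a face of a simplex of
  X is smooth as soon as its image in Y is, which holds for a covering because smoothness
  downstairs lifts.
\<close>

locale simplicial_quotient =
  fixes G :: "('g, 'c) monoid_scheme" and X :: "'x diffsp" and Y :: "'y diffsp"
    and act :: "'g \<Rightarrow> 'x \<Rightarrow> 'x" and f :: "'x \<Rightarrow> 'y"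
  assumes group: "group G" and finite_carrier: "finite (carrier G)"
    and map_sing: "\<And>n s. s \<in> sing X n \<Longrightarrow> compose (standard_simplex n) f s \<in> sing Y n"
    and act_sing: "\<And>h n s. h \<in> carrier G \<Longrightarrow> s \<in> sing X n \<Longrightarrow> compose (standard_simplex n) (act h) s \<in> sing X n"
    and act_one: "\<And>x. x \<in> pts X \<Longrightarrow> act \<one>\<^bsub>G\<^esub> x = x"
    and act_mult: "\<And>h k x. h \<in> carrier G \<Longrightarrow> k \<in> carrier G \<Longrightarrow> x \<in> pts X \<Longrightarrow> act (h \<otimes>\<^bsub>G\<^esub> k) x = act h (act k x)"
    and map_act: "\<And>h x. h \<in> carrier G \<Longrightarrow> x \<in> pts X \<Longrightarrow> f (act h x) = f x"
    and lift: "\<And>n t. t \<in> sing Y n \<Longrightarrow> \<exists>s\<in>sing X n. compose (standard_simplex n) f s = t"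
    and orbit: "\<And>n s s'. s \<in> sing X n \<Longrightarrow> s' \<in> sing X n \<Longrightarrow>
        compose (standard_simplex n) f s = compose (standard_simplex n) f s' \<Longrightarrow>
        \<exists>h\<in>carrier G. s' = compose (standard_simplex n) (act h) s"
    and lift_face: "\<And>m n a s. a \<in> {..m::nat} \<rightarrow> {..n::nat} \<Longrightarrow> s \<in> sing X n \<Longrightarrow>
        compose (standard_simplex m) (compose (standard_simplex n) f s) (vertex_map m a) \<in> sing Y m \<Longrightarrow>
        compose (standard_simplex m) s (vertex_map m a) \<in> sing X m"
begin

interpretation G: group G by (rule group)

abbreviation pull where "pull \<equiv> cochain_pullback X f"
abbreviation move where "move h \<equiv> cochain_pullback X (act h)"

lemma pull_in_cochains: "c \<in> DR_cochains Y \<Longrightarrow> pull c \<in> DR_cochains X"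
  by (rule cochain_pullback_in_DR_cochains[OF map_sing lift_face])

lemma act_inv_act:
  assumes "h \<in> carrier G" "x \<in> pts X"
  shows "act (inv\<^bsub>G\<^esub> h) (act h x) = x"
  using act_mult[of "inv\<^bsub>G\<^esub> h" h x] act_one[OF assms(2)] assms by simp

lemma move_in_cochains:
  assumes h: "h \<in> carrier G" and c: "c \<in> DR_cochains X"
  shows "move h c \<in> DR_cochains X"
proof (rule cochain_pullback_in_DR_cochains[OF act_sing[OF h] _ c])
  fix m n a s assume a: "a \<in> {..m::nat} \<rightarrow> {..n::nat}" and s: "s \<in> sing X n"
    and "compose (standard_simplex m) (compose (standard_simplex n) (act h) s) (vertex_map m a) \<in> sing X m" (is "?t \<in> _")
  then have "compose (standard_simplex m) (act (inv\<^bsub>G\<^esub> h)) ?t \<in> sing X m"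
    using act_sing[of "inv\<^bsub>G\<^esub> h"] h by simp
  also have "compose (standard_simplex m) (act (inv\<^bsub>G\<^esub> h)) ?t = compose (standard_simplex m) s (vertex_map m a)"
    using vertex_map_simplex[OF a] act_inv_act[OF h sing_mem[OF s]] by (auto simp: compose_def fun_eq_iff)
  finally show "compose (standard_simplex m) s (vertex_map m a) \<in> sing X m" .
qed

lemma compose_map_act:
  assumes h: "h \<in> carrier G" and s: "s \<in> sing X n"
  shows "compose (standard_simplex n) f (compose (standard_simplex n) (act h) s) = compose (standard_simplex n) f s"
  using map_act[OF h sing_mem[OF s]] by (auto simp: compose_def fun_eq_iff)

lemma move_pull:
  assumes h: "h \<in> carrier G"
  shows "move h (pull c) = pull c"
  by (intro ext) (simp add: cochain_pullback_def compose_map_act[OF h] act_sing[OF h])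

lemma move_move:
  assumes h: "h \<in> carrier G" and k: "k \<in> carrier G"
  shows "move k (move h c) = move (h \<otimes>\<^bsub>G\<^esub> k) c"
proof (intro ext)
  fix n s
  show "move k (move h c) n s x vs = move (h \<otimes>\<^bsub>G\<^esub> k) c n s x vs" for x vs
  proof (cases "s \<in> sing X n")
    case True
    have "compose (standard_simplex n) (act h) (compose (standard_simplex n) (act k) s)
        = compose (standard_simplex n) (act (h \<otimes>\<^bsub>G\<^esub> k)) s"
      using act_mult[OF h k sing_mem[OF True]] by (auto simp: compose_def fun_eq_iff)
    then show ?thesis
      using True by (simp add: cochain_pullback_def act_sing[OF k])
  qed (simp add: cochain_pullback_def)
qed

lemma pull_inject:
  assumes c: "c \<in> DR_cochains Y" and e: "e \<in> DR_cochains Y" and eq: "pull c = pull e"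
  shows "c = e"
proof (intro ext)
  fix n t
  have "c n t = e n t"
  proof (cases "t \<in> sing Y n")
    case True
    then obtain s where s: "s \<in> sing X n" "compose (standard_simplex n) f s = t"
      using lift by blast
    have "pull c n s = pull e n s" by (simp only: eq)
    then show ?thesis
      using s by (simp add: cochain_pullback_def)
  qed (simp add: DR_cochains_outside[OF c] DR_cochains_outside[OF e])
  then show "c n t x vs = e n t x vs" for x vs by simp
qed

text \<open>
  The value of e on a simplex of Y is the value of c on any of its lifts; by invariance of c the
  choice does not matter, as the lifts form one orbit.
\<close>

lemma invariant_cochain_descends:
  assumes c: "c \<in> DR_cochains X" and inv: "\<And>h. h \<in> carrier G \<Longrightarrow> move h c = c"
  obtains e where "e \<in> DR_cochains Y" "pull e = c" "\<And>q. homogeneous q c \<Longrightarrow> homogeneous q e"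
proof -
  define lft where "lft n t = (SOME s. s \<in> sing X n \<and> compose (standard_simplex n) f s = t)" for n t
  define e where "e n t = (if t \<in> sing Y n then c n (lft n t) else (\<lambda>x vs. 0))" for n t
  have lft: "lft n t \<in> sing X n" "compose (standard_simplex n) f (lft n t) = t" if "t \<in> sing Y n" for n t
    using someI_ex[of "\<lambda>s. s \<in> sing X n \<and> compose (standard_simplex n) f s = t"] lift[OF that]
    unfolding lft_def by blast+
  have e_eq: "e n (compose (standard_simplex n) f s) = c n s" if s: "s \<in> sing X n" for n s
  proof -
    let ?t = "compose (standard_simplex n) f s"
    have t: "?t \<in> sing Y n" by (rule map_sing[OF s])
    obtain h where h: "h \<in> carrier G" "lft n ?t = compose (standard_simplex n) (act h) s"
      using orbit[OF s lft(1)[OF t] lft(2)[OF t, symmetric]] by blast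
    have "c n (lft n ?t) = move h c n s"
      using s h by (simp add: cochain_pullback_def)
    then show ?thesis
      using t by (simp add: e_def inv[OF h(1)])
  qed
  obtain N where N: "\<forall>n s x vs. N < length vs \<longrightarrow> c n s x vs = 0"
    using DR_cochains_bounded[OF c] by blast
  have "e \<in> DR_cochains Y"
  proof (rule DR_cochainsI[where N = N])
    fix m n a t assume a: "mono_on {..m::nat} a" "a \<in> {..m::nat} \<rightarrow> {..n::nat}" and t: "t \<in> sing Y n"
    let ?t = "compose (standard_simplex m) t (vertex_map m a)"
    let ?s = "compose (standard_simplex m) (lft n t) (vertex_map m a)"
    have eq: "compose (standard_simplex m) f ?s = ?t"
      using vertex_map_simplex[OF a(2)]
      by (subst (2) lft(2)[OF t, symmetric]) (auto simp: compose_def fun_eq_iff)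
    have "e m ?t = c m ?s"
    proof (cases "?t \<in> sing Y m")
      case True
      then have "?s \<in> sing X m"
        using lift_face[OF a(2) lft(1)[OF t]] lft(2)[OF t] by simp
      from e_eq[OF this] show ?thesis by (simp only: eq)
    next
      case False
      then have "?s \<notin> sing X m" using map_sing[of ?s m] eq by auto
      with False show ?thesis by (simp add: e_def DR_cochains_outside[OF c])
    qed
    also have "\<dots> = form_pullback m a (c n (lft n t))"
      by (rule DR_cochains_pullback[OF c a lft(1)[OF t]])
    finally show "e m ?t = form_pullback m a (e n t)"
      using t by (simp add: e_def)
  qed (use N in \<open>auto simp: e_def DR_cochains_forms[OF c] lft\<close>)
  moreover have "pull e = c"
  proof (intro ext)
    fix n s x vs
    show "pull e n s x vs = c n s x vs"
      by (cases "s \<in> sing X n") (simp_all add: cochain_pullback_def e_eq DR_cochains_outside[OF c])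
  qed
  moreover have "homogeneous q e" if "homogeneous q c" for q
    using that by (simp add: homogeneous_def e_def)
  ultimately show ?thesis by (rule that)
qed

definition average :: "'x cochain \<Rightarrow> 'x cochain" where
  "average c = scale_cochain (1 / card (carrier G)) (\<Sum>h\<in>carrier G. move h c)"

lemma card_carrier: "card (carrier G) \<noteq> 0"
  using finite_carrier G.one_closed by auto

lemma sum_cochain_apply: "(\<Sum>i\<in>I. c i :: 'x cochain) n s x vs = (\<Sum>i\<in>I. c i n s x vs)"
  by (induction I rule: infinite_finite_induct) simp_all

lemma average_in_cochains: "c \<in> DR_cochains X \<Longrightarrow> average c \<in> DR_cochains X"
  unfolding average_def
  by (intro DR_cochains_scale DR_cochains_sum finite_carrier move_in_cochains)

lemma move_average:
  assumes k: "k \<in> carrier G"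
  shows "move k (average c) = average c"
proof -
  have "(\<Sum>h\<in>carrier G. move k (move h c)) = (\<Sum>h\<in>carrier G. move (h \<otimes>\<^bsub>G\<^esub> k) c)"
    by (rule sum.cong[OF refl]) (rule move_move[OF _ k])
  also have "\<dots> = (\<Sum>h\<in>carrier G. move h c)"
    by (rule sum.reindex_bij_witness[where i = "\<lambda>h. h \<otimes>\<^bsub>G\<^esub> inv\<^bsub>G\<^esub> k" and j = "\<lambda>h. h \<otimes>\<^bsub>G\<^esub> k"])
      (auto simp: k G.m_assoc)
  finally show ?thesis
    by (simp only: average_def cochain_pullback_scale cochain_pullback_sum[OF finite_carrier])
qed

lemma average_invariant:
  assumes "\<And>h. h \<in> carrier G \<Longrightarrow> move h c = c"
  shows "average c = c"
proof -
  have "(\<Sum>h\<in>carrier G. move h c n s x vs) = real (card (carrier G)) * c n s x vs" for n s x vs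
    by (simp add: assms)
  then show ?thesis
    unfolding average_def using card_carrier by (intro ext) (simp add: sum_cochain_apply)
qed

lemma DR_d_zero: "DR_d 0 = 0"
  by (intro ext) (simp add: DR_d_def form_d_def)

lemma DR_d_sum:
  fixes c :: "'i \<Rightarrow> 'x cochain"
  shows "finite I \<Longrightarrow> (\<And>i. i \<in> I \<Longrightarrow> c i \<in> DR_cochains X) \<Longrightarrow> DR_d (\<Sum>i\<in>I. c i) = (\<Sum>i\<in>I. DR_d (c i))"
proof (induction I rule: finite_induct)
  case empty
  show ?case by (simp only: sum.empty DR_d_zero)
next
  case (insert i I)
  have c: "c i \<in> DR_cochains X" "(\<Sum>i\<in>I. c i) \<in> DR_cochains X"
    using insert by (auto intro: DR_cochains_sum)
  have "DR_d (\<Sum>i\<in>I. c i) = (\<Sum>i\<in>I. DR_d (c i))"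
    by (rule insert.IH) (rule insert.prems, rule insertI2)
  then show ?case
    by (simp only: sum.insert[OF insert.hyps] DR_d_add[OF c])
qed

lemma DR_d_average:
  assumes c: "c \<in> DR_cochains X"
  shows "DR_d (average c) = average (DR_d c)"
proof -
  have "DR_d (\<Sum>h\<in>carrier G. move h c) = (\<Sum>h\<in>carrier G. DR_d (move h c))"
    by (rule DR_d_sum[OF finite_carrier move_in_cochains[OF _ c]])
  then show ?thesis
    unfolding average_def
    by (simp only: DR_d_scale[OF DR_cochains_sum[OF finite_carrier move_in_cochains[OF _ c]]] cochain_pullback_DR_d)
qed

text \<open>The difference is the mean of the coboundaries \<open>move h c - c\<close>.\<close>

lemma average_cohomologous:
  assumes "\<And>h. h \<in> carrier G \<Longrightarrow> move h c - c \<in> DR_coboundaries X"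
  shows "average c - c \<in> DR_coboundaries X"
proof -
  have "average c - c = scale_cochain (1 / card (carrier G)) (\<Sum>h\<in>carrier G. move h c - c)"
    using card_carrier
    by (intro ext) (simp add: average_def sum_cochain_apply sum_subtractf field_simps)
  then show ?thesis
    using coboundaries_scale[OF coboundaries_sum[OF finite_carrier assms]] by (simp only:)
qed

lemma homogeneous_average: "homogeneous q c \<Longrightarrow> homogeneous q (average c)"
proof -
  assume c: "homogeneous q c"
  have "move h c n s x vs = 0" if "length vs \<noteq> q" for h n s x vs
    using homogeneous_cochain_pullback[OF c, of X "act h"] that unfolding homogeneous_def by blast
  then have "(\<Sum>h\<in>carrier G. move h c n s x vs) = 0" if "length vs \<noteq> q" for n s x vs
    using that by (intro sum.neutral) blast
  then show ?thesis
    unfolding homogeneous_def average_def sum_cochain_apply by simp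
qed

lemma H_pullback_pull: "H_pullback X f (coh_class Y c) = coh_class X (pull c)"
  by (rule H_pullback_coh_class[OF pull_in_cochains])

lemma H_pullback_move: "h \<in> carrier G \<Longrightarrow> H_pullback X (act h) (coh_class X c) = coh_class X (move h c)"
  by (rule H_pullback_coh_class[OF move_in_cochains])

lemma pull_cocycle: "c \<in> cocycle_set Y \<Longrightarrow> pull c \<in> cocycle_set X"
  by (simp add: pull_in_cochains cochain_pullback_DR_d cochain_pullback_zero)

text \<open>
  For each h in G the equation \<open>\<nabla>(x) = 1 \<otimes> x\<close> says that
  \<open>h\<^sup>*x = x\<close>.
\<close>

lemma carrier_cotensor:
  "carrier (cotensor G X act) =
     {coh_class X c | c. c \<in> cocycle_set X \<and> (\<forall>h\<in>carrier G. move h c - c \<in> DR_coboundaries X)}"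
proof -
  have "coaction G X act (coh_class X c) = dual_tensor G (H_DR X) (\<lambda>_. 1) (coh_class X c)
      \<longleftrightarrow> (\<forall>h\<in>carrier G. move h c - c \<in> DR_coboundaries X)" for c
  proof -
    have "coaction G X act (coh_class X c) = (\<lambda>h\<in>carrier G. coh_class X (move h c))"
      unfolding coaction_def
      by (rule restrict_ext) (rule H_pullback_move)
    moreover have "dual_tensor G (H_DR X) (\<lambda>_. 1) (coh_class X c) = (\<lambda>h\<in>carrier G. coh_class X c)"
      unfolding dual_tensor_def coh_class_scale by simp
    moreover have "(\<lambda>h\<in>carrier G. coh_class X (move h c)) = (\<lambda>h\<in>carrier G. coh_class X c)
        \<longleftrightarrow> (\<forall>h\<in>carrier G. coh_class X (move h c) = coh_class X c)"
      by (auto simp: fun_eq_iff restrict_def)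
    ultimately show ?thesis
      by (simp only: coh_class_eq_iff)
  qed
  then show ?thesis
    unfolding cotensor_def Let_def by (auto simp: H_DR_record)
qed

lemma cotensor_record:
  "A \<otimes>\<^bsub>cotensor G X act\<^esub> B = A \<otimes>\<^bsub>H_DR X\<^esub> B"
  "A \<oplus>\<^bsub>cotensor G X act\<^esub> B = A \<oplus>\<^bsub>H_DR X\<^esub> B"
  "\<one>\<^bsub>cotensor G X act\<^esub> = \<one>\<^bsub>H_DR X\<^esub>"
  "r \<odot>\<^bsub>cotensor G X act\<^esub> A = r \<odot>\<^bsub>H_DR X\<^esub> A"
  "degree_part (cotensor G X act) q = degree_part (H_DR X) q \<inter> carrier (cotensor G X act)"
  by (simp_all add: cotensor_def Let_def)

text \<open>
  An invariant class is represented by the average of any of its cocycles, which descends to Y.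
  What it descends to is a cocycle since pulling back is injective on cochains.
\<close>

lemma invariant_class_lifts:
  assumes c: "c \<in> cocycle_set X" and inv: "\<forall>h\<in>carrier G. move h c - c \<in> DR_coboundaries X"
  obtains e where "e \<in> cocycle_set Y" "coh_class X (pull e) = coh_class X c"
    "\<And>q. homogeneous q c \<Longrightarrow> homogeneous q e"
proof -
  have c': "c \<in> DR_cochains X" "DR_d c = 0" using c by auto
  obtain e where e: "e \<in> DR_cochains Y" "pull e = average c" "\<And>q. homogeneous q (average c) \<Longrightarrow> homogeneous q e"
    using invariant_cochain_descends[OF average_in_cochains[OF c'(1)] move_average] by metis
  have "pull (DR_d e) = DR_d (average c)"
    by (simp only: cochain_pullback_DR_d[symmetric] e(2))
  also have "\<dots> = average 0"
    by (simp only: DR_d_average[OF c'(1)] c'(2))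
  also have "\<dots> = pull 0"
    by (simp only: average_invariant[OF cochain_pullback_zero] cochain_pullback_zero)
  finally have "DR_d e = 0"
    by (rule pull_inject[OF DR_cochains_d[OF e(1)] zero_in_DR_cochains])
  moreover have "coh_class X (pull e) = coh_class X c"
    unfolding e(2) coh_class_eq_iff using inv by (intro average_cohomologous) blast
  ultimately show ?thesis
    using e homogeneous_average by (intro that[of e]) auto
qed

text \<open>
  Injectivity uses the average again: if the pullback of c is the coboundary of some cochain,
  then it is also the coboundary of the average of that cochain, which comes from Y.
\<close>

theorem H_pullback_iso: "H_pullback X f \<in> galgebra_iso (H_DR Y) (cotensor G X act)"
proof -
  let ?F = "H_pullback X f"
  have in_K: "coh_class X (pull c) \<in> carrier (cotensor G X act)" if "c \<in> cocycle_set Y" for c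
  proof -
    have "move h (pull c) - pull c \<in> DR_coboundaries X" if "h \<in> carrier G" for h
      unfolding move_pull[OF that] diff_self by (rule coboundaries_zero)
    then show ?thesis
      unfolding carrier_cotensor using pull_cocycle[OF that] by blast
  qed
  have "?F \<in> ring_hom (H_DR Y) (cotensor G X act)"
  proof (rule ring_hom_memI)
    fix A assume "A \<in> carrier (H_DR Y)"
    then show "?F A \<in> carrier (cotensor G X act)"
      by (auto simp: H_DR_record H_pullback_pull intro!: in_K)
  next
    fix A B assume "A \<in> carrier (H_DR Y)" "B \<in> carrier (H_DR Y)"
    then obtain a b where a: "a \<in> cocycle_set Y" "A = coh_class Y a" and b: "b \<in> cocycle_set Y" "B = coh_class Y b"
      unfolding H_DR_record by blast
    show "?F (A \<otimes>\<^bsub>H_DR Y\<^esub> B) = ?F A \<otimes>\<^bsub>cotensor G X act\<^esub> ?F B"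
      unfolding cotensor_record a(2) b(2) coh_class_mult[OF a(1) b(1)] H_pullback_pull
        coh_class_mult[OF pull_cocycle[OF a(1)] pull_cocycle[OF b(1)]] cochain_pullback_wedge ..
    show "?F (A \<oplus>\<^bsub>H_DR Y\<^esub> B) = ?F A \<oplus>\<^bsub>cotensor G X act\<^esub> ?F B"
      unfolding cotensor_record a(2) b(2) coh_class_add H_pullback_pull cochain_pullback_add ..
  next
    have "pull (\<one>\<^bsub>DR_algebra Y\<^esub>) = \<one>\<^bsub>DR_algebra X\<^esub>"
      by (intro ext) (simp add: DR_algebra_def cochain_pullback_def map_sing)
    then show "?F \<one>\<^bsub>H_DR Y\<^esub> = \<one>\<^bsub>cotensor G X act\<^esub>"
      by (simp only: cotensor_record H_DR_record H_pullback_pull)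
  qed
  moreover have "bij_betw ?F (carrier (H_DR Y)) (carrier (cotensor G X act))"
  proof (rule bij_betw_imageI)
    show "inj_on ?F (carrier (H_DR Y))"
    proof (rule inj_onI)
      fix A B assume "A \<in> carrier (H_DR Y)" "B \<in> carrier (H_DR Y)" and eq: "?F A = ?F B"
      then obtain a b where a: "a \<in> cocycle_set Y" "A = coh_class Y a" and b: "b \<in> cocycle_set Y" "B = coh_class Y b"
        unfolding H_DR_record by blast
      have ab: "a - b \<in> DR_cochains Y"
        using a b DR_cochains_diff by blast
      have "pull (a - b) \<in> DR_coboundaries X"
        using eq unfolding a(2) b(2) H_pullback_pull coh_class_eq_iff cochain_pullback_diff .
      then obtain \<beta> where \<beta>: "\<beta> \<in> DR_cochains X" "DR_d \<beta> = pull (a - b)"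
        by (rule coboundaryE)
      obtain \<gamma> where \<gamma>: "\<gamma> \<in> DR_cochains Y" "pull \<gamma> = average \<beta>"
        using invariant_cochain_descends[OF average_in_cochains[OF \<beta>(1)] move_average] by metis
      have "pull (DR_d \<gamma>) = average (pull (a - b))"
        by (simp only: cochain_pullback_DR_d[symmetric] \<gamma>(2) DR_d_average[OF \<beta>(1)] \<beta>(2))
      also have "\<dots> = pull (a - b)"
        by (rule average_invariant[OF move_pull])
      finally have "DR_d \<gamma> = a - b"
        by (rule pull_inject[OF DR_cochains_d[OF \<gamma>(1)] ab])
      then show "A = B"
        unfolding a(2) b(2) coh_class_eq_iff by (rule coboundaryI[OF \<gamma>(1)])
    qed
    show "?F ` carrier (H_DR Y) = carrier (cotensor G X act)"
    proof
      show "?F ` carrier (H_DR Y) \<subseteq> carrier (cotensor G X act)"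
        by (auto simp: H_DR_record H_pullback_pull intro!: in_K)
      show "carrier (cotensor G X act) \<subseteq> ?F ` carrier (H_DR Y)"
      proof
        fix A assume "A \<in> carrier (cotensor G X act)"
        then obtain c where c: "A = coh_class X c" "c \<in> cocycle_set X" "\<forall>h\<in>carrier G. move h c - c \<in> DR_coboundaries X"
          unfolding carrier_cotensor by blast
        obtain e where e: "e \<in> cocycle_set Y" "coh_class X (pull e) = coh_class X c"
          using invariant_class_lifts[OF c(2,3)] .
        have "A = ?F (coh_class Y e)"
          by (simp only: c(1) H_pullback_pull e(2))
        then show "A \<in> ?F ` carrier (H_DR Y)"
          unfolding H_DR_record by (rule image_eqI[OF _ imageI[OF e(1)]])
      qed
    qed
  qed
  moreover have "?F (r \<odot>\<^bsub>H_DR Y\<^esub> A) = r \<odot>\<^bsub>cotensor G X act\<^esub> ?F A" if A: "A \<in> carrier (H_DR Y)" for r A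
  proof -
    obtain a where a: "A = coh_class Y a"
      using A unfolding H_DR_record by blast
    show ?thesis
      unfolding cotensor_record a coh_class_scale H_pullback_pull cochain_pullback_scale ..
  qed
  moreover have "?F ` degree_part (H_DR Y) q = degree_part (cotensor G X act) q" for q
  proof
    show "?F ` degree_part (H_DR Y) q \<subseteq> degree_part (cotensor G X act) q"
    proof
      fix B assume "B \<in> ?F ` degree_part (H_DR Y) q"
      then obtain a where a: "a \<in> cocycle_set Y" "homogeneous q a" "B = coh_class X (pull a)"
        unfolding H_DR_record by (auto simp: H_pullback_pull)
      then show "B \<in> degree_part (cotensor G X act) q"
        unfolding cotensor_record H_DR_record
        using in_K[OF a(1)] pull_cocycle[OF a(1)] homogeneous_cochain_pullback[OF a(2)] by blast
    qed
    show "degree_part (cotensor G X act) q \<subseteq> ?F ` degree_part (H_DR Y) q"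
    proof
      fix A assume "A \<in> degree_part (cotensor G X act) q"
      then obtain c c' where c: "A = coh_class X c" "c \<in> cocycle_set X" "homogeneous q c"
        and c': "A = coh_class X c'" "\<forall>h\<in>carrier G. move h c' - c' \<in> DR_coboundaries X"
        unfolding cotensor_record H_DR_record carrier_cotensor by blast
      have "move h c - c \<in> DR_coboundaries X" if h: "h \<in> carrier G" for h
      proof -
        have "H_pullback X (act h) A = A"
          unfolding c'(1) H_pullback_move[OF h] coh_class_eq_iff using c'(2) h by blast
        then show ?thesis
          unfolding c(1) H_pullback_move[OF h] coh_class_eq_iff .
      qed
      then have inv: "\<forall>h\<in>carrier G. move h c - c \<in> DR_coboundaries X" by blast
      obtain e where e: "e \<in> cocycle_set Y" "coh_class X (pull e) = coh_class X c"
        "\<And>q. homogeneous q c \<Longrightarrow> homogeneous q e"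
        using invariant_class_lifts[OF c(2) inv] by blast
      have "A = ?F (coh_class Y e)"
        by (simp only: c(1) H_pullback_pull e(2))
      moreover have "coh_class Y e \<in> degree_part (H_DR Y) q"
        unfolding H_DR_record using e(1) e(3)[OF c(3)] by blast
      ultimately show "A \<in> ?F ` degree_part (H_DR Y) q"
        by (rule image_eqI)
    qed
  qed
  ultimately show ?thesis
    by (simp add: galgebra_iso_def ring_iso_def)
qed

end

section \<open>Free actions of finite groups as covering maps\<close>

locale free_finite_action = group_action G "topspace T" act
  for G :: "('g, 'c) monoid_scheme" (structure) and T :: "'a topology" and act :: "'g \<Rightarrow> 'a \<Rightarrow> 'a" +
  assumes finite_group: "finite (carrier G)"
    and Hausdorff: "Hausdorff_space T"
    and continuous_act: "\<And>g. g \<in> carrier G \<Longrightarrow> continuous_map T T (act g)"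
    and free: "\<And>g x. g \<in> carrier G \<Longrightarrow> x \<in> topspace T \<Longrightarrow> act g x = x \<Longrightarrow> g = \<one>"
begin

abbreviation orb :: "'a \<Rightarrow> 'a set" where "orb \<equiv> orbit G act"

lemma group_G: "group G"
  by (rule group_hom.axioms(1)[OF group_hom])

interpretation G: group G by (rule group_G)

lemma act_in: "g \<in> carrier G \<Longrightarrow> x \<in> topspace T \<Longrightarrow> act g x \<in> topspace T"
  by (rule element_image[OF _ _ refl])

lemma act_one: "x \<in> topspace T \<Longrightarrow> act \<one> x = x"
  using id_eq_one by (metis restrict_apply')

lemma act_mult: "g \<in> carrier G \<Longrightarrow> h \<in> carrier G \<Longrightarrow> x \<in> topspace T \<Longrightarrow> act (g \<otimes> h) x = act g (act h x)"
  by (rule composition_rule)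

lemma act_inv: "g \<in> carrier G \<Longrightarrow> x \<in> topspace T \<Longrightarrow> act (inv g) (act g x) = x"
  using act_mult[of "inv g" g x] act_one by simp

lemma act_cancel:
  assumes "g \<in> carrier G" "h \<in> carrier G" "x \<in> topspace T" "act g x = act h x"
  shows "g = h"
proof -
  have "act (inv h \<otimes> g) x = x"
    using act_mult[of "inv h" g x] act_inv[of h x] assms by simp
  then have "inv h \<otimes> g = \<one>"
    using free[of "inv h \<otimes> g" x] assms by simp
  then have "inv g = inv h"
    using assms G.inv_equality[of "inv h" g] by simp
  then have "inv (inv g) = inv (inv h)" by (rule arg_cong)
  then show ?thesis
    using assms by (simp only: G.inv_inv)
qed

lemma orb_eq_iff:
  assumes x: "x \<in> topspace T" and y: "y \<in> topspace T"
  shows "orb x = orb y \<longleftrightarrow> (\<exists>g\<in>carrier G. y = act g x)"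
proof
  assume "orb x = orb y"
  moreover have "y \<in> orb y"
    unfolding orbit_def using act_one[OF y] G.one_closed by (intro CollectI exI[of _ \<one>]) simp
  ultimately show "\<exists>g\<in>carrier G. y = act g x"
    unfolding orbit_def by blast
next
  assume "\<exists>g\<in>carrier G. y = act g x"
  then obtain g where g: "g \<in> carrier G" "y = act g x" by blast
  have "\<exists>k\<in>carrier G. act h y = act k x" if "h \<in> carrier G" for h
    using that g act_mult[OF that g(1) x] by (intro bexI[of _ "h \<otimes> g"]) auto
  moreover have "\<exists>k\<in>carrier G. act h x = act k y" if "h \<in> carrier G" for h
    using that g act_mult[of h "inv g" y] act_inv[OF g(1) x] y
    by (intro bexI[of _ "h \<otimes> inv g"]) auto
  ultimately show "orb x = orb y"
    unfolding orbit_def by blast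
qed

lemma orb_act: "g \<in> carrier G \<Longrightarrow> x \<in> topspace T \<Longrightarrow> orb (act g x) = orb x"
  using orb_eq_iff[of x "act g x"] act_in by auto

definition quotient_top :: "'a set topology" where
  "quotient_top = topology (\<lambda>V. V \<subseteq> orbits G (topspace T) act \<and> openin T {x \<in> topspace T. orb x \<in> V})"

lemma openin_quotient_top:
  "openin quotient_top V \<longleftrightarrow> V \<subseteq> orbits G (topspace T) act \<and> openin T {x \<in> topspace T. orb x \<in> V}"
proof -
  have "istopology (\<lambda>V. V \<subseteq> orbits G (topspace T) act \<and> openin T {x \<in> topspace T. orb x \<in> V})"
    unfolding istopology_def
  proof (intro conjI allI impI)
    fix S S'
    assume "S \<subseteq> orbits G (topspace T) act \<and> openin T {x \<in> topspace T. orb x \<in> S}"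
      "S' \<subseteq> orbits G (topspace T) act \<and> openin T {x \<in> topspace T. orb x \<in> S'}"
    moreover have "{x \<in> topspace T. orb x \<in> S \<inter> S'} = {x \<in> topspace T. orb x \<in> S} \<inter> {x \<in> topspace T. orb x \<in> S'}"
      by auto
    ultimately show "S \<inter> S' \<subseteq> orbits G (topspace T) act" "openin T {x \<in> topspace T. orb x \<in> S \<inter> S'}"
      by auto
  next
    fix \<K> assume "\<forall>K\<in>\<K>. K \<subseteq> orbits G (topspace T) act \<and> openin T {x \<in> topspace T. orb x \<in> K}"
    moreover have "{x \<in> topspace T. orb x \<in> \<Union>\<K>} = (\<Union>K\<in>\<K>. {x \<in> topspace T. orb x \<in> K})"
      by auto
    ultimately show "\<Union>\<K> \<subseteq> orbits G (topspace T) act" "openin T {x \<in> topspace T. orb x \<in> \<Union>\<K>}"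
      by auto
  qed
  then show ?thesis
    unfolding quotient_top_def by (simp only: topology_inverse')
qed

lemma topspace_quotient_top: "topspace quotient_top = orbits G (topspace T) act"
proof -
  have "{x \<in> topspace T. orb x \<in> orbits G (topspace T) act} = topspace T"
    by (auto simp: orbits_def)
  then have "openin quotient_top (orbits G (topspace T) act)"
    by (simp add: openin_quotient_top)
  then show ?thesis
    using openin_subset[of quotient_top] openin_topspace[of quotient_top]
    unfolding openin_quotient_top by blast
qed

lemma continuous_orb: "continuous_map T quotient_top orb"
  unfolding continuous_map_def topspace_quotient_top openin_quotient_top
  by (auto simp: orbits_def)

lemma open_orb_image:
  assumes W: "openin T W"
  shows "openin quotient_top (orb ` W)"
proof -
  have WT: "W \<subseteq> topspace T" by (rule openin_subset[OF W])
  have "{x \<in> topspace T. orb x \<in> orb ` W} = (\<Union>g\<in>carrier G. {x \<in> topspace T. act g x \<in> W})"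
  proof (intro equalityI subsetI)
    fix x assume "x \<in> {x \<in> topspace T. orb x \<in> orb ` W}"
    then obtain y where "x \<in> topspace T" "y \<in> W" "orb x = orb y" by blast
    then show "x \<in> (\<Union>g\<in>carrier G. {x \<in> topspace T. act g x \<in> W})"
      using orb_eq_iff[of x y] WT by blast
  next
    fix x assume "x \<in> (\<Union>g\<in>carrier G. {x \<in> topspace T. act g x \<in> W})"
    then obtain g where "g \<in> carrier G" "x \<in> topspace T" "act g x \<in> W" by blast
    moreover from this have "orb x = orb (act g x)" by (simp only: orb_act)
    ultimately show "x \<in> {x \<in> topspace T. orb x \<in> orb ` W}" by blast
  qed
  moreover have "openin T (\<Union>g\<in>carrier G. {x \<in> topspace T. act g x \<in> W})"
    using openin_continuous_map_preimage[OF continuous_act W] by blast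
  moreover have "orb ` W \<subseteq> orbits G (topspace T) act"
    using WT by (auto simp: orbits_def)
  ultimately show ?thesis
    by (simp add: openin_quotient_top)
qed

text \<open>
  An open set that is disjoint from its translates by the elements other than the unit: the
  projection maps it homeomorphically to an evenly covered open set.
\<close>

definition slice :: "'a set \<Rightarrow> bool" where
  "slice W \<longleftrightarrow> openin T W \<and> (\<forall>g\<in>carrier G. \<forall>y\<in>W. act g y \<in> W \<longrightarrow> g = \<one>)"

lemma slice_subset: "slice W \<Longrightarrow> openin T W' \<Longrightarrow> W' \<subseteq> W \<Longrightarrow> slice W'"
  unfolding slice_def by blast

text \<open>
  Separate x from each of its finitely many other translates, and intersect the resulting
  neighbourhoods.
\<close>

lemma slice_exists:
  assumes x: "x \<in> topspace T"
  obtains W where "slice W" "x \<in> W"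
proof -
  have "\<exists>V. openin T V \<and> x \<in> V \<and> (\<forall>y\<in>V. act g y \<notin> V)" if g: "g \<in> carrier G - {\<one>}" for g
  proof -
    have "act g x \<noteq> x" using free[of g x] g x by auto
    then obtain A B where AB: "openin T A" "openin T B" "x \<in> A" "act g x \<in> B" "disjnt A B"
      using Hausdorff[unfolded Hausdorff_space_def, rule_format, of x "act g x"] act_in[of g x] g x by auto
    let ?V = "A \<inter> {y \<in> topspace T. act g y \<in> B}"
    have "openin T ?V"
      using openin_continuous_map_preimage[OF continuous_act AB(2)] AB(1) g by blast
    moreover have "\<forall>y\<in>?V. act g y \<notin> ?V"
      using AB(5) by (auto simp: disjnt_def)
    ultimately show ?thesis
      using AB x by (intro exI[of _ ?V]) auto
  qed
  then obtain V where V: "\<And>g. g \<in> carrier G - {\<one>} \<Longrightarrow> openin T (V g) \<and> x \<in> V g \<and> (\<forall>y\<in>V g. act g y \<notin> V g)"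
    by metis
  let ?W = "topspace T \<inter> (\<Inter>g\<in>carrier G - {\<one>}. V g)"
  have "openin T ?W"
  proof (cases "carrier G - {\<one>} = {}")
    case False
    then show ?thesis
      using V finite_group by (intro openin_Int openin_topspace openin_INT2) auto
  next
    case True
    show ?thesis
      unfolding True by simp
  qed
  moreover have "g = \<one>" if "g \<in> carrier G" "y \<in> ?W" "act g y \<in> ?W" for g y
    using V[of g] that by blast
  ultimately have "slice ?W"
    unfolding slice_def by blast
  moreover have "x \<in> ?W" using V x by blast
  ultimately show ?thesis by (rule that)
qed

lemma slice_inj:
  assumes "slice W"
  shows "inj_on orb W"
proof (rule inj_onI)
  fix x y assume xy: "x \<in> W" "y \<in> W" "orb x = orb y"
  have "W \<subseteq> topspace T" using assms openin_subset unfolding slice_def by blast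
  with xy have xT: "x \<in> topspace T" "y \<in> topspace T" by blast+
  obtain g where g: "g \<in> carrier G" "y = act g x"
    using orb_eq_iff[OF xT] xy(3) by blast
  have "g = \<one>"
    using assms g xy unfolding slice_def by blast
  then show "x = y"
    using g(2) act_one[OF xT(1)] by simp
qed

lemma continuous_slice_section:
  assumes W: "slice W"
  shows "continuous_map (subtopology quotient_top (orb ` W)) T (inv_into W orb)"
proof -
  have oW: "openin T W" using W by (simp add: slice_def)
  have WT: "W \<subseteq> topspace T" by (rule openin_subset[OF oW])
  have top: "topspace (subtopology quotient_top (orb ` W)) = orb ` W"
    using openin_subset[OF open_orb_image[OF oW]] by (simp add: Int_absorb1)
  show ?thesis
    unfolding continuous_map_def top
  proof (intro conjI allI impI)
    show "inv_into W orb \<in> orb ` W \<rightarrow> topspace T"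
      by (intro funcsetI subsetD[OF WT] inv_into_into)
    fix O' assume O': "openin T O'"
    have "{q \<in> orb ` W. inv_into W orb q \<in> O'} = orb ` (W \<inter> O')"
      using slice_inj[OF W] by (auto simp: inv_into_f_f)
    moreover have "openin quotient_top (orb ` (W \<inter> O'))"
      using oW O' by (intro open_orb_image openin_Int)
    moreover have "orb ` (W \<inter> O') \<subseteq> orb ` W" by blast
    ultimately show "openin (subtopology quotient_top (orb ` W)) {q \<in> orb ` W. inv_into W orb q \<in> O'}"
      by (simp add: openin_open_subtopology[OF open_orb_image[OF oW]])
  qed
qed

lemma closedin_translates:
  assumes F: "continuous_map C T F" and F': "continuous_map C T F'" and g: "g \<in> carrier G"
  shows "closedin C {c \<in> topspace C. F' c = act g (F c)}"
  using closedin_continuous_maps_eq[OF Hausdorff F' continuous_map_compose[OF F continuous_act[OF g]]]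
  by simp

text \<open>
  Two lifts differ at every point by an element of G, and for each of the finitely many elements
  other than the unit the set where they differ by it is closed.
\<close>

lemma openin_lifts_agree:
  assumes F: "continuous_map C T F" and F': "continuous_map C T F'"
    and eq: "\<And>c. c \<in> topspace C \<Longrightarrow> orb (F c) = orb (F' c)"
  shows "openin C {c \<in> topspace C. F' c = F c}"
proof -
  have FT: "F c \<in> topspace T" "F' c \<in> topspace T" if "c \<in> topspace C" for c
    using continuous_map_image_subset_topspace[OF F] continuous_map_image_subset_topspace[OF F'] that by auto
  let ?A = "\<Union>g\<in>carrier G - {\<one>}. {c \<in> topspace C. F' c = act g (F c)}"
  have "closedin C ?A"
  proof (rule closedin_Union)
    show "finite ((\<lambda>g. {c \<in> topspace C. F' c = act g (F c)}) ` (carrier G - {\<one>}))"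
      using finite_group by simp
    fix S assume "S \<in> (\<lambda>g. {c \<in> topspace C. F' c = act g (F c)}) ` (carrier G - {\<one>})"
    then obtain g where "g \<in> carrier G" "S = {c \<in> topspace C. F' c = act g (F c)}" by blast
    then show "closedin C S"
      using closedin_translates[OF F F'] by simp
  qed
  then have "openin C (topspace C - ?A)"
    by (rule openin_diff[OF openin_topspace])
  also have "topspace C - ?A = {c \<in> topspace C. F' c = F c}"
  proof (intro equalityI subsetI)
    fix c assume c: "c \<in> topspace C - ?A"
    then have cC: "c \<in> topspace C" by (rule DiffD1)
    obtain g where g: "g \<in> carrier G" "F' c = act g (F c)"
      using eq[OF cC] orb_eq_iff[OF FT[OF cC]] by blast
    have "g = \<one>"
      using c g cC by blast
    then show "c \<in> {c \<in> topspace C. F' c = F c}"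
      using g(2) cC by (simp add: act_one[OF FT(1)[OF cC]])
  next
    fix c assume "c \<in> {c \<in> topspace C. F' c = F c}"
    then have c: "c \<in> topspace C" "F' c = F c" by blast+
    have "F' c \<noteq> act g (F c)" if "g \<in> carrier G - {\<one>}" for g
      using free[OF _ FT(1)[OF c(1)], of g] c(2) that by auto
    then show "c \<in> topspace C - ?A"
      using c(1) by blast
  qed
  finally show ?thesis .
qed

lemma lifts_agree:
  assumes C: "connected_space C"
    and F: "continuous_map C T F" and F': "continuous_map C T F'"
    and eq: "\<And>c. c \<in> topspace C \<Longrightarrow> orb (F c) = orb (F' c)"
    and c0: "c0 \<in> topspace C" "F' c0 = F c0" and c: "c \<in> topspace C"
  shows "F' c = F c"
proof -
  let ?A = "{c \<in> topspace C. F' c = F c}"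
  have "openin C ?A" by (rule openin_lifts_agree[OF F F' eq])
  moreover have "closedin C ?A" by (rule closedin_continuous_maps_eq[OF Hausdorff F' F])
  ultimately have "?A = {} \<or> ?A = topspace C"
    using C unfolding connected_space_clopen_in by blast
  then show ?thesis
    using c0 c by blast
qed

text \<open>
  After a translation the first lift agrees with the second one at c0, and then everywhere by
  \<open>lifts_agree\<close>.
\<close>

lemma lifts_differ_by_translate:
  assumes C: "connected_space C"
    and F: "continuous_map C T F" and F': "continuous_map C T F'"
    and eq: "\<And>c. c \<in> topspace C \<Longrightarrow> orb (F c) = orb (F' c)"
    and c0: "c0 \<in> topspace C"
  obtains h where "h \<in> carrier G" "\<And>c. c \<in> topspace C \<Longrightarrow> F' c = act h (F c)"
proof -
  have FT: "F c \<in> topspace T" "F' c \<in> topspace T" if "c \<in> topspace C" for c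
    using continuous_map_image_subset_topspace[OF F] continuous_map_image_subset_topspace[OF F'] that by auto
  obtain h where h: "h \<in> carrier G" "F' c0 = act h (F c0)"
    using eq[OF c0] orb_eq_iff[OF FT[OF c0]] by blast
  have hF: "continuous_map C T (act h \<circ> F)"
    by (rule continuous_map_compose[OF F continuous_act[OF h(1)]])
  have "F' c = (act h \<circ> F) c" if "c \<in> topspace C" for c
    by (rule lifts_agree[OF C hF F' _ c0 _ that]) (use eq orb_act[OF h(1) FT(1)] h(2) in auto)
  then show ?thesis
    using that[OF h(1)] by simp
qed

abbreviation cylinder :: "'k topology \<Rightarrow> real \<Rightarrow> real \<Rightarrow> ('k \<times> real) topology" where
  "cylinder K a b \<equiv> subtopology (prod_topology K euclideanreal) (UNIV \<times> {a..b})"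

lemma topspace_cylinder: "topspace (cylinder K a b) = topspace K \<times> {a..b}"
  by auto

lemma continuous_fst_cylinder: "continuous_map (cylinder K a b) K fst"
  by (intro continuous_map_from_subtopology continuous_map_fst)

text \<open>
  Near time x the whole homotopy is covered by finitely many tubes over slices, because K is
  compact. On a tube a lift is the local section of the slice followed by a translation, which
  is determined by the initial lift F0. The local lifts agree where they overlap as they agree
  at time a and the time interval is connected.
\<close>

lemma lift_homotopy_short:
  assumes K: "compact_space K" and x: "x \<in> {0..1}"
    and f: "continuous_map (cylinder K 0 1) quotient_top f"
  shows "\<exists>d>0. \<forall>a b. a \<le> x \<and> x \<le> b \<and> b - a < d \<longrightarrow> 0 \<le> a \<longrightarrow> b \<le> 1 \<longrightarrow>
     (\<forall>F0. continuous_map K T F0 \<and> (\<forall>k\<in>topspace K. orb (F0 k) = f (k, a)) \<longrightarrow>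
       (\<exists>F. continuous_map (cylinder K a b) T F \<and>
          (\<forall>k\<in>topspace K. \<forall>t\<in>{a..b}. orb (F (k, t)) = f (k, t)) \<and> (\<forall>k\<in>topspace K. F (k, a) = F0 k)))"
proof -
  \<comment> \<open>Over the tube V around k, at times within e of x, the homotopy stays in the image of the slice W.\<close>
  define tube where "tube k W V e \<longleftrightarrow> slice W \<and> openin K V \<and> k \<in> V \<and> e > 0 \<and>
      (\<forall>k'\<in>V. \<forall>t\<in>{0..1}. \<bar>t - x\<bar> < e \<longrightarrow> f (k', t) \<in> orb ` W)" for k W V and e :: real
  have "\<exists>W V e. tube k W V e" if k: "k \<in> topspace K" for k
  proof -
    have kx: "(k, x) \<in> topspace (cylinder K 0 1)"
      unfolding topspace_cylinder using k x by simp
    then have "f (k, x) \<in> topspace quotient_top"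
      using continuous_map_image_subset_topspace[OF f] by blast
    then obtain m where m: "m \<in> topspace T" "f (k, x) = orb m"
      unfolding topspace_quotient_top orbits_def by blast
    obtain W where W: "slice W" "m \<in> W" using slice_exists[OF m(1)] .
    let ?O = "{z \<in> topspace (cylinder K 0 1). f z \<in> orb ` W}"
    have "openin (cylinder K 0 1) ?O"
      using W(1) by (intro openin_continuous_map_preimage[OF f] open_orb_image) (simp add: slice_def)
    then obtain S where S: "openin (prod_topology K euclideanreal) S" "?O = S \<inter> (UNIV \<times> {0..1})"
      unfolding openin_subtopology by blast
    have "(k, x) \<in> S" using kx m W S(2) by blast
    then obtain V R where VR: "openin K V" "open R" "k \<in> V" "x \<in> R" "V \<times> R \<subseteq> S"
      using S(1) unfolding openin_prod_topology_alt by (metis open_openin)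
    obtain e where e: "e > 0" "\<And>t. dist t x < e \<Longrightarrow> t \<in> R"
      using VR(2,4) unfolding open_dist by blast
    have "f (k', t) \<in> orb ` W" if "k' \<in> V" "t \<in> {0..1}" "\<bar>t - x\<bar> < e" for k' t
    proof -
      have "(k', t) \<in> S \<inter> (UNIV \<times> {0..1})"
        using that VR(5) e(2)[of t] by (auto simp: dist_real_def)
      then show ?thesis using S(2) by blast
    qed
    then have "tube k W V e"
      unfolding tube_def using W VR e by blast
    then show ?thesis by blast
  qed
  then obtain W V e where tube: "\<And>k. k \<in> topspace K \<Longrightarrow> tube k (W k) (V k) (e k)"
    by metis
  then have WV: "\<And>k. k \<in> topspace K \<Longrightarrow> slice (W k)" "\<And>k. k \<in> topspace K \<Longrightarrow> openin K (V k)"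
    "\<And>k. k \<in> topspace K \<Longrightarrow> k \<in> V k" "\<And>k. k \<in> topspace K \<Longrightarrow> (e k :: real) > 0"
    "\<And>k k' t. k \<in> topspace K \<Longrightarrow> k' \<in> V k \<Longrightarrow> t \<in> {0..1} \<Longrightarrow> \<bar>t - x\<bar> < e k \<Longrightarrow> f (k', t) \<in> orb ` W k"
    unfolding tube_def by blast+
  have "\<forall>U\<in>V ` topspace K. openin K U" "topspace K \<subseteq> \<Union>(V ` topspace K)"
    using WV(2,3) by auto
  then obtain \<F> where \<F>: "finite \<F>" "\<F> \<subseteq> V ` topspace K" "topspace K \<subseteq> \<Union>\<F>"
    using K unfolding compact_space_alt by meson
  obtain C where C: "C \<subseteq> topspace K" "finite C" "\<F> = V ` C"
    using finite_subset_image[OF \<F>(1,2)] by blast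
  define d where "d = Min (insert 1 (e ` C))"
  have d: "d > 0" "\<And>c. c \<in> C \<Longrightarrow> d \<le> e c"
    using C WV(4) by (auto simp: d_def)
  show ?thesis
  proof (intro exI[of _ d] conjI allI impI d(1))
    fix a b F0
    assume ab: "a \<le> x \<and> x \<le> b \<and> b - a < d" "0 \<le> a" "b \<le> 1"
      and F0: "continuous_map K T F0 \<and> (\<forall>k\<in>topspace K. orb (F0 k) = f (k, a))"
    define \<sigma> where "\<sigma> c = inv_into (W c) orb" for c
    \<comment> \<open>The candidates for a lift over the tube c: the section over its slice, translated by h.\<close>
    define L where "L c h z = act h (\<sigma> c (f z))" for c h z
    have fW: "f (k, t) \<in> orb ` W c" if "c \<in> C" "k \<in> V c" "t \<in> {a..b}" for c k t
      using that ab d(2)[OF that(1)] C(1) by (intro WV(5)) auto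
    have WT: "W c \<subseteq> topspace T" if "c \<in> C" for c
      using WV(1)[of c] that C(1) openin_subset unfolding slice_def by blast
    have \<sigma>: "\<sigma> c (f (k, t)) \<in> topspace T" "orb (\<sigma> c (f (k, t))) = f (k, t)"
      if "c \<in> C" "k \<in> V c" "t \<in> {a..b}" for c k t
      using fW[OF that] WT[OF that(1)] inv_into_into[of "f (k, t)" orb "W c"]
      by (auto simp: \<sigma>_def f_inv_into_f)
    have L_orb: "orb (L c h (k, t)) = f (k, t)"
      if "h \<in> carrier G" "c \<in> C" "k \<in> V c" "t \<in> {a..b}" for c h k t
      unfolding L_def using orb_act[OF that(1) \<sigma>(1)[OF that(2-4)]] \<sigma>(2)[OF that(2-4)] by simp
    have f_ab: "continuous_map (cylinder K a b) quotient_top f"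
      by (rule continuous_map_from_subtopology_mono[OF f]) (use ab in auto)
    have L_cont: "continuous_map (subtopology (cylinder K a b) (V c \<times> UNIV)) T (L c h)"
      if h: "h \<in> carrier G" and c: "c \<in> C" for c h
    proof -
      have "continuous_map (subtopology (cylinder K a b) (V c \<times> UNIV)) (subtopology quotient_top (orb ` W c)) f"
        using fW[OF c] by (intro continuous_map_into_subtopology continuous_map_from_subtopology f_ab) auto
      moreover have "continuous_map (subtopology quotient_top (orb ` W c)) T (\<sigma> c)"
        unfolding \<sigma>_def by (rule continuous_slice_section[OF WV(1)]) (use c C(1) in blast)
      ultimately have "continuous_map (subtopology (cylinder K a b) (V c \<times> UNIV)) T (\<sigma> c \<circ> f)"
        by (rule continuous_map_compose)
      from continuous_map_compose[OF this continuous_act[OF h]] show ?thesis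
        by (simp only: L_def[abs_def] o_def)
    qed
    have VK: "V c \<subseteq> topspace K" if "c \<in> C" for c
      using WV(2)[of c] that C(1) openin_subset by blast
    have at_a: "continuous_map (subtopology K (V c)) (subtopology (cylinder K a b) (V c \<times> UNIV)) (\<lambda>k. (k, a))"
      if "c \<in> C" for c
    proof -
      have "continuous_map (subtopology K (V c)) (prod_topology K euclideanreal) (\<lambda>k. (k, a))"
        by (intro continuous_map_from_subtopology continuous_map_pairedI) auto
      then show ?thesis
        by (intro continuous_map_into_subtopology) (use ab in auto)
    qed
    have along: "continuous_map (top_of_set {a..b}) (subtopology (cylinder K a b) (V c \<times> UNIV)) (\<lambda>t. (k, t))"
      if "c \<in> C" "k \<in> V c" for c k
    proof -
      have "k \<in> topspace K" using that VK by blast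
      then have "continuous_map (top_of_set {a..b}) (prod_topology K euclideanreal) (\<lambda>t. (k, t))"
        by (intro continuous_map_pairedI) auto
      then show ?thesis
        by (intro continuous_map_into_subtopology) (use that in auto)
    qed
    define start where "start k c h \<longleftrightarrow> c \<in> C \<and> k \<in> V c \<and> h \<in> carrier G \<and> F0 k = L c h (k, a)" for k c h
    have "\<exists>c h. start k c h" if k: "k \<in> topspace K" for k
    proof -
      obtain c where c: "c \<in> C" "k \<in> V c" using \<F>(3) C(3) k by blast
      have a: "a \<in> {a..b}" using ab by simp
      have "F0 k \<in> topspace T"
        using F0 k continuous_map_image_subset_topspace[of K T F0] by blast
      moreover have "orb (\<sigma> c (f (k, a))) = orb (F0 k)"
        using \<sigma>(2)[OF c a] F0 k by simp
      ultimately obtain h where "h \<in> carrier G" "F0 k = act h (\<sigma> c (f (k, a)))"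
        using orb_eq_iff[OF \<sigma>(1)[OF c a]] by blast
      then have "start k c h" using c unfolding start_def L_def by blast
      then show ?thesis by blast
    qed
    then obtain j h where start: "\<And>k. k \<in> topspace K \<Longrightarrow> start k (j k) (h k)"
      by metis
    then have jh: "\<And>k. k \<in> topspace K \<Longrightarrow> j k \<in> C" "\<And>k. k \<in> topspace K \<Longrightarrow> k \<in> V (j k)"
      "\<And>k. k \<in> topspace K \<Longrightarrow> h k \<in> carrier G" "\<And>k. k \<in> topspace K \<Longrightarrow> F0 k = L (j k) (h k) (k, a)"
      unfolding start_def by blast+
    \<comment> \<open>The points of the tube of k0 at which the candidate chosen for k0 starts at F0; on this open
      neighbourhood of k0 it is the lift to be constructed.\<close>
    define N where "N k0 = {k \<in> topspace (subtopology K (V (j k0))). L (j k0) (h k0) (k, a) = F0 k}" for k0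
    have N_open: "openin K (N k0)" if k0: "k0 \<in> topspace K" for k0
    proof -
      have "openin (subtopology K (V (j k0))) (N k0)"
        unfolding N_def
      proof (rule openin_lifts_agree)
        show "continuous_map (subtopology K (V (j k0))) T F0"
          using F0 by (intro continuous_map_from_subtopology) blast
        show "continuous_map (subtopology K (V (j k0))) T (\<lambda>k. L (j k0) (h k0) (k, a))"
          using continuous_map_compose[OF at_a[OF jh(1)[OF k0]] L_cont[OF jh(3)[OF k0] jh(1)[OF k0]]]
          by (simp add: o_def)
        show "orb (F0 k) = orb (L (j k0) (h k0) (k, a))" if "k \<in> topspace (subtopology K (V (j k0)))" for k
          using that F0 ab L_orb[OF jh(3)[OF k0] jh(1)[OF k0]] by simp
      qed
      then show ?thesis
        using WV(2)[of "j k0"] jh(1)[OF k0] C(1) openin_trans_full by blast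
    qed
    define F where "F z = L (j (fst z)) (h (fst z)) z" for z
    have F_local: "F (k, t) = L (j k0) (h k0) (k, t)" if k0: "k0 \<in> topspace K" and k: "k \<in> N k0" and t: "t \<in> {a..b}" for k0 k t
    proof -
      have k': "k \<in> topspace K" "k \<in> V (j k0)" "L (j k0) (h k0) (k, a) = F0 k"
        using k by (auto simp: N_def)
      have "L (j k) (h k) (k, t) = L (j k0) (h k0) (k, t)"
      proof (rule lifts_agree[of "top_of_set {a..b}" "\<lambda>t. L (j k0) (h k0) (k, t)" "\<lambda>t. L (j k) (h k) (k, t)" a t])
        show "continuous_map (top_of_set {a..b}) T (\<lambda>t. L (j k0) (h k0) (k, t))"
          using continuous_map_compose[OF along[OF jh(1)[OF k0] k'(2)] L_cont[OF jh(3)[OF k0] jh(1)[OF k0]]]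
          by (simp add: o_def)
        show "continuous_map (top_of_set {a..b}) T (\<lambda>t. L (j k) (h k) (k, t))"
          using continuous_map_compose[OF along[OF jh(1)[OF k'(1)] jh(2)[OF k'(1)]] L_cont[OF jh(3)[OF k'(1)] jh(1)[OF k'(1)]]]
          by (simp add: o_def)
        show "orb (L (j k0) (h k0) (k, t)) = orb (L (j k) (h k) (k, t))" if "t \<in> topspace (top_of_set {a..b})" for t
          using that L_orb[OF jh(3)[OF k0] jh(1)[OF k0] k'(2)] L_orb[OF jh(3)[OF k'(1)] jh(1)[OF k'(1)] jh(2)[OF k'(1)]]
          by simp
        show "L (j k) (h k) (k, a) = L (j k0) (h k0) (k, a)"
          using k'(3) jh(4)[OF k'(1)] by simp
        show "connected_space (top_of_set {a..b})"
          using connected_Icc[of a b] by (simp add: connectedin_iff_connected[symmetric] connectedin_def)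
      qed (use ab t in auto)
      then show ?thesis by (simp add: F_def)
    qed
    have N_self: "k \<in> N k" if "k \<in> topspace K" for k
      using that jh by (simp add: N_def)
    have "continuous_map (cylinder K a b) T F"
    proof (rule pasting_lemma[where I = "topspace K" and T = "\<lambda>i. {z \<in> topspace (cylinder K a b). fst z \<in> N i}"
          and f = "\<lambda>i. L (j i) (h i)"])
      fix i assume i: "i \<in> topspace K"
      show "openin (cylinder K a b) {z \<in> topspace (cylinder K a b). fst z \<in> N i}"
        by (rule openin_continuous_map_preimage[OF continuous_fst_cylinder N_open[OF i]])
      show "continuous_map (subtopology (cylinder K a b) {z \<in> topspace (cylinder K a b). fst z \<in> N i}) T (L (j i) (h i))"
        by (rule continuous_map_from_subtopology_mono[OF L_cont[OF jh(3)[OF i] jh(1)[OF i]]]) (auto simp: N_def)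
    next
      fix i i' z assume "i \<in> topspace K" "i' \<in> topspace K"
        "z \<in> topspace (cylinder K a b) \<inter> {z \<in> topspace (cylinder K a b). fst z \<in> N i} \<inter> {z \<in> topspace (cylinder K a b). fst z \<in> N i'}"
      then show "L (j i) (h i) z = L (j i') (h i') z"
        using F_local[of i "fst z" "snd z"] F_local[of i' "fst z" "snd z"] unfolding topspace_cylinder by auto
    next
      fix z assume "z \<in> topspace (cylinder K a b)"
      then show "\<exists>i. i \<in> topspace K \<and> z \<in> {z \<in> topspace (cylinder K a b). fst z \<in> N i} \<and> F z = L (j i) (h i) z"
        unfolding topspace_cylinder using N_self by (intro exI[of _ "fst z"]) (auto simp: F_def)
    qed
    moreover have "orb (F (k, t)) = f (k, t)" if "k \<in> topspace K" "t \<in> {a..b}" for k t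
      using L_orb[OF jh(3)[OF that(1)] jh(1)[OF that(1)] jh(2)[OF that(1)] that(2)] by (simp add: F_def)
    moreover have "F (k, a) = F0 k" if "k \<in> topspace K" for k
      using jh(4)[OF that] by (simp add: F_def)
    ultimately show "\<exists>F. continuous_map (cylinder K a b) T F \<and>
          (\<forall>k\<in>topspace K. \<forall>t\<in>{a..b}. orb (F (k, t)) = f (k, t)) \<and> (\<forall>k\<in>topspace K. F (k, a) = F0 k)"
      by blast
  qed
qed

text \<open>
  Lifts over successive time intervals can be concatenated, so the property of having a lift for
  every initial lift passes from small intervals (\<open>lift_homotopy_short\<close>) to [0, 1]
  by bisection.
\<close>

lemma lift_homotopy:
  assumes K: "compact_space K" and f: "continuous_map (cylinder K 0 1) quotient_top f"
    and F0: "continuous_map K T F0" "\<And>k. k \<in> topspace K \<Longrightarrow> orb (F0 k) = f (k, 0)"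
  obtains F where "continuous_map (cylinder K 0 1) T F"
    "\<And>k t. k \<in> topspace K \<Longrightarrow> t \<in> {0..1} \<Longrightarrow> orb (F (k, t)) = f (k, t)"
proof -
  define P where "P a b \<longleftrightarrow> 0 \<le> a \<longrightarrow> b \<le> (1::real) \<longrightarrow>
     (\<forall>F0. continuous_map K T F0 \<and> (\<forall>k\<in>topspace K. orb (F0 k) = f (k, a)) \<longrightarrow>
       (\<exists>F. continuous_map (cylinder K a b) T F \<and>
          (\<forall>k\<in>topspace K. \<forall>t\<in>{a..b}. orb (F (k, t)) = f (k, t)) \<and> (\<forall>k\<in>topspace K. F (k, a) = F0 k)))" for a b
  have "P 0 1"
  proof (rule Bolzano)
    fix x :: real assume "0 \<le> x" "x \<le> 1"
    then show "\<exists>d>0. \<forall>a b. a \<le> x \<and> x \<le> b \<and> b - a < d \<longrightarrow> P a b"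
      unfolding P_def using lift_homotopy_short[OF K _ f, of x] by simp
  next
    fix a b c assume ab: "P a b" and bc: "P b c" and abc: "a \<le> b" "b \<le> c"
    show "P a c"
      unfolding P_def
    proof (intro impI allI)
      fix F0 assume "0 \<le> a" "c \<le> 1" and F0: "continuous_map K T F0 \<and> (\<forall>k\<in>topspace K. orb (F0 k) = f (k, a))"
      have "\<exists>F. continuous_map (cylinder K a b) T F \<and>
          (\<forall>k\<in>topspace K. \<forall>t\<in>{a..b}. orb (F (k, t)) = f (k, t)) \<and> (\<forall>k\<in>topspace K. F (k, a) = F0 k)"
        by (rule ab[unfolded P_def, THEN mp, THEN mp, THEN spec, THEN mp, OF _ _ F0])
          (use abc \<open>0 \<le> a\<close> \<open>c \<le> 1\<close> in linarith)+
      then obtain F1 where F1: "continuous_map (cylinder K a b) T F1"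
        "\<forall>k\<in>topspace K. \<forall>t\<in>{a..b}. orb (F1 (k, t)) = f (k, t)" "\<forall>k\<in>topspace K. F1 (k, a) = F0 k"
        by (elim exE conjE)
      have "continuous_map K (cylinder K a b) (\<lambda>k. (k, b))"
        by (intro continuous_map_into_subtopology continuous_map_pairedI) (use abc in auto)
      from continuous_map_compose[OF this F1(1)] have "continuous_map K T (\<lambda>k. F1 (k, b))"
        by (simp add: o_def)
      moreover have "\<forall>k\<in>topspace K. orb (F1 (k, b)) = f (k, b)"
        using F1(2) abc by simp
      ultimately have F1b: "continuous_map K T (\<lambda>k. F1 (k, b)) \<and> (\<forall>k\<in>topspace K. orb (F1 (k, b)) = f (k, b))"
        by (rule conjI)
      have "\<exists>F. continuous_map (cylinder K b c) T F \<and>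
          (\<forall>k\<in>topspace K. \<forall>t\<in>{b..c}. orb (F (k, t)) = f (k, t)) \<and> (\<forall>k\<in>topspace K. F (k, b) = F1 (k, b))"
        by (rule bc[unfolded P_def, THEN mp, THEN mp, THEN spec, THEN mp, OF _ _ F1b])
          (use abc \<open>0 \<le> a\<close> \<open>c \<le> 1\<close> in linarith)+
      then obtain F2 where F2: "continuous_map (cylinder K b c) T F2"
        "\<forall>k\<in>topspace K. \<forall>t\<in>{b..c}. orb (F2 (k, t)) = f (k, t)" "\<forall>k\<in>topspace K. F2 (k, b) = F1 (k, b)"
        by (elim exE conjE)
      define F where "F z = (if snd z \<le> b then F1 z else F2 z)" for z
      have "continuous_map (cylinder K a c) T F"
        unfolding F_def
      proof (rule continuous_map_cases_le)
        show "continuous_map (cylinder K a c) euclideanreal snd"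
          by (intro continuous_map_from_subtopology continuous_map_snd)
        show "continuous_map (subtopology (cylinder K a c) {z \<in> topspace (cylinder K a c). snd z \<le> b}) T F1"
          unfolding subtopology_subtopology
          by (rule continuous_map_from_subtopology_mono[OF F1(1)]) auto
        show "continuous_map (subtopology (cylinder K a c) {z \<in> topspace (cylinder K a c). b \<le> snd z}) T F2"
          unfolding subtopology_subtopology
          by (rule continuous_map_from_subtopology_mono[OF F2(1)]) auto
        show "F1 z = F2 z" if "z \<in> topspace (cylinder K a c)" "snd z = b" for z
          using that F2(3) unfolding topspace_cylinder by auto
      qed simp
      moreover have "\<forall>k\<in>topspace K. \<forall>t\<in>{a..c}. orb (F (k, t)) = f (k, t)"
        using F1(2) F2(2) by (auto simp: F_def)
      moreover have "\<forall>k\<in>topspace K. F (k, a) = F0 k"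
        using F1(3) abc by (simp add: F_def)
      ultimately show "\<exists>F. continuous_map (cylinder K a c) T F \<and>
          (\<forall>k\<in>topspace K. \<forall>t\<in>{a..c}. orb (F (k, t)) = f (k, t)) \<and> (\<forall>k\<in>topspace K. F (k, a) = F0 k)"
        by blast
    qed
  qed simp
  then have "\<exists>F. continuous_map (cylinder K 0 1) T F \<and>
          (\<forall>k\<in>topspace K. \<forall>t\<in>{0..1}. orb (F (k, t)) = f (k, t)) \<and> (\<forall>k\<in>topspace K. F (k, 0) = F0 k)"
    unfolding P_def using F0 by simp
  then show ?thesis using that by blast
qed

text \<open>
  Lift the homotopy f H, which starts at a constant map with an obvious lift and ends at f.
\<close>

lemma lift_contractible:
  assumes K: "compact_space K" and H: "continuous_map (cylinder K 0 1) K H"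
    and k0: "k0 \<in> topspace K" and H0: "\<And>k. k \<in> topspace K \<Longrightarrow> H (k, 0) = k0" and H1: "\<And>k. k \<in> topspace K \<Longrightarrow> H (k, 1) = k"
    and f: "continuous_map K quotient_top f"
  obtains F where "continuous_map K T F" "\<And>k. k \<in> topspace K \<Longrightarrow> orb (F k) = f k"
proof -
  have "f k0 \<in> topspace quotient_top"
    using continuous_map_image_subset_topspace[OF f] k0 by blast
  then obtain m where m: "m \<in> topspace T" "f k0 = orb m"
    unfolding topspace_quotient_top orbits_def by blast
  obtain F where F: "continuous_map (cylinder K 0 1) T F"
    "\<And>k t. k \<in> topspace K \<Longrightarrow> t \<in> {0..1} \<Longrightarrow> orb (F (k, t)) = (f \<circ> H) (k, t)"
    using lift_homotopy[OF K continuous_map_compose[OF H f], of "\<lambda>_. m"] m H0 by auto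
  have "continuous_map K (cylinder K 0 1) (\<lambda>k. (k, 1))"
    by (intro continuous_map_into_subtopology continuous_map_pairedI) auto
  from continuous_map_compose[OF this F(1)] have "continuous_map K T (\<lambda>k. F (k, 1))"
    by (simp add: o_def)
  moreover have "orb (F (k, 1)) = f k" if "k \<in> topspace K" for k
    using F(2)[OF that, of 1] H1[OF that] by simp
  ultimately show ?thesis by (rule that)
qed

end

section \<open>Plots of a manifold and of its quotient\<close>

lemma continuous_map_locally:
  assumes "\<And>x. x \<in> topspace X \<Longrightarrow> \<exists>W. openin X W \<and> x \<in> W \<and> continuous_map (subtopology X W) Y f"
  shows "continuous_map X Y f"
proof (rule pasting_lemma[where I = "{W. openin X W \<and> continuous_map (subtopology X W) Y f}" and T = "\<lambda>W. W" and f = "\<lambda>_. f"])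
  fix x assume "x \<in> topspace X"
  with assms[OF this] show "\<exists>W. W \<in> {W. openin X W \<and> continuous_map (subtopology X W) Y f} \<and> x \<in> W \<and> f x = f x"
    by blast
qed auto

lemma subtopology_Int_local:
  "W \<subseteq> U \<Longrightarrow> subtopology (subtopology X U) W = subtopology X W"
  by (simp add: subtopology_subtopology inf.absorb2)

lemma openin_subtopology_subset:
  "openin X W \<Longrightarrow> W \<subseteq> U \<Longrightarrow> openin (subtopology X U) W"
  by (auto simp: openin_subtopology)

lemma plot_manifold_iff:
  "plot (manifold_diff M \<A>) k U p \<longleftrightarrow>
     openin (Euclidean_space k) U \<and> p \<in> U \<rightarrow> M \<and>
        (\<forall>u\<in>U. \<exists>W. \<exists>(V, \<psi>)\<in>\<A>. openin (Euclidean_space k) W \<and> u \<in> W \<and> W \<subseteq> U \<and>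
           p \<in> W \<rightarrow> V \<and> (\<forall>i. Cinf_on k W (\<lambda>w. \<psi> (p w) i)))"
  by (simp add: manifold_diff_def)

lemma plot_manifoldE:
  assumes "plot (manifold_diff M \<A>) k U p" "u \<in> U"
  obtains W V \<psi> where "(V, \<psi>) \<in> \<A>" "openin (Euclidean_space k) W" "u \<in> W" "W \<subseteq> U" "p \<in> W \<rightarrow> V"
    "\<forall>i. Cinf_on k W (\<lambda>w. \<psi> (p w) i)"
proof -
  obtain W c where c: "c \<in> \<A>" "case c of (V, \<psi>) \<Rightarrow> openin (Euclidean_space k) W \<and> u \<in> W \<and> W \<subseteq> U \<and>
           p \<in> W \<rightarrow> V \<and> (\<forall>i. Cinf_on k W (\<lambda>w. \<psi> (p w) i))"
    using bspec[OF assms(1)[unfolded plot_manifold_iff, THEN conjunct2, THEN conjunct2] assms(2)]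
    by (elim exE bexE)
  show ?thesis
    by (rule that[of "fst c" "snd c" W]) (use c in \<open>simp_all add: case_prod_unfold\<close>)
qed

lemma plot_manifoldI:
  assumes U: "openin (Euclidean_space k) U" and p: "p \<in> U \<rightarrow> M"
    and local: "\<And>u. u \<in> U \<Longrightarrow> \<exists>W V \<psi>. (V, \<psi>) \<in> \<A> \<and> openin (Euclidean_space k) W \<and> u \<in> W \<and> W \<subseteq> U \<and> p \<in> W \<rightarrow> V \<and>
      (\<forall>i. Cinf_on k W (\<lambda>w. \<psi> (p w) i))"
  shows "plot (manifold_diff M \<A>) k U p"
  unfolding plot_manifold_iff
proof (intro conjI ballI U p)
  fix u assume "u \<in> U"
  from local[OF this] obtain W V \<psi> where "(V, \<psi>) \<in> \<A>" "openin (Euclidean_space k) W \<and> u \<in> W \<and> W \<subseteq> U \<and> p \<in> W \<rightarrow> V \<and>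
      (\<forall>i. Cinf_on k W (\<lambda>w. \<psi> (p w) i))"
    by (elim exE conjE[where P = "_ \<in> _"])
  then show "\<exists>W. \<exists>(V, \<psi>)\<in>\<A>. openin (Euclidean_space k) W \<and> u \<in> W \<and> W \<subseteq> U \<and>
           p \<in> W \<rightarrow> V \<and> (\<forall>i. Cinf_on k W (\<lambda>w. \<psi> (p w) i))"
    by (intro exI[of _ W] bexI[of _ "(V, \<psi>)"]) simp_all
qed

lemma pts_manifold_diff: "pts (manifold_diff M \<A>) = M"
  by (simp add: manifold_diff_def)

lemma plot_manifold_open: "plot (manifold_diff M \<A>) k U p \<Longrightarrow> openin (Euclidean_space k) U"
  by (simp add: plot_manifold_iff)

lemma plot_manifold_mem: "plot (manifold_diff M \<A>) k U p \<Longrightarrow> u \<in> U \<Longrightarrow> p u \<in> M"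
  unfolding plot_manifold_iff by (elim conjE funcset_mem)

text \<open>Plots of a manifold form a sheaf: the property can be checked on an open cover.\<close>

lemma plot_manifold_local:
  assumes U: "openin (Euclidean_space k) U"
    and local: "\<And>u. u \<in> U \<Longrightarrow> \<exists>W q. openin (Euclidean_space k) W \<and> u \<in> W \<and> W \<subseteq> U \<and>
      plot (manifold_diff M \<A>) k W q \<and> (\<forall>w\<in>W. p w = q w)"
  shows "plot (manifold_diff M \<A>) k U p"
proof (rule plot_manifoldI[OF U])
  show "p \<in> U \<rightarrow> M"
  proof
    fix u assume "u \<in> U"
    from local[OF this] obtain W q where "u \<in> W" "plot (manifold_diff M \<A>) k W q" "\<forall>w\<in>W. p w = q w" by blast
    then show "p u \<in> M" using plot_manifold_mem by metis
  qed
  fix u assume "u \<in> U"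
  from local[OF this] obtain W q where W: "u \<in> W" "W \<subseteq> U" and q: "plot (manifold_diff M \<A>) k W q" and eq: "\<forall>w\<in>W. p w = q w" by blast
  obtain W' V \<psi> where W': "(V, \<psi>) \<in> \<A>" "openin (Euclidean_space k) W'" "u \<in> W'" "W' \<subseteq> W" "q \<in> W' \<rightarrow> V"
    "\<forall>i. Cinf_on k W' (\<lambda>w. \<psi> (q w) i)"
    using plot_manifoldE[OF q W(1)] .
  have eq': "p w = q w" if "w \<in> W'" for w
    using that W' eq by blast
  have pV: "p \<in> W' \<rightarrow> V" using W'(5) eq' by auto
  have cinf: "Cinf_on k W' (\<lambda>w. \<psi> (p w) i)" for i
    by (rule Cinf_on_cong[OF spec[OF W'(6), of i]]) (simp add: eq')
  show "\<exists>W V \<psi>. (V, \<psi>) \<in> \<A> \<and> openin (Euclidean_space k) W \<and> u \<in> W \<and> W \<subseteq> U \<and> p \<in> W \<rightarrow> V \<and>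
      (\<forall>i. Cinf_on k W (\<lambda>w. \<psi> (p w) i))"
    by (intro exI[of _ W'] exI[of _ V] exI[of _ \<psi>] conjI allI W'(1-3) subset_trans[OF W'(4) W(2)] pV cinf)
qed

lemma plot_manifold_restrict:
  assumes p: "plot (manifold_diff M \<A>) k U p" and W: "openin (Euclidean_space k) W" "W \<subseteq> U"
  shows "plot (manifold_diff M \<A>) k W p"
proof (rule plot_manifoldI[OF W(1)])
  show "p \<in> W \<rightarrow> M" using plot_manifold_mem[OF p] W(2) by blast
  fix u assume u: "u \<in> W"
  then have "u \<in> U" using W(2) by blast
  obtain W' V \<psi> where W': "(V, \<psi>) \<in> \<A>" "openin (Euclidean_space k) W'" "u \<in> W'" "W' \<subseteq> U" "p \<in> W' \<rightarrow> V"
    "\<forall>i. Cinf_on k W' (\<lambda>w. \<psi> (p w) i)"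
    using plot_manifoldE[OF p \<open>u \<in> U\<close>] .
  have o: "openin (Euclidean_space k) (W' \<inter> W)"
    by (rule openin_Int[OF W'(2) W(1)])
  have cinf: "Cinf_on k (W' \<inter> W) (\<lambda>w. \<psi> (p w) i)" for i
    by (rule Cinf_on_subset[OF spec[OF W'(6), of i] o]) blast
  have pV: "p \<in> W' \<inter> W \<rightarrow> V" using W'(5) by blast
  show "\<exists>W'' V \<psi>. (V, \<psi>) \<in> \<A> \<and> openin (Euclidean_space k) W'' \<and> u \<in> W'' \<and> W'' \<subseteq> W \<and> p \<in> W'' \<rightarrow> V \<and>
      (\<forall>i. Cinf_on k W'' (\<lambda>w. \<psi> (p w) i))"
    by (intro exI[of _ "W' \<inter> W"] exI[of _ V] exI[of _ \<psi>] conjI allI W'(1) o IntI W'(3) u Int_lower2 pV cinf)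
qed

locale manifold_action =
  fixes G :: "('g, 'c) monoid_scheme" and T :: "'a topology" and \<A> :: "'a chart set"
    and d :: nat and act :: "'g \<Rightarrow> 'a \<Rightarrow> 'a"
  assumes manifold: "smooth_manifold d T \<A>"
    and group: "group G" and finite_group: "finite (carrier G)"
    and action: "group_action G (topspace T) act"
    and smooth_act: "\<And>g. g \<in> carrier G \<Longrightarrow>
      smooth (manifold_diff (topspace T) \<A>) (manifold_diff (topspace T) \<A>) (act g)"
    and free: "\<And>g x. g \<in> carrier G \<Longrightarrow> x \<in> topspace T \<Longrightarrow> act g x = x \<Longrightarrow> g = \<one>\<^bsub>G\<^esub>"
begin

abbreviation "M \<equiv> manifold_diff (topspace T) \<A>"
abbreviation "N \<equiv> quotient_diff G act T \<A>"

lemma chart: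
  assumes "(V, \<psi>) \<in> \<A>"
  shows "openin T V" "openin (Euclidean_space d) (\<psi> ` V)"
    "homeomorphic_map (subtopology T V) (subtopology (Euclidean_space d) (\<psi> ` V)) \<psi>"
  using manifold assms unfolding smooth_manifold_def by blast+

lemma charts_cover: "x \<in> topspace T \<Longrightarrow> \<exists>V \<psi>. (V, \<psi>) \<in> \<A> \<and> x \<in> V"
proof -
  assume "x \<in> topspace T"
  then have "x \<in> \<Union>(fst ` \<A>)"
    using manifold unfolding smooth_manifold_def by blast
  then show ?thesis by force
qed

lemma chart_plot_continuous:
  assumes c: "(V, \<psi>) \<in> \<A>" and W: "openin (Euclidean_space k) W" and p: "p \<in> W \<rightarrow> V"
    and smooth: "\<forall>i. Cinf_on k W (\<lambda>w. \<psi> (p w) i)"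
  shows "continuous_map (subtopology (Euclidean_space k) W) T p"
proof -
  obtain g where g: "homeomorphic_maps (subtopology T V) (subtopology (Euclidean_space d) (\<psi> ` V)) \<psi> g"
    using chart(3)[OF c] homeomorphic_map_maps by blast
  have "continuous_on W (\<lambda>w. \<psi> (p w))"
    by (rule continuous_on_coordinatewise_then_product) (rule Cinf_on_continuous_on[OF spec[OF smooth]])
  moreover have "(\<lambda>w. \<psi> (p w)) \<in> W \<rightarrow> \<psi> ` V" using p by auto
  ultimately have 1: "continuous_map (top_of_set W) (top_of_set (\<psi> ` V)) (\<lambda>w. \<psi> (p w))"
    by auto
  have 2: "continuous_map (top_of_set (\<psi> ` V)) T g"
    using g unfolding homeomorphic_maps_def continuous_map_subtopology_Euclidean_space[OF chart(2)[OF c]]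
      continuous_map_in_subtopology by blast
  have "continuous_map (top_of_set W) T (\<lambda>w. g (\<psi> (p w)))"
    using continuous_map_compose[OF 1 2] by (simp only: o_def)
  moreover have "g (\<psi> (p w)) = p w" if "w \<in> W" for w
  proof -
    have "p w \<in> topspace (subtopology T V)"
      using p that openin_subset[OF chart(1)[OF c]] by auto
    then show ?thesis
      using g unfolding homeomorphic_maps_def by blast
  qed
  ultimately have "continuous_map (top_of_set W) T p"
    by (rule continuous_map_eq) simp
  then show ?thesis
    by (simp only: continuous_map_subtopology_Euclidean_space[OF W])
qed

lemma plot_M_continuous:
  assumes p: "plot M k U p"
  shows "continuous_map (subtopology (Euclidean_space k) U) T p"
proof (rule continuous_map_locally)
  fix u assume "u \<in> topspace (subtopology (Euclidean_space k) U)"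
  then have u: "u \<in> U" by simp
  obtain W V \<psi> where W: "(V, \<psi>) \<in> \<A>" "openin (Euclidean_space k) W" "u \<in> W" "W \<subseteq> U" "p \<in> W \<rightarrow> V"
    "\<forall>i. Cinf_on k W (\<lambda>w. \<psi> (p w) i)"
    using plot_manifoldE[OF p u] .
  then show "\<exists>W. openin (subtopology (Euclidean_space k) U) W \<and> u \<in> W \<and>
      continuous_map (subtopology (subtopology (Euclidean_space k) U) W) T p"
    using chart_plot_continuous[OF W(1,2,5,6)] openin_subtopology_subset[OF W(2,4)]
    by (intro exI[of _ W]) (simp only: subtopology_Int_local simp_thms)
qed

lemma inverse_chart_plot:
  assumes c: "(V, \<psi>) \<in> \<A>"
  shows "plot M d (\<psi> ` V) (inv_into V \<psi>)"
proof (rule plot_manifoldI[OF chart(2)[OF c]])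
  have V: "inv_into V \<psi> \<in> \<psi> ` V \<rightarrow> V"
    by (intro funcsetI inv_into_into)
  then show "inv_into V \<psi> \<in> \<psi> ` V \<rightarrow> topspace T"
    using openin_subset[OF chart(1)[OF c]] by blast
  have cinf: "Cinf_on d (\<psi> ` V) (\<lambda>w. \<psi> (inv_into V \<psi> w) i)" for i
    by (rule Cinf_on_cong[OF Cinf_on_coordinate[OF chart(2)[OF c], of i]]) (simp add: f_inv_into_f)
  show "\<exists>W V' \<psi>'. (V', \<psi>') \<in> \<A> \<and> openin (Euclidean_space d) W \<and> u \<in> W \<and> W \<subseteq> \<psi> ` V \<and>
      inv_into V \<psi> \<in> W \<rightarrow> V' \<and> (\<forall>i. Cinf_on d W (\<lambda>w. \<psi>' (inv_into V \<psi> w) i))" if "u \<in> \<psi> ` V" for u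
    by (intro exI[of _ "\<psi> ` V"] exI[of _ V] exI[of _ \<psi>] conjI allI c chart(2)[OF c] that subset_refl V cinf)
qed

text \<open>
  Smoothness speaks of plots only; it gives continuity since the inverse of a chart is a plot.
\<close>

lemma continuous_act:
  assumes g: "g \<in> carrier G"
  shows "continuous_map T T (act g)"
proof (rule continuous_map_locally)
  fix x assume "x \<in> topspace T"
  then obtain V \<psi> where c: "(V, \<psi>) \<in> \<A>" and x: "x \<in> V"
    using charts_cover by blast
  have "plot M d (\<psi> ` V) (act g \<circ> inv_into V \<psi>)"
    using smooth_act[OF g] inverse_chart_plot[OF c] unfolding smooth_def by blast
  then have 1: "continuous_map (subtopology (Euclidean_space d) (\<psi> ` V)) T (act g \<circ> inv_into V \<psi>)"
    by (rule plot_M_continuous)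
  have 2: "continuous_map (subtopology T V) (subtopology (Euclidean_space d) (\<psi> ` V)) \<psi>"
    by (rule homeomorphic_imp_continuous_map[OF chart(3)[OF c]])
  have inj: "inj_on \<psi> V"
    using homeomorphic_imp_injective_map[OF chart(3)[OF c]] openin_subset[OF chart(1)[OF c]]
    by (simp add: inf.absorb2)
  have "continuous_map (subtopology T V) T (act g)"
    by (rule continuous_map_eq[OF continuous_map_compose[OF 2 1]]) (simp add: inv_into_f_f[OF inj])
  then show "\<exists>W. openin T W \<and> x \<in> W \<and> continuous_map (subtopology T W) T (act g)"
    using chart(1)[OF c] x by blast
qed

sublocale free_finite_action G T act
proof -
  interpret group_action G "topspace T" act by (rule action)
  show "free_finite_action G T act"
  proof
    show "Hausdorff_space T"
      using manifold unfolding smooth_manifold_def by blast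
  qed (use finite_group continuous_act free in blast)+
qed

lemma quotient_chartE:
  assumes "(V, \<psi>) \<in> quotient_atlas G act T \<A>"
  obtains W U \<phi> where "V = orb ` W" "\<psi> = \<phi> \<circ> inv_into W orb" "openin T W" "W \<subseteq> U" "(U, \<phi>) \<in> \<A>" "inj_on orb W"
  using assms unfolding quotient_atlas_def by auto

text \<open>
  The charts of the quotient are charts of M transported along a local section of the
  projection, so composing a plot with that section gives a plot of M.
\<close>

lemma plot_N_local_lift:
  assumes p: "plot N k U p" and u: "u \<in> U"
  obtains W m where "openin (Euclidean_space k) W" "u \<in> W" "W \<subseteq> U" "plot M k W m" "\<And>w. w \<in> W \<Longrightarrow> orb (m w) = p w"
proof -
  obtain W V \<psi> where W: "(V, \<psi>) \<in> quotient_atlas G act T \<A>" "openin (Euclidean_space k) W" "u \<in> W" "W \<subseteq> U" "p \<in> W \<rightarrow> V"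
    "\<forall>i. Cinf_on k W (\<lambda>w. \<psi> (p w) i)"
    using plot_manifoldE[OF p[unfolded quotient_diff_def] u] .
  obtain W' U' \<phi> where W': "V = orb ` W'" "\<psi> = \<phi> \<circ> inv_into W' orb" "openin T W'" "W' \<subseteq> U'" "(U', \<phi>) \<in> \<A>"
    using quotient_chartE[OF W(1)] by blast
  let ?m = "\<lambda>w. inv_into W' orb (p w)"
  have m: "?m w \<in> W'" "orb (?m w) = p w" if "w \<in> W" for w
  proof -
    have "p w \<in> orb ` W'" using W(5) W'(1) that by blast
    then show "?m w \<in> W'" "orb (?m w) = p w"
      by (simp_all only: inv_into_into f_inv_into_f)
  qed
  have "plot M k W ?m"
  proof (rule plot_manifoldI[OF W(2)])
    show "?m \<in> W \<rightarrow> topspace T"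
      using m(1) openin_subset[OF W'(3)] by blast
    have cinf: "\<forall>i. Cinf_on k W (\<lambda>w. \<phi> (?m w) i)"
      using W(6) unfolding W'(2) o_def .
    have mU: "?m \<in> W \<rightarrow> U'" using m(1) W'(4) by blast
    show "\<exists>W'' V \<psi>. (V, \<psi>) \<in> \<A> \<and> openin (Euclidean_space k) W'' \<and> u \<in> W'' \<and> W'' \<subseteq> W \<and> ?m \<in> W'' \<rightarrow> V \<and>
        (\<forall>i. Cinf_on k W'' (\<lambda>w. \<psi> (?m w) i))" if "u \<in> W" for u
      by (intro exI[of _ W] exI[of _ U'] exI[of _ \<phi>] conjI W'(5) W(2) that subset_refl mU cinf)
  qed
  then show ?thesis
    using that W m(2) by blast
qed

lemma plot_N_continuous:
  assumes p: "plot N k U p"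
  shows "continuous_map (subtopology (Euclidean_space k) U) quotient_top p"
proof (rule continuous_map_locally)
  fix u assume "u \<in> topspace (subtopology (Euclidean_space k) U)"
  then have u: "u \<in> U" by simp
  obtain W m where W: "openin (Euclidean_space k) W" "u \<in> W" "W \<subseteq> U" and m: "plot M k W m" "\<And>w. w \<in> W \<Longrightarrow> orb (m w) = p w"
    using plot_N_local_lift[OF p u] by blast
  have "continuous_map (subtopology (Euclidean_space k) W) quotient_top (orb \<circ> m)"
    by (rule continuous_map_compose[OF plot_M_continuous[OF m(1)] continuous_orb])
  then have "continuous_map (subtopology (Euclidean_space k) W) quotient_top p"
    by (rule continuous_map_eq) (simp add: m(2))
  then show "\<exists>W. openin (subtopology (Euclidean_space k) U) W \<and> u \<in> W \<and>
      continuous_map (subtopology (subtopology (Euclidean_space k) U) W) quotient_top p"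
    using openin_subtopology_subset[OF W(1,3)] W(2,3)
    by (intro exI[of _ W]) (simp only: subtopology_Int_local simp_thms)
qed

text \<open>
  Intersecting a chart domain with a slice yields the domain of a chart of the quotient.
\<close>

lemma smooth_orb: "smooth M N orb"
  unfolding smooth_def
proof (intro conjI allI impI)
  show "orb \<in> pts M \<rightarrow> pts N"
    by (auto simp: quotient_diff_def pts_manifold_diff orbits_def)
  fix k U p assume p: "plot M k U p"
  show "plot N k U (orb \<circ> p)"
    unfolding quotient_diff_def
  proof (rule plot_manifoldI[OF plot_manifold_open[OF p]])
    show "orb \<circ> p \<in> U \<rightarrow> orbits G (topspace T) act"
      using plot_manifold_mem[OF p] by (auto simp: orbits_def)
    fix u assume u: "u \<in> U"
    obtain W V \<psi> where W: "(V, \<psi>) \<in> \<A>" "openin (Euclidean_space k) W" "u \<in> W" "W \<subseteq> U" "p \<in> W \<rightarrow> V"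
      "\<forall>i. Cinf_on k W (\<lambda>w. \<psi> (p w) i)"
      using plot_manifoldE[OF p u] .
    obtain S where S: "slice S" "p u \<in> S"
      using slice_exists[OF plot_manifold_mem[OF p u]] .
    let ?S = "V \<inter> S"
    have oS: "openin T ?S" using chart(1)[OF W(1)] S(1) by (auto simp: slice_def)
    have "slice ?S" by (rule slice_subset[OF S(1) oS]) blast
    then have inj: "inj_on orb ?S" by (rule slice_inj)
    let ?W = "{w \<in> W. p w \<in> ?S}"
    have "openin (subtopology (Euclidean_space k) W) {w \<in> topspace (subtopology (Euclidean_space k) W). p w \<in> ?S}"
      by (rule openin_continuous_map_preimage[OF plot_M_continuous[OF plot_manifold_restrict[OF p W(2,4)]] oS])
    moreover have "topspace (subtopology (Euclidean_space k) W) = W"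
      using openin_subset[OF W(2)] by (simp add: inf.absorb2)
    ultimately have "openin (subtopology (Euclidean_space k) W) ?W"
      by (simp only:)
    then have oW: "openin (Euclidean_space k) ?W"
      using W(2) openin_trans_full by blast
    have q: "(orb ` ?S, \<psi> \<circ> inv_into ?S orb) \<in> quotient_atlas G act T \<A>"
      unfolding quotient_atlas_def using oS W(1) inj by blast
    have cinf: "Cinf_on k ?W (\<lambda>w. (\<psi> \<circ> inv_into ?S orb) ((orb \<circ> p) w) i)" for i
    proof (rule Cinf_on_cong)
      show "Cinf_on k ?W (\<lambda>w. \<psi> (p w) i)"
        by (rule Cinf_on_subset[OF spec[OF W(6), of i] oW]) blast
      show "\<psi> (p w) i = (\<psi> \<circ> inv_into ?S orb) ((orb \<circ> p) w) i" if "w \<in> ?W" for w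
      proof -
        have "inv_into ?S orb (orb (p w)) = p w"
          by (rule inv_into_f_f[OF inj]) (use that in blast)
        then show ?thesis by (simp only: o_apply)
      qed
    qed
    have uW: "u \<in> ?W" using W(3,5) S(2) by blast
    have WU: "?W \<subseteq> U" using W(4) by blast
    have pS: "orb \<circ> p \<in> ?W \<rightarrow> orb ` ?S" by auto
    show "\<exists>W V \<psi>. (V, \<psi>) \<in> quotient_atlas G act T \<A> \<and> openin (Euclidean_space k) W \<and> u \<in> W \<and> W \<subseteq> U \<and>
        orb \<circ> p \<in> W \<rightarrow> V \<and> (\<forall>i. Cinf_on k W (\<lambda>w. \<psi> ((orb \<circ> p) w) i))"
      by (intro exI[of _ ?W] exI[of _ "orb ` ?S"] exI[of _ "\<psi> \<circ> inv_into ?S orb"] conjI allI q oW uW WU pS cinf)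
  qed
qed

text \<open>
  Near each point there is some smooth lift; after a translation it agrees with F at the point,
  and then on a neighbourhood because the set where two lifts agree is open.
\<close>

lemma continuous_lift_of_plot:
  assumes p: "plot N k U p" and F: "continuous_map (subtopology (Euclidean_space k) U) T F"
    and lift: "\<And>u. u \<in> U \<Longrightarrow> orb (F u) = p u"
  shows "plot M k U F"
proof (rule plot_manifold_local)
  show U: "openin (Euclidean_space k) U"
    using plot_manifold_open p unfolding quotient_diff_def by blast
  fix u assume u: "u \<in> U"
  obtain W m where W: "openin (Euclidean_space k) W" "u \<in> W" "W \<subseteq> U" and m: "plot M k W m" "\<And>w. w \<in> W \<Longrightarrow> orb (m w) = p w"
    using plot_N_local_lift[OF p u] by blast
  have topW: "topspace (subtopology (Euclidean_space k) W) = W"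
    using openin_subset[OF W(1)] by (simp add: inf.absorb2)
  have FW: "continuous_map (subtopology (Euclidean_space k) W) T F"
    by (rule continuous_map_from_subtopology_mono[OF F W(3)])
  have Fu: "F w \<in> topspace T" if "w \<in> W" for w
    using continuous_map_image_subset_topspace[OF FW] that topW by auto
  obtain g where g: "g \<in> carrier G" "F u = act g (m u)"
    using orb_eq_iff[OF plot_manifold_mem[OF m(1) W(2)] Fu[OF W(2)]] m(2)[OF W(2)] lift[OF u] by auto
  have gm: "plot M k W (act g \<circ> m)"
    using smooth_act[OF g(1)] m(1) unfolding smooth_def by blast
  let ?A = "{w \<in> topspace (subtopology (Euclidean_space k) W). F w = (act g \<circ> m) w}"
  have "openin (subtopology (Euclidean_space k) W) ?A"
  proof (rule openin_lifts_agree[OF plot_M_continuous[OF gm] FW])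
    fix w assume "w \<in> topspace (subtopology (Euclidean_space k) W)"
    then have w: "w \<in> W" "w \<in> U" using topW W(3) by auto
    show "orb ((act g \<circ> m) w) = orb (F w)"
      using orb_act[OF g(1) plot_manifold_mem[OF m(1) w(1)]] m(2)[OF w(1)] lift[OF w(2)] by simp
  qed
  then have oA: "openin (Euclidean_space k) ?A"
    using W(1) openin_trans_full by blast
  have AW: "?A \<subseteq> W" using topW by blast
  have "plot M k ?A (act g \<circ> m)"
    by (rule plot_manifold_restrict[OF gm oA AW])
  moreover have "u \<in> ?A" unfolding topW using W(2) g(2) by simp
  ultimately show "\<exists>W q. openin (Euclidean_space k) W \<and> u \<in> W \<and> W \<subseteq> U \<and> plot M k W q \<and> (\<forall>w\<in>W. F w = q w)"
    using oA AW W(3) by (intro exI[of _ ?A] exI[of _ "act g \<circ> m"] conjI) blast+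
qed

end

section \<open>The topology of smooth simplices\<close>

lemma kihara_map_apply: "kihara_map i (x, t) j = (1 - t) * (if j = i then 1 else 0) + t * simplical_face i x j"
  by (simp add: kihara_map_def)

lemma simplical_face_apply:
  "simplical_face i x j = (if j < i then x j else if j = i then 0 else x (j - 1))"
  by (simp add: simplical_face_def)

lemma kihara_map_in_simplex:
  assumes "i \<le> Suc n" "x \<in> standard_simplex n" "0 \<le> t" "t \<le> 1"
  shows "kihara_map i (x, t) \<in> standard_simplex (Suc n)"
proof -
  have "simplical_face i x \<in> standard_simplex (Suc n)"
    using assms simplical_face_in_standard_simplex[of "Suc n" i x] by simp
  then have "(\<lambda>j. (1 - t) * (if j = i then 1 else 0) + t * simplical_face i x j) \<in> standard_simplex (Suc n)"
    using assms by (intro convex_standard_simplex) auto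
  then show ?thesis by (simp add: kihara_map_def)
qed

lemma plot_std_simplex_mem:
  assumes "plot (std_simplex n) m U q" "u \<in> U"
  shows "q u \<in> standard_simplex n"
proof (cases n rule: std_simplex.cases)
  case 1 with assms show ?thesis by (auto simp: subspace_diff_def)
next
  case 2 with assms show ?thesis by (auto simp: subspace_diff_def)
next
  case 3 with assms show ?thesis by (auto simp: final_diff_def)
qed

lemma plot_std_simplex_open: "plot (std_simplex n) m U q \<Longrightarrow> openin (Euclidean_space m) U"
  by (cases n rule: std_simplex.cases) (auto simp: subspace_diff_def euclid_def final_diff_def)

lemma continuous_kihara_map: "continuous_on S (kihara_map i)"
proof (rule continuous_on_coordinatewise_then_product)
  fix j
  have x: "continuous_on S (\<lambda>z :: (nat \<Rightarrow> real) \<times> real. fst z l)" for l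
    using continuous_on_compose[OF continuous_on_fst[OF continuous_on_id] continuous_on_coordinate] by (simp add: o_def)
  have face: "continuous_on S (\<lambda>z :: (nat \<Rightarrow> real) \<times> real. simplical_face i (fst z) j)"
  proof -
    consider "j < i" | "j = i" | "j > i" by linarith
    then show ?thesis
    proof cases
      case 1
      then have "(\<lambda>z :: (nat \<Rightarrow> real) \<times> real. simplical_face i (fst z) j) = (\<lambda>z. fst z j)"
        by (simp add: simplical_face_apply)
      then show ?thesis using x by (simp only:)
    next
      case 2
      then have "(\<lambda>z :: (nat \<Rightarrow> real) \<times> real. simplical_face i (fst z) j) = (\<lambda>z. 0)"
        by (simp add: simplical_face_apply)
      then show ?thesis by (simp only: continuous_on_const)
    next
      case 3
      then have "(\<lambda>z :: (nat \<Rightarrow> real) \<times> real. simplical_face i (fst z) j) = (\<lambda>z. fst z (j - 1))"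
        by (simp add: simplical_face_apply)
      then show ?thesis using x by (simp only:)
    qed
  qed
  have "(\<lambda>z. kihara_map i z j) = (\<lambda>z. (1 - snd z) * (if j = i then 1 else 0) + snd z * simplical_face i (fst z) j)"
    by (simp add: kihara_map_def case_prod_unfold)
  then show "continuous_on S (\<lambda>z. kihara_map i z j)"
    by (simp only:) (intro continuous_on_add continuous_on_mult continuous_on_diff continuous_on_const
        continuous_on_snd continuous_on_id face)
qed

lemma plot_euclid_continuous:
  assumes "plot (euclid n) m U p"
  shows "continuous_on U p"
proof (rule continuous_on_coordinatewise_then_product)
  fix i
  show "continuous_on U (\<lambda>u. p u i)"
  proof (cases "i < n")
    case True
    then show ?thesis
      using assms by (intro Cinf_on_continuous_on[of m]) (simp add: euclid_def)
  next
    case False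
    have "p u i = 0" if "u \<in> U" for u
      using assms that False by (auto simp: euclid_def Pi_iff)
    then show ?thesis
      using continuous_on_cong[OF refl, of U "\<lambda>u. p u i" "\<lambda>_. 0"] continuous_on_const by blast
  qed
qed

lemma continuous_on_open_cover:
  assumes U: "openin (Euclidean_space m) U"
    and local: "\<And>u. u \<in> U \<Longrightarrow> \<exists>W. openin (Euclidean_space m) W \<and> u \<in> W \<and> W \<subseteq> U \<and> continuous_on W f"
  shows "continuous_on U f"
proof -
  have "continuous_map (subtopology (Euclidean_space m) U) euclidean f"
  proof (rule continuous_map_locally)
    fix u assume "u \<in> topspace (subtopology (Euclidean_space m) U)"
    then have "u \<in> U" by simp
    from local[OF this] obtain W where W: "openin (Euclidean_space m) W" "u \<in> W" "W \<subseteq> U" "continuous_on W f" by blast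
    have "continuous_map (subtopology (Euclidean_space m) W) euclidean f"
      using W(4) by (simp only: continuous_map_subtopology_Euclidean_space[OF W(1)] continuous_map_iff_continuous)
    then show "\<exists>W. openin (subtopology (Euclidean_space m) U) W \<and> u \<in> W \<and>
        continuous_map (subtopology (subtopology (Euclidean_space m) U) W) euclidean f"
      using openin_subtopology_subset[OF W(1,3)] W(2,3)
      by (intro exI[of _ W]) (simp only: subtopology_Int_local simp_thms)
  qed
  then show ?thesis
    by (simp only: continuous_map_subtopology_Euclidean_space[OF U] continuous_map_iff_continuous)
qed

lemma plot_std_simplex_continuous:
  "plot (std_simplex n) m U q \<Longrightarrow> continuous_on U q"
proof (induction n arbitrary: m U q rule: std_simplex.induct)
  case 1
  then show ?case by (intro plot_euclid_continuous[of 1 m]) (simp add: subspace_diff_def)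
next
  case 2
  then show ?case by (intro plot_euclid_continuous[of 2 m]) (simp add: subspace_diff_def)
next
  case (3 n)
  show ?case
  proof (rule continuous_on_open_cover[OF plot_std_simplex_open[OF "3.prems"]])
    fix u assume u: "u \<in> U"
    have "\<forall>u\<in>U. \<exists>W. openin (Euclidean_space m) W \<and> u \<in> W \<and> W \<subseteq> U \<and>
           ((\<exists>b. \<forall>w\<in>W. q w = b) \<or>
            (\<exists>i\<in>{..Suc (Suc n)}. \<exists>p. plot (prod_diff (std_simplex (Suc n)) (subspace_diff real_line {0..<1})) m W p \<and>
               (\<forall>w\<in>W. q w = kihara_map i (p w))))"
      using "3.prems" by (simp add: final_diff_def)
    from bspec[OF this u] obtain W where W: "openin (Euclidean_space m) W" "u \<in> W" "W \<subseteq> U"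
      "(\<exists>b. \<forall>w\<in>W. q w = b) \<or>
            (\<exists>i\<in>{..Suc (Suc n)}. \<exists>p. plot (prod_diff (std_simplex (Suc n)) (subspace_diff real_line {0..<1})) m W p \<and>
               (\<forall>w\<in>W. q w = kihara_map i (p w)))"
      by (elim exE conjE)
    from W(4) have "continuous_on W q"
    proof (elim disjE exE bexE conjE)
      fix b assume "\<forall>w\<in>W. q w = b"
      then show ?thesis
        using continuous_on_cong[OF refl, of W q "\<lambda>_. b"] continuous_on_const by blast
    next
      fix i p assume p: "plot (prod_diff (std_simplex (Suc n)) (subspace_diff real_line {0..<1})) m W p"
        and eq: "\<forall>w\<in>W. q w = kihara_map i (p w)"
      have "plot (std_simplex (Suc n)) m W (fst \<circ> p)"
        using p by (simp add: prod_diff_def)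
      then have "continuous_on W (fst \<circ> p)"
        by (rule "3.IH")
      moreover have "continuous_on W (snd \<circ> p)"
        using p by (intro Cinf_on_continuous_on[of m]) (simp add: prod_diff_def subspace_diff_def real_line_def)
      ultimately have "continuous_on W (\<lambda>w. (fst (p w), snd (p w)))"
        by (intro continuous_on_Pair) (simp_all only: o_def)
      then have "continuous_on W p" by simp
      then have "continuous_on W (\<lambda>w. kihara_map i (p w))"
        using continuous_on_compose[OF _ continuous_kihara_map] by (simp add: o_def)
      then show ?thesis
        using continuous_on_cong[OF refl, of W q "\<lambda>w. kihara_map i (p w)"] eq by blast
    qed
    with W show "\<exists>W. openin (Euclidean_space m) W \<and> u \<in> W \<and> W \<subseteq> U \<and> continuous_on W q" by blast
  qed
qed

text \<open>
  By definition of the final diffeology in dimension at least 2. A 1-simplex has the subspace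
  diffeology, and there the coordinates are polynomials in those of q and in t.
\<close>

lemma kihara_plot:
  assumes q: "plot (std_simplex n) m U q" and t: "Cinf_on m U t" "t \<in> U \<rightarrow> {0..<1}" and i: "i \<le> Suc n"
  shows "plot (std_simplex (Suc n)) m U (\<lambda>u. kihara_map i (q u, t u))"
proof -
  have U: "openin (Euclidean_space m) U" by (rule plot_std_simplex_open[OF q])
  have mem: "(\<lambda>u. kihara_map i (q u, t u)) \<in> U \<rightarrow> standard_simplex (Suc n)"
  proof
    fix u assume u: "u \<in> U"
    then have "t u \<in> {0..<1}" using t(2) by blast
    then show "kihara_map i (q u, t u) \<in> standard_simplex (Suc n)"
      by (intro kihara_map_in_simplex[OF i plot_std_simplex_mem[OF q u]]) auto
  qed
  show ?thesis
  proof (cases n)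
    case 0
    have q0: "Cinf_on m U (\<lambda>u. q u 0)"
      using q by (simp add: 0 subspace_diff_def euclid_def)
    have cinf: "Cinf_on m U (\<lambda>u. kihara_map i (q u, t u) j)" if "j < 2" for j
    proof -
      have face: "Cinf_on m U (\<lambda>u. simplical_face i (q u) j)"
      proof (cases "j = i")
        case True
        then have "(\<lambda>u. simplical_face i (q u) j) = (\<lambda>u. 0)" by (simp add: simplical_face_apply)
        then show ?thesis using Cinf_on_const[OF U] by (simp only:)
      next
        case False
        have "j < i \<and> j = 0 \<or> \<not> j < i \<and> j - 1 = 0"
          using False that i 0 by linarith
        then have "simplical_face i (q u) j = q u 0" for u
          using False by (auto simp: simplical_face_apply)
        then have "(\<lambda>u. simplical_face i (q u) j) = (\<lambda>u. q u 0)" by (rule ext)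
        then show ?thesis using q0 by (simp only:)
      qed
      show ?thesis
        unfolding kihara_map_apply
        by (intro Cinf_on_add Cinf_on_mult Cinf_on_diff Cinf_on_const U t(1) face)
    qed
    have mem1: "(\<lambda>u. kihara_map i (q u, t u)) \<in> U \<rightarrow> standard_simplex 1"
      using mem by (simp only: 0 One_nat_def)
    have "standard_simplex 1 \<subseteq> topspace (Euclidean_space 2)"
      using standard_simplex_subset_Euclidean_space[of 1] by (simp only: numeral_2_eq_2 One_nat_def)
    with mem1 have top: "(\<lambda>u. kihara_map i (q u, t u)) \<in> U \<rightarrow> topspace (Euclidean_space 2)"
      by blast
    show ?thesis
      unfolding 0 std_simplex.simps subspace_diff_def euclid_def diffsp.sel
      by (intro conjI allI impI U top mem1 cinf)
  next
    case (Suc n')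
    have "plot (prod_diff (std_simplex (Suc n')) (subspace_diff real_line {0..<1})) m U (\<lambda>u. (q u, t u))"
      using q t by (simp add: prod_diff_def subspace_diff_def real_line_def o_def Suc)
    then have "\<exists>W. openin (Euclidean_space m) W \<and> u \<in> W \<and> W \<subseteq> U \<and>
           ((\<exists>b. \<forall>w\<in>W. kihara_map i (q w, t w) = b) \<or>
            (\<exists>i'\<in>{..Suc (Suc n')}. \<exists>p. plot (prod_diff (std_simplex (Suc n')) (subspace_diff real_line {0..<1})) m W p \<and>
               (\<forall>w\<in>W. kihara_map i (q w, t w) = kihara_map i' (p w))))" if "u \<in> U" for u
      using U that i Suc by (intro exI[of _ U] conjI disjI2 bexI[of _ i] exI[of _ "\<lambda>u. (q u, t u)"]) simp_all
    then show ?thesis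
      unfolding Suc std_simplex.simps final_diff_def diffsp.sel
      by (intro conjI ballI U mem[unfolded Suc])
  qed
qed

text \<open>
  Every point lies on the cone from the vertex i over the opposite face; at the vertex itself,
  any point of the face will do.
\<close>

lemma kihara_map_surj:
  assumes y: "y \<in> standard_simplex (Suc n)" and i: "i \<le> Suc n"
  obtains x where "x \<in> standard_simplex n" "y = kihara_map i (x, 1 - y i)"
proof (cases "y i = 1")
  case True
  have y_props: "\<And>j. 0 \<le> y j" "\<And>j. j > Suc n \<Longrightarrow> y j = 0" "(\<Sum>j\<le>Suc n. y j) = 1"
    using y by (auto simp: standard_simplex_def)
  have "y j = 0" if "j \<noteq> i" for j
  proof (cases "j \<le> Suc n")
    case True
    have "y i + y j \<le> (\<Sum>j\<le>Suc n. y j)"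
    proof -
      have "(\<Sum>j\<in>{i, j}. y j) \<le> (\<Sum>j\<le>Suc n. y j)"
        by (rule sum_mono2) (use True i y_props in auto)
      then show ?thesis using that by simp
    qed
    then show ?thesis using y_props \<open>y i = 1\<close> by (smt (verit))
  qed (use y_props in auto)
  then have "y = kihara_map i (x, 1 - y i)" for x
    using True by (auto simp: kihara_map_apply fun_eq_iff)
  then show ?thesis using that nonempty_standard_simplex[of n] by blast
next
  case False
  have y_props: "\<And>j. 0 \<le> y j" "\<And>j. y j \<le> 1" "\<And>j. j > Suc n \<Longrightarrow> y j = 0" "(\<Sum>j\<le>Suc n. y j) = 1"
    using y by (auto simp: standard_simplex_def)
  define r where "r = 1 - y i"
  have r: "r > 0" using False y_props(2)[of i] by (simp add: r_def)
  define x where "x j = (if j < i then y j else y (Suc j)) / r" for j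
  have "{..Suc n} = insert i ({..<i} \<union> Suc ` {i..n})"
  proof (intro equalityI subsetI)
    fix j assume j: "j \<in> {..Suc n}"
    consider "j < i" | "j = i" | "j > i" by linarith
    then show "j \<in> insert i ({..<i} \<union> Suc ` {i..n})"
    proof cases
      case 3
      then have "j = Suc (j - 1)" "j - 1 \<in> {i..n}" using j by auto
      then show ?thesis by blast
    qed auto
  qed (use i in auto)
  then have "(\<Sum>j\<le>Suc n. y j) = y i + (\<Sum>j\<in>{..<i} \<union> Suc ` {i..n}. y j)"
    by (simp add: sum.insert_if image_iff)
  also have "(\<Sum>j\<in>{..<i} \<union> Suc ` {i..n}. y j) = (\<Sum>j<i. y j) + (\<Sum>j\<in>{i..n}. y (Suc j))"
  proof -
    have "(\<Sum>j\<in>Suc ` {i..n}. y j) = (\<Sum>j\<in>{i..n}. y (Suc j))"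
      by (simp only: sum.reindex[OF inj_Suc] o_def)
    moreover have "{..<i} \<inter> Suc ` {i..n} = {}" by auto
    ultimately show ?thesis
      using sum.union_disjoint[of "{..<i}" "Suc ` {i..n}" y] by simp
  qed
  finally have sum_r: "(\<Sum>j<i. y j) + (\<Sum>j\<in>{i..n}. y (Suc j)) = r"
    using y_props(4) by (simp add: r_def)
  have "{..n} = {..<i} \<union> {i..n}" using i by auto
  then have "(\<Sum>j\<le>n. x j) = (\<Sum>j<i. x j) + (\<Sum>j\<in>{i..n}. x j)"
    by (simp add: sum.union_disjoint ivl_disj_int)
  also have "\<dots> = ((\<Sum>j<i. y j) + (\<Sum>j\<in>{i..n}. y (Suc j))) / r"
    by (simp add: x_def add_divide_distrib sum_divide_distrib)
  finally have sum_x: "(\<Sum>j\<le>n. x j) = 1" using sum_r r by simp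
  have x0: "0 \<le> x j" for j using y_props(1) r by (simp add: x_def)
  have xn: "x j = 0" if "j > n" for j using that i y_props(3) by (simp add: x_def)
  have x1: "x j \<le> 1" for j
  proof (cases "j \<le> n")
    case True
    then have "x j \<le> (\<Sum>j\<le>n. x j)" by (intro member_le_sum) (auto simp: x0)
    then show ?thesis using sum_x by simp
  qed (simp add: xn)
  have "x \<in> standard_simplex n"
    using x0 x1 xn sum_x by (simp add: standard_simplex_def)
  moreover have "y = kihara_map i (x, 1 - y i)"
  proof
    fix j
    show "y j = kihara_map i (x, 1 - y i) j"
      unfolding kihara_map_apply simplical_face_apply r_def[symmetric]
      using r by (auto simp: x_def r_def)
  qed
  ultimately show ?thesis by (rule that)
qed


text \<open>
  Continuity on a simplex is proved by induction on its dimension along the cones over its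
  faces, which turn a simplex into a simplex of lower dimension and a parameter t in [0, 1). To
  keep the induction going, the parameters are collected in an open cube. Its coordinates r
  range over an open interval, where plots are available, and t = \<open>r\<^sup>2\<close> is
  smooth in r and covers [0, 1).
\<close>

definition open_cube :: "nat \<Rightarrow> (nat \<Rightarrow> real) set" where
  "open_cube k = {x. (\<forall>i\<ge>k. x i = 0) \<and> (\<forall>i<k. \<bar>x i\<bar> < 1)}"

lemma open_Euclidean_conditions:
  "open {x :: nat \<Rightarrow> real. \<forall>i<k. \<bar>x i\<bar> < 1}"
proof -
  have "open {x :: nat \<Rightarrow> real. \<bar>x i\<bar> < 1}" for i
    by (intro open_Collect_less continuous_on_rabs continuous_on_coordinate continuous_on_const)
  then have "open (\<Inter>i<k. {x :: nat \<Rightarrow> real. \<bar>x i\<bar> < 1})"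
    by (intro open_INT) auto
  moreover have "(\<Inter>i<k. {x :: nat \<Rightarrow> real. \<bar>x i\<bar> < 1}) = {x. \<forall>i<k. \<bar>x i\<bar> < 1}" by auto
  ultimately show ?thesis by simp
qed

lemma openin_open_cube: "openin (Euclidean_space k) (open_cube k)"
proof -
  have "open_cube k = {x. \<forall>i\<ge>k. x i = 0} \<inter> {x. \<forall>i<k. \<bar>x i\<bar> < 1}"
    by (auto simp: open_cube_def)
  then show ?thesis
    unfolding Euclidean_space_eq_top_of_set using open_Euclidean_conditions openin_open by blast
qed

lemma compact_standard_simplex: "compact (standard_simplex n)"
  using compactin_standard_simplex[of n] by (simp add: euclidean_product_topology)

lemma continuous_on_fun_upd:
  "continuous_on S (\<lambda>z :: (nat \<Rightarrow> real) \<times> real. (fst z)(k := snd z))"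
proof (rule continuous_on_coordinatewise_then_product)
  fix i
  show "continuous_on S (\<lambda>z :: (nat \<Rightarrow> real) \<times> real. ((fst z)(k := snd z)) i)"
  proof (cases "i = k")
    case True
    then have "(\<lambda>z :: (nat \<Rightarrow> real) \<times> real. ((fst z)(k := snd z)) i) = snd" by auto
    then show ?thesis by (simp only: continuous_on_snd continuous_on_id)
  next
    case False
    then have "(\<lambda>z :: (nat \<Rightarrow> real) \<times> real. ((fst z)(k := snd z)) i) = (\<lambda>z. fst z i)" by auto
    moreover have "continuous_on S (\<lambda>z :: (nat \<Rightarrow> real) \<times> real. fst z i)"
      using continuous_on_compose[OF continuous_on_fst[OF continuous_on_id] continuous_on_coordinate] by (simp add: o_def)
    ultimately show ?thesis by (simp only:)
  qed
qed

lemma closedin_sequentiallyI: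
  fixes Z :: "'b::metric_space set"
  assumes "D \<subseteq> Z" "\<And>z l. (\<And>r. z r \<in> D) \<Longrightarrow> l \<in> Z \<Longrightarrow> z \<longlonglongrightarrow> l \<Longrightarrow> l \<in> D"
  shows "closedin (top_of_set Z) D"
  unfolding closedin_limpt
proof (intro conjI allI impI assms(1))
  fix l assume l: "l islimpt D \<and> l \<in> Z"
  then have "\<exists>z. (\<forall>r. z r \<in> D - {l}) \<and> z \<longlonglongrightarrow> l"
    by (simp only: islimpt_sequential)
  then obtain z where z: "\<forall>r. z r \<in> D - {l}" "z \<longlonglongrightarrow> l"
    by (elim exE conjE)
  show "l \<in> D"
    by (rule assms(2)[OF _ conjunct2[OF l] z(2)]) (use z(1) in blast)
qed

lemma closedin_sequentiallyD:
  fixes Z :: "'b::metric_space set"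
  assumes "closedin (top_of_set Z) D" "\<And>r. z r \<in> D" "l \<in> Z" "z \<longlonglongrightarrow> l"
  shows "l \<in> D"
proof -
  obtain E where E: "closed E" "D = Z \<inter> E"
    using assms(1) unfolding closedin_closed by blast
  have "l \<in> E"
    by (rule closed_sequentially[OF E(1) _ assms(4)]) (use assms(2) E(2) in blast)
  then show ?thesis using E(2) assms(3) by blast
qed

text \<open>
  The cones over the faces, without their bases, cover the simplex: a point with positive i-th
  coordinate is in the cone from vertex i, with parameter \<open>1 - y i < 1\<close>. A
  convergent sequence of points can be lifted to such a cone; the lifts accumulate because the
  face is compact, so preimages of closed sets are sequentially closed.
\<close>

lemma continuous_by_faces:
  fixes f :: "(nat \<Rightarrow> real) \<times> (nat \<Rightarrow> real) \<Rightarrow> 'y"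
  assumes faces: "\<And>i. i \<le> Suc n \<Longrightarrow> continuous_map (top_of_set (standard_simplex n \<times> open_cube (Suc k))) Y
      (\<lambda>(x, c). f (kihara_map i (x, (c k)\<^sup>2), c(k := 0)))"
  shows "continuous_map (top_of_set (standard_simplex (Suc n) \<times> open_cube k)) Y f"
  unfolding continuous_map_closedin
proof (intro conjI ballI allI impI)
  let ?Z = "standard_simplex (Suc n) \<times> open_cube k"
  have root: "sqrt (1 - y i) \<ge> 0" "sqrt (1 - y i) < 1" "(sqrt (1 - y i))\<^sup>2 = 1 - y i"
    if "y \<in> standard_simplex (Suc n)" "y i > 0" for y :: "nat \<Rightarrow> real" and i
  proof -
    have "y i \<le> 1" using that(1) by (simp add: standard_simplex_def)
    then show "sqrt (1 - y i) \<ge> 0" "sqrt (1 - y i) < 1" "(sqrt (1 - y i))\<^sup>2 = 1 - y i"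
      using that(2) by auto
  qed
  have cube: "c(k := s) \<in> open_cube (Suc k)" "(c(k := s))(k := 0) = c"
    if "c \<in> open_cube k" "0 \<le> s" "s < 1" for c and s :: real
    using that by (auto simp: open_cube_def less_Suc_eq)
  have pos: "\<exists>i\<le>Suc n. y i > 0" if y: "y \<in> standard_simplex (Suc n)" for y
  proof (rule ccontr)
    assume "\<not> ?thesis"
    then have "(\<Sum>i\<le>Suc n. y i) \<le> 0" by (intro sum_nonpos) (auto simp: not_less)
    then show False using y by (simp add: standard_simplex_def)
  qed
  show "f \<in> topspace (top_of_set ?Z) \<rightarrow> topspace Y"
  proof
    fix z assume "z \<in> topspace (top_of_set ?Z)"
    then obtain y c where z: "z = (y, c)" "y \<in> standard_simplex (Suc n)" "c \<in> open_cube k" by auto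
    obtain i where i: "i \<le> Suc n" "y i > 0" using pos[OF z(2)] by blast
    let ?s = "sqrt (1 - y i)"
    obtain x where x: "x \<in> standard_simplex n" "y = kihara_map i (x, 1 - y i)"
      by (rule kihara_map_surj[OF z(2) i(1)])
    note s = root[OF z(2) i(2)]
    have "(\<lambda>(x, c). f (kihara_map i (x, (c k)\<^sup>2), c(k := 0))) \<in>
        topspace (top_of_set (standard_simplex n \<times> open_cube (Suc k))) \<rightarrow> topspace Y"
      by (rule continuous_map_funspace[OF faces[OF i(1)]])
    then have "(\<lambda>(x, c). f (kihara_map i (x, (c k)\<^sup>2), c(k := 0))) (x, c(k := ?s)) \<in> topspace Y"
      by (rule funcset_mem) (simp add: x(1) cube(1)[OF z(3) s(1,2)])
    then show "f z \<in> topspace Y"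
      by (simp only: prod.case fun_upd_same s(3) cube(2)[OF z(3) s(1,2)] x(2)[symmetric] z(1))
  qed
  fix C assume C: "closedin Y C"
  let ?D = "{z \<in> topspace (top_of_set ?Z). f z \<in> C}"
  have limit: "l \<in> ?D" if z: "\<And>r. z r \<in> ?D" and l: "l \<in> ?Z" and lim: "z \<longlonglongrightarrow> l" for z :: "nat \<Rightarrow> (nat \<Rightarrow> real) \<times> (nat \<Rightarrow> real)" and l
  proof -
    define y c where "y r = fst (z r)" and "c r = snd (z r)" for r
    have yc: "y r \<in> standard_simplex (Suc n)" "c r \<in> open_cube k" "f (y r, c r) \<in> C" for r
      using z[of r] by (auto simp: y_def c_def)
    obtain y0 c0 where l0: "l = (y0, c0)" "y0 \<in> standard_simplex (Suc n)" "c0 \<in> open_cube k"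
      using l by auto
    have limy: "y \<longlonglongrightarrow> y0" and limc: "c \<longlonglongrightarrow> c0"
      using tendsto_fst[OF lim] tendsto_snd[OF lim] by (simp_all add: y_def[abs_def] c_def[abs_def] l0)
    obtain i where i: "i \<le> Suc n" "y0 i > 0" using pos[OF l0(2)] by blast
    have limyi: "(\<lambda>r. y r i) \<longlonglongrightarrow> y0 i"
      using continuous_on_tendsto_compose[OF continuous_on_coordinate[of UNIV i] limy] by simp
    then obtain R where R: "\<And>r. r \<ge> R \<Longrightarrow> y r i > 0"
      using order_tendstoD(1)[OF limyi i(2)] unfolding eventually_sequentially by blast
    \<comment> \<open>The cube coordinate over the cone parameter \<open>1 - y i\<close>, for the tail of the sequence on which it is less than 1.\<close>
    define s where "s r = sqrt (1 - y (r + R) i)" for r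
    have lims: "s \<longlonglongrightarrow> sqrt (1 - y0 i)"
      unfolding s_def[abs_def] using LIMSEQ_ignore_initial_segment[OF limyi, of R] by (intro tendsto_intros)
    define lifted where "lifted r x \<longleftrightarrow> x \<in> standard_simplex n \<and> y (r + R) = kihara_map i (x, 1 - y (r + R) i)" for r x
    have "\<exists>x. lifted r x" for r
      unfolding lifted_def by (rule kihara_map_surj[OF yc(1) i(1)]) (rule exI, rule conjI)
    then obtain x where "\<And>r. lifted r (x r)" by metis
    note x = conjunct1[OF this[unfolded lifted_def]] conjunct2[OF this[unfolded lifted_def]]
    have s: "0 \<le> s r" "s r < 1" "(s r)\<^sup>2 = 1 - y (r + R) i" for r
      unfolding s_def by (rule root[OF yc(1) R], simp)+
    \<comment> \<open>The face component need not converge, since at the vertex it is not determined by the point.\<close>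
    obtain x0 \<rho> where x0: "x0 \<in> standard_simplex n" "strict_mono \<rho>" "(x \<circ> \<rho>) \<longlonglongrightarrow> x0"
      using seq_compactE[OF compact_imp_seq_compact[OF compact_standard_simplex[of n]] allI[OF x(1)]] .
    let ?seq = "\<lambda>r. (c (\<rho> r + R))(k := s (\<rho> r))" and ?lim = "c0(k := sqrt (1 - y0 i))"
    have lim_s: "(\<lambda>r. s (\<rho> r)) \<longlonglongrightarrow> sqrt (1 - y0 i)"
      using LIMSEQ_subseq_LIMSEQ[OF lims x0(2)] by (simp add: o_def)
    have lim_c: "(\<lambda>r. c (\<rho> r + R)) \<longlonglongrightarrow> c0"
      using LIMSEQ_subseq_LIMSEQ[OF LIMSEQ_ignore_initial_segment[OF limc, of R] x0(2)] by (simp add: o_def)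
    have lim_y: "(\<lambda>r. y (\<rho> r + R)) \<longlonglongrightarrow> y0"
      using LIMSEQ_subseq_LIMSEQ[OF LIMSEQ_ignore_initial_segment[OF limy, of R] x0(2)] by (simp add: o_def)
    have lim_x: "(\<lambda>r. x (\<rho> r)) \<longlonglongrightarrow> x0"
      using x0(3) by (simp add: o_def)
    have lim_cs: "?seq \<longlonglongrightarrow> ?lim"
      using continuous_on_tendsto_compose[OF continuous_on_fun_upd[of UNIV k] tendsto_Pair[OF lim_c lim_s]] by simp
    note s0 = root[OF l0(2) i(2)]
    note c0 = cube[OF l0(3) s0(1,2)]
    have "(\<lambda>r. kihara_map i (x (\<rho> r), (s (\<rho> r))\<^sup>2)) \<longlonglongrightarrow> kihara_map i (x0, 1 - y0 i)"
    proof -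
      have "(\<lambda>r. (x (\<rho> r), (s (\<rho> r))\<^sup>2)) \<longlonglongrightarrow> (x0, (sqrt (1 - y0 i))\<^sup>2)"
        by (intro tendsto_Pair lim_x tendsto_power lim_s)
      from continuous_on_tendsto_compose[OF continuous_kihara_map[of UNIV i] this] show ?thesis
        unfolding s0(3) by simp
    qed
    moreover have "(\<lambda>r. kihara_map i (x (\<rho> r), (s (\<rho> r))\<^sup>2)) = (\<lambda>r. y (\<rho> r + R))"
      by (rule ext) (simp only: s(3) x(2)[symmetric])
    ultimately have "(\<lambda>r. y (\<rho> r + R)) \<longlonglongrightarrow> kihara_map i (x0, 1 - y0 i)"
      by (simp only:)
    then have y0_eq: "kihara_map i (x0, 1 - y0 i) = y0"
      by (rule LIMSEQ_unique[OF _ lim_y])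
    let ?g = "\<lambda>(x, c). f (kihara_map i (x, (c k)\<^sup>2), c(k := 0))"
    let ?W = "standard_simplex n \<times> open_cube (Suc k)"
    have "closedin (top_of_set ?W) {w \<in> topspace (top_of_set ?W). ?g w \<in> C}"
      by (rule closedin_continuous_map_preimage[OF faces[OF i(1)] C])
    then have cl: "closedin (top_of_set ?W) {w \<in> ?W. ?g w \<in> C}" by simp
    have seq: "(x (\<rho> r), ?seq r) \<in> {w \<in> ?W. ?g w \<in> C}" for r
      using yc(3)[of "\<rho> r + R"]
      by (simp only: mem_Collect_eq mem_Sigma_iff prod.case fun_upd_same s(3) x(2)[symmetric]
          cube[OF yc(2) s(1,2)] x(1) simp_thms)
    have "(\<lambda>r. (x (\<rho> r), ?seq r)) \<longlonglongrightarrow> (x0, ?lim)"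
      by (rule tendsto_Pair[OF lim_x lim_cs])
    moreover have "(x0, ?lim) \<in> ?W" using x0(1) c0(1) by (rule SigmaI)
    ultimately have "(x0, ?lim) \<in> {w \<in> ?W. ?g w \<in> C}"
      using closedin_sequentiallyD[OF cl seq] by (simp only:)
    then have "f (y0, c0) \<in> C"
      by (simp only: mem_Collect_eq prod.case fun_upd_same s0(3) y0_eq c0(2) simp_thms)
    then show ?thesis using l0 by simp
  qed
  show "closedin (top_of_set ?Z) ?D"
  proof (rule closedin_sequentiallyI)
    show "?D \<subseteq> ?Z" by auto
  qed (rule limit)
qed

text \<open>
  A plot of the face and a smooth map to the cube combine to a plot of the simplex by
  \<open>kihara_plot\<close>, so the induction hypothesis applies to the maps that
  \<open>continuous_by_faces\<close> asks for.
\<close>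

lemma continuous_if_continuous_on_plots:
  fixes f :: "(nat \<Rightarrow> real) \<times> (nat \<Rightarrow> real) \<Rightarrow> 'y"
  assumes "\<And>m U q b. plot (std_simplex n) m U q \<Longrightarrow> b \<in> U \<rightarrow> open_cube k \<Longrightarrow> \<forall>i. Cinf_on m U (\<lambda>u. b u i) \<Longrightarrow>
     continuous_map (subtopology (Euclidean_space m) U) Y (\<lambda>u. f (q u, b u))"
  shows "continuous_map (top_of_set (standard_simplex n \<times> open_cube k)) Y f"
  using assms
proof (induction n arbitrary: k f)
  case 0
  let ?e = "\<lambda>j. if j = 0 then 1 else 0 :: real"
  have "plot (std_simplex 0) k (open_cube k) (\<lambda>_. ?e)"
    unfolding std_simplex.simps subspace_diff_def euclid_def diffsp.sel standard_simplex_0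
    by (auto intro!: openin_open_cube Cinf_on_const)
  then have "continuous_map (subtopology (Euclidean_space k) (open_cube k)) Y (\<lambda>u. f (?e, u))"
    by (rule "0.prems") (auto intro!: Cinf_on_coordinate openin_open_cube)
  then have 1: "continuous_map (top_of_set (open_cube k)) Y (\<lambda>u. f (?e, u))"
    by (simp only: continuous_map_subtopology_Euclidean_space[OF openin_open_cube])
  have 2: "continuous_map (top_of_set (standard_simplex 0 \<times> open_cube k)) (top_of_set (open_cube k)) snd"
    by (auto intro!: continuous_on_snd continuous_on_id)
  show ?case
    by (rule continuous_map_eq[OF continuous_map_compose[OF 2 1]]) (auto simp: standard_simplex_0)
next
  case (Suc n)
  show ?case
  proof (rule continuous_by_faces, rule Suc.IH)
    fix i m U q and b :: "(nat \<Rightarrow> real) \<Rightarrow> nat \<Rightarrow> real"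
    assume i: "i \<le> Suc n" and q: "plot (std_simplex n) m U q" and b: "b \<in> U \<rightarrow> open_cube (Suc k)"
      and smooth: "\<forall>i. Cinf_on m U (\<lambda>u. b u i)"
    have U: "openin (Euclidean_space m) U" by (rule plot_std_simplex_open[OF q])
    have bk: "(b u k)\<^sup>2 \<in> {0..<1}" if "u \<in> U" for u
    proof -
      have "\<bar>b u k\<bar> < 1" using b that by (auto simp: open_cube_def Pi_iff)
      then show ?thesis by (simp add: abs_square_less_1)
    qed
    have "Cinf_on m U (\<lambda>u. (b u k)\<^sup>2)"
      unfolding power2_eq_square by (intro Cinf_on_mult spec[OF smooth])
    then have "plot (std_simplex (Suc n)) m U (\<lambda>u. kihara_map i (q u, (b u k)\<^sup>2))"
      using bk by (intro kihara_plot[OF q _ _ i]) auto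
    moreover have "(\<lambda>u. (b u)(k := 0)) \<in> U \<rightarrow> open_cube k"
      using b by (auto simp: open_cube_def Pi_iff)
    moreover have "\<forall>i. Cinf_on m U (\<lambda>u. ((b u)(k := 0)) i)"
    proof
      fix j
      show "Cinf_on m U (\<lambda>u. ((b u)(k := 0)) j)"
      proof (cases "j = k")
        case True
        then have "(\<lambda>u. ((b u)(k := 0)) j) = (\<lambda>u. 0)" by auto
        then show ?thesis using Cinf_on_const[OF U] by (simp only:)
      next
        case False
        then have "(\<lambda>u. ((b u)(k := 0)) j) = (\<lambda>u. b u j)" by auto
        then show ?thesis using smooth by (simp only:)
      qed
    qed
    ultimately have "continuous_map (subtopology (Euclidean_space m) U) Y (\<lambda>u. f (kihara_map i (q u, (b u k)\<^sup>2), (b u)(k := 0)))"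
      by (rule Suc.prems)
    then show "continuous_map (subtopology (Euclidean_space m) U) Y
        (\<lambda>u. case (q u, b u) of (x, c) \<Rightarrow> f (kihara_map i (x, (c k)\<^sup>2), c(k := 0)))"
      by (simp only: prod.case)
  qed
qed

text \<open>
  A plot of [0, 1] cannot pass through an end point with non-zero speed. Near 0 the substitution
  \<open>t = r\<^sup>2\<close>, and near 1 the substitution \<open>t = 1 - r\<^sup>2\<close>,
  express the interval through an open cube of dimension 1.
\<close>

lemma continuous_on_simplex_times_interval:
  fixes f :: "(nat \<Rightarrow> real) \<times> real \<Rightarrow> 'y"
  assumes f: "\<And>m U p. plot (prod_diff (std_simplex n) unit_interval) m U p \<Longrightarrow>
     continuous_map (subtopology (Euclidean_space m) U) Y (f \<circ> p)"
  shows "continuous_map (top_of_set (standard_simplex n \<times> {0..1})) Y f"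
proof (rule continuous_map_locally)
  have cube: "\<bar>c 0\<bar> < 1" "(c 0)\<^sup>2 < 1" if "c \<in> open_cube 1" for c
    using that by (auto simp: open_cube_def abs_square_less_1)
  have param: "continuous_map (top_of_set (standard_simplex n \<times> open_cube 1)) Y (\<lambda>(x, c). f (x, \<tau> (c 0)))"
    if \<tau>: "\<And>r. \<bar>r\<bar> < 1 \<Longrightarrow> \<tau> r \<in> {0..1}" "\<And>m U b. Cinf_on m U b \<Longrightarrow> Cinf_on m U (\<lambda>u. \<tau> (b u))" for \<tau>
  proof (rule continuous_if_continuous_on_plots)
    fix m U q and b :: "(nat \<Rightarrow> real) \<Rightarrow> nat \<Rightarrow> real"
    assume q: "plot (std_simplex n) m U q" and b: "b \<in> U \<rightarrow> open_cube 1" and smooth: "\<forall>i. Cinf_on m U (\<lambda>u. b u i)"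
    have "\<tau> (b u 0) \<in> {0..1}" if "u \<in> U" for u
      by (rule \<tau>(1)[OF cube(1)]) (use b that in blast)
    then have "plot (prod_diff (std_simplex n) unit_interval) m U (\<lambda>u. (q u, \<tau> (b u 0)))"
      using q \<tau>(2)[OF spec[OF smooth]] by (simp add: prod_diff_def subspace_diff_def real_line_def o_def)
    from f[OF this] show "continuous_map (subtopology (Euclidean_space m) U) Y (\<lambda>u. case (q u, b u) of (x, c) \<Rightarrow> f (x, \<tau> (c 0)))"
      by (simp only: o_def prod.case)
  qed
  have square: "continuous_map (top_of_set (standard_simplex n \<times> open_cube 1)) Y (\<lambda>(x, c). f (x, (c 0)\<^sup>2))"
  proof (rule param)
    show "r\<^sup>2 \<in> {0..1}" if "\<bar>r\<bar> < 1" for r :: real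
      using that abs_square_less_1[of r] by simp
    show "Cinf_on m U (\<lambda>u. (b u)\<^sup>2)" if "Cinf_on m U b" for m U b
      unfolding power2_eq_square by (intro Cinf_on_mult that)
  qed
  have cosquare: "continuous_map (top_of_set (standard_simplex n \<times> open_cube 1)) Y (\<lambda>(x, c). f (x, 1 - (c 0)\<^sup>2))"
  proof (rule param)
    show "1 - r\<^sup>2 \<in> {0..1}" if "\<bar>r\<bar> < 1" for r :: real
      using that abs_square_less_1[of r] by simp
    show "Cinf_on m U (\<lambda>u. 1 - (b u)\<^sup>2)" if "Cinf_on m U b" for m U b
      unfolding power2_eq_square using that by (intro Cinf_on_diff Cinf_on_const Cinf_on_mult that) (auto simp: Cinf_on_def)
  qed
  \<comment> \<open>Going back along a continuous section \<open>\<sigma>\<close> of the substitution \<open>\<tau>\<close>.\<close>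
  have descend: "continuous_map (top_of_set (standard_simplex n \<times> J)) Y f"
    if J: "\<And>t. t \<in> J \<Longrightarrow> \<sigma> t \<in> {0..<1}" "\<And>t. t \<in> J \<Longrightarrow> \<tau> (\<sigma> t) = t" "continuous_on UNIV \<sigma>"
      and g: "continuous_map (top_of_set (standard_simplex n \<times> open_cube 1)) Y (\<lambda>(x, c). f (x, \<tau> (c 0)))"
    for J :: "real set" and \<sigma> \<tau> :: "real \<Rightarrow> real"
  proof -
    let ?j = "\<lambda>z. (fst z, \<lambda>i::nat. if i = 0 then \<sigma> (snd z) else 0)"
    have "continuous_on (standard_simplex n \<times> J) (\<lambda>z. \<lambda>i::nat. if i = 0 then \<sigma> (snd z) else 0)"
    proof (rule continuous_on_coordinatewise_then_product)
      fix i :: nat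
      have "continuous_on (standard_simplex n \<times> J) (\<lambda>z. \<sigma> (snd z))"
        by (rule continuous_on_compose2[OF J(3) continuous_on_snd[OF continuous_on_id]]) simp
      then show "continuous_on (standard_simplex n \<times> J) (\<lambda>z. if i = 0 then \<sigma> (snd z) else 0)"
        by (cases "i = 0") simp_all
    qed
    then have "continuous_on (standard_simplex n \<times> J) ?j"
      by (intro continuous_on_Pair continuous_on_fst continuous_on_id)
    moreover have "?j \<in> standard_simplex n \<times> J \<rightarrow> standard_simplex n \<times> open_cube 1"
      using J(1) by (auto simp: open_cube_def)
    ultimately have "continuous_map (top_of_set (standard_simplex n \<times> J)) (top_of_set (standard_simplex n \<times> open_cube 1)) ?j"
      by auto
    from continuous_map_compose[OF this g] show ?thesis
      by (rule continuous_map_eq) (auto simp: J(2))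
  qed
  fix z assume "z \<in> topspace (top_of_set (standard_simplex n \<times> {0..1::real}))"
  then obtain x t where z: "z = (x, t)" "x \<in> standard_simplex n" "t \<in> {0..1}" by auto
  have open_J: "openin (top_of_set (standard_simplex n \<times> {0..1})) (standard_simplex n \<times> J)"
    if "openin (top_of_set {0..1}) J" for J :: "real set"
    using openin_Times[OF openin_subtopology_self that] by blast
  have sub: "subtopology (top_of_set (standard_simplex n \<times> {0..1})) (standard_simplex n \<times> J) = top_of_set (standard_simplex n \<times> J)"
    if "J \<subseteq> {0..1}" for J :: "real set"
    using that by (intro subtopology_Int_local) auto
  consider "t < 1" | "t > 0" by linarith
  then show "\<exists>W. openin (top_of_set (standard_simplex n \<times> {0..1})) W \<and> z \<in> W \<and>
      continuous_map (subtopology (top_of_set (standard_simplex n \<times> {0..1})) W) Y f"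
  proof cases
    case 1
    have "openin (top_of_set {0..1}) {0..<1::real}"
      unfolding openin_open by (intro exI[of _ "{..<1}"]) auto
    moreover have "continuous_map (top_of_set (standard_simplex n \<times> {0..<1})) Y f"
      by (rule descend[where \<sigma> = sqrt and \<tau> = "\<lambda>r. r\<^sup>2", OF _ _ _ square]) (auto intro!: continuous_intros)
    moreover have "{0..<1} \<subseteq> {0..1::real}" by auto
    moreover have "z \<in> standard_simplex n \<times> {0..<1}" using 1 z by auto
    ultimately show ?thesis
      by (intro exI[of _ "standard_simplex n \<times> {0..<1}"]) (simp only: sub open_J simp_thms)
  next
    case 2
    have "openin (top_of_set {0..1}) {0<..1::real}"
      unfolding openin_open by (intro exI[of _ "{0<..}"]) auto
    moreover have "continuous_map (top_of_set (standard_simplex n \<times> {0<..1})) Y f"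
      by (rule descend[where \<sigma> = "\<lambda>t. sqrt (1 - t)" and \<tau> = "\<lambda>r. 1 - r\<^sup>2", OF _ _ _ cosquare]) (auto intro!: continuous_intros)
    moreover have "{0<..1} \<subseteq> {0..1::real}" by auto
    moreover have "z \<in> standard_simplex n \<times> {0<..1}" using 2 z by auto
    ultimately show ?thesis
      by (intro exI[of _ "standard_simplex n \<times> {0<..1}"]) (simp only: sub open_J simp_thms)
  qed
qed

section \<open>Twisted paths and loops\<close>

lemma pts_unit_interval: "pts unit_interval = {0..1}"
  by (simp add: subspace_diff_def real_line_def)

lemma plot_unit_interval: "plot unit_interval k U t \<longleftrightarrow> Cinf_on k U t \<and> t \<in> U \<rightarrow> {0..1}"
  by (simp add: subspace_diff_def real_line_def)

abbreviation param_diff :: "nat \<Rightarrow> (nat \<Rightarrow> real) set \<Rightarrow> ((nat \<Rightarrow> real) \<times> real) diffsp" where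
  "param_diff m U \<equiv> prod_diff (subspace_diff (euclid m) U) unit_interval"

lemma plot_param:
  "plot (param_diff m U) k V p \<longleftrightarrow> openin (Euclidean_space k) V \<and>
     (\<forall>w\<in>V. fst (p w) \<in> topspace (Euclidean_space m) \<and> fst (p w) \<in> U \<and> snd (p w) \<in> {0..1}) \<and>
     (\<forall>i<m. Cinf_on k V (\<lambda>w. fst (p w) i)) \<and> Cinf_on k V (\<lambda>w. snd (p w))"
  by (auto simp: prod_diff_def subspace_diff_def euclid_def real_line_def Pi_iff o_def)

lemma plot_param_id:
  assumes U: "openin (Euclidean_space m) U" and t: "Cinf_on m U t" "\<And>u. u \<in> U \<Longrightarrow> t u \<in> {0..1}"
  shows "plot (param_diff m U) m U (\<lambda>u. (u, t u))"
  unfolding plot_param fst_conv snd_conv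
  using openin_subset[OF U] t by (intro conjI U ballI allI impI Cinf_on_coordinate) auto

lemma plot_param_restrict:
  assumes p: "plot (param_diff m U) k V p" and W: "openin (Euclidean_space k) W" "W \<subseteq> V"
    and U': "\<And>w. w \<in> W \<Longrightarrow> fst (p w) \<in> U'"
  shows "plot (param_diff m U') k W p"
  using p unfolding plot_param
  by (intro conjI W(1)) (use W U' in \<open>auto intro: Cinf_on_subset[OF _ W]\<close>)

lemma pts_param: "openin (Euclidean_space m) U \<Longrightarrow> pts (param_diff m U) = U \<times> {0..1}"
  using openin_subset[of "Euclidean_space m" U]
  by (auto simp: prod_diff_def subspace_diff_def euclid_def real_line_def)

lemma plot_param_continuous:
  assumes p: "plot (param_diff m U) k V p"
  shows "continuous_on V (\<lambda>w. fst (p w))" "continuous_on V (\<lambda>w. snd (p w))"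
proof -
  have "plot (euclid m) k V (\<lambda>w. fst (p w))"
    using p unfolding plot_param by (simp add: euclid_def Pi_iff)
  then show "continuous_on V (\<lambda>w. fst (p w))"
    by (rule plot_euclid_continuous)
  show "continuous_on V (\<lambda>w. snd (p w))"
    using p unfolding plot_param by (intro Cinf_on_continuous_on[of k]) blast
qed

lemma pts_map_diff: "pts (map_diff D E) = {\<gamma> \<in> extensional (pts D). smooth D E \<gamma>}"
  by (simp add: map_diff_def Let_def)

lemma smooth_mem: "smooth D E f \<Longrightarrow> x \<in> pts D \<Longrightarrow> f x \<in> pts E"
  by (auto simp: smooth_def)

lemma plot_map_diff_iff:
  "plot (map_diff unit_interval E) m U P \<longleftrightarrow>
     openin (Euclidean_space m) U \<and> (\<forall>u\<in>U. P u \<in> pts (map_diff unit_interval E)) \<and>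
     (\<forall>k V p. plot (param_diff m U) k V p \<longrightarrow> plot E k V (\<lambda>w. P (fst (p w)) (snd (p w))))"
proof -
  have "smooth (param_diff m U) E (\<lambda>(u, x). P u x) \<longleftrightarrow>
      (\<forall>k V p. plot (param_diff m U) k V p \<longrightarrow> plot E k V (\<lambda>w. P (fst (p w)) (snd (p w))))"
    if U: "openin (Euclidean_space m) U" and P: "\<forall>u\<in>U. P u \<in> pts (map_diff unit_interval E)"
  proof -
    have "P u t \<in> pts E" if "u \<in> U" "t \<in> {0..1}" for u t
      using P that by (auto simp: pts_map_diff pts_unit_interval intro: smooth_mem)
    then have "(\<lambda>(u, x). P u x) \<in> pts (param_diff m U) \<rightarrow> pts E"
      unfolding pts_param[OF U] by auto
    then show ?thesis
      by (simp add: smooth_def o_def case_prod_unfold)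
  qed
  then show ?thesis
    by (auto simp: map_diff_def Let_def)
qed

lemma plot_manifold_cong:
  assumes "plot (manifold_diff M \<A>) k U p" "\<And>u. u \<in> U \<Longrightarrow> p u = q u"
  shows "plot (manifold_diff M \<A>) k U q"
proof (rule plot_manifold_local[OF plot_manifold_open[OF assms(1)]])
  fix u assume "u \<in> U"
  then show "\<exists>W p. openin (Euclidean_space k) W \<and> u \<in> W \<and> W \<subseteq> U \<and> plot (manifold_diff M \<A>) k W p \<and> (\<forall>w\<in>W. q w = p w)"
    using plot_manifold_open[OF assms(1)] assms by (intro exI[of _ U] exI[of _ p]) simp
qed

context manifold_action
begin

interpretation G: group G by (rule group)

abbreviation "PG \<equiv> PG_space G act M"
abbreviation "LN \<equiv> loop_space N"
abbreviation "ptilde \<equiv> p_tilde G act"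

lemma pts_twisted:
  "\<gamma> \<in> pts (twisted_paths act M g) \<longleftrightarrow> \<gamma> \<in> extensional {0..1} \<and> smooth unit_interval M \<gamma> \<and> \<gamma> 1 = act g (\<gamma> 0)"
  by (simp add: twisted_paths_def subspace_diff_def pts_map_diff[unfolded subspace_diff_def] real_line_def)

lemma pts_PG: "z \<in> pts PG \<longleftrightarrow> snd z \<in> carrier G \<and> fst z \<in> pts (twisted_paths act M (snd z))"
  by (cases z) (simp add: PG_space_def coprod_diff_def final_diff_def)

lemma pts_LN:
  "\<gamma> \<in> pts LN \<longleftrightarrow> \<gamma> \<in> extensional {0..1} \<and> smooth unit_interval N \<gamma> \<and> \<gamma> 0 = \<gamma> 1"
  by (simp add: loop_space_def subspace_diff_def pts_map_diff[unfolded subspace_diff_def] real_line_def)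

lemma PG_mem:
  assumes "z \<in> pts PG"
  shows "snd z \<in> carrier G" "fst z \<in> extensional {0..1}" "smooth unit_interval M (fst z)"
    "fst z 1 = act (snd z) (fst z 0)" "\<And>t. t \<in> {0..1} \<Longrightarrow> fst z t \<in> topspace T"
proof -
  show "snd z \<in> carrier G" "fst z \<in> extensional {0..1}" and s: "smooth unit_interval M (fst z)"
    and "fst z 1 = act (snd z) (fst z 0)"
    using assms unfolding pts_PG pts_twisted by blast+
  show "fst z t \<in> topspace T" if "t \<in> {0..1}" for t
    using smooth_mem[OF s] that by (simp only: pts_unit_interval pts_manifold_diff)
qed

lemma plot_twisted_iff:
  "plot (twisted_paths act M g) m U P \<longleftrightarrow>
     openin (Euclidean_space m) U \<and> (\<forall>u\<in>U. P u \<in> pts (twisted_paths act M g)) \<and>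
     (\<forall>k V p. plot (param_diff m U) k V p \<longrightarrow> plot M k V (\<lambda>w. P (fst (p w)) (snd (p w))))"
proof -
  have 1: "plot (twisted_paths act M g) m U P \<longleftrightarrow> plot (map_diff unit_interval M) m U P \<and> (\<forall>u\<in>U. P u 1 = act g (P u 0))"
    by (simp add: twisted_paths_def subspace_diff_def[of "map_diff _ _"] Pi_iff)
  have 2: "pts (twisted_paths act M g) = pts (map_diff unit_interval M) \<inter> {\<gamma>. \<gamma> 1 = act g (\<gamma> 0)}"
    by (simp add: twisted_paths_def subspace_diff_def[of "map_diff _ _"])
  show ?thesis
    unfolding 1 2 plot_map_diff_iff by blast
qed

lemma plot_LN_iff:
  "plot LN m U P \<longleftrightarrow>
     openin (Euclidean_space m) U \<and> (\<forall>u\<in>U. P u \<in> pts LN) \<and>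
     (\<forall>k V p. plot (param_diff m U) k V p \<longrightarrow> plot N k V (\<lambda>w. P (fst (p w)) (snd (p w))))"
proof -
  have 1: "plot LN m U P \<longleftrightarrow> plot (map_diff unit_interval N) m U P \<and> (\<forall>u\<in>U. P u 0 = P u 1)"
    by (simp add: loop_space_def subspace_diff_def[of "map_diff _ _"] Pi_iff)
  have 2: "pts LN = pts (map_diff unit_interval N) \<inter> {\<gamma>. \<gamma> 0 = \<gamma> 1}"
    by (simp add: loop_space_def subspace_diff_def[of "map_diff _ _"])
  show ?thesis
    unfolding 1 2 plot_map_diff_iff by blast
qed

lemma plot_PG_iff:
  "plot PG m U P \<longleftrightarrow> openin (Euclidean_space m) U \<and> (\<forall>u\<in>U. P u \<in> pts PG) \<and>
     (\<forall>u\<in>U. \<exists>W. openin (Euclidean_space m) W \<and> u \<in> W \<and> W \<subseteq> U \<and>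
        ((\<exists>b. \<forall>w\<in>W. P w = b) \<or>
         (\<exists>g\<in>carrier G. \<exists>q. plot (twisted_paths act M g) m W q \<and> (\<forall>w\<in>W. P w = (q w, g)))))"
  by (simp add: PG_space_def coprod_diff_def final_diff_def Pi_iff)

text \<open>
  Locally a plot of the coproduct stays in one component. Where it is constant, evaluation at
  the parameter is the composite of one smooth path with a plot of the interval.
\<close>

lemma plot_PG_evaluate:
  assumes P: "plot PG m U P" and p: "plot (param_diff m U) k V p"
  shows "plot M k V (\<lambda>w. fst (P (fst (p w))) (snd (p w)))"
proof (rule plot_manifold_local)
  show V: "openin (Euclidean_space k) V"
    using p unfolding plot_param by blast
  have pm: "fst (p w) \<in> U" "snd (p w) \<in> {0..1}" if "w \<in> V" for w
    using p that unfolding plot_param by blast+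
  fix w0 assume w0: "w0 \<in> V"
  have "\<exists>W. openin (Euclidean_space m) W \<and> fst (p w0) \<in> W \<and> W \<subseteq> U \<and>
        ((\<exists>b. \<forall>w\<in>W. P w = b) \<or>
         (\<exists>g\<in>carrier G. \<exists>q. plot (twisted_paths act M g) m W q \<and> (\<forall>w\<in>W. P w = (q w, g))))"
    by (rule bspec[OF P[unfolded plot_PG_iff, THEN conjunct2, THEN conjunct2] pm(1)[OF w0]])
  then obtain W where W: "openin (Euclidean_space m) W" "fst (p w0) \<in> W" "W \<subseteq> U"
    "(\<exists>b. \<forall>w\<in>W. P w = b) \<or> (\<exists>g\<in>carrier G. \<exists>q. plot (twisted_paths act M g) m W q \<and> (\<forall>w\<in>W. P w = (q w, g)))"
    by (elim exE conjE)
  let ?W = "{w \<in> V. fst (p w) \<in> W}"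
  have cont: "continuous_map (subtopology (Euclidean_space k) V) (Euclidean_space m) (\<lambda>w. fst (p w))"
    unfolding continuous_map_subtopology_Euclidean_space[OF V] Euclidean_space_eq_top_of_set[of m]
    using plot_param_continuous(1)[OF p] p unfolding plot_param by auto
  have top: "topspace (subtopology (Euclidean_space k) V) = V"
    using openin_subset[OF V] by (simp add: inf.absorb2)
  have "openin (subtopology (Euclidean_space k) V) ?W"
    using openin_continuous_map_preimage[OF cont W(1)] unfolding top .
  then have oW: "openin (Euclidean_space k) ?W"
    using V openin_trans_full by blast
  have WV: "?W \<subseteq> V" by blast
  have pW: "plot (param_diff m W) k ?W p"
    by (rule plot_param_restrict[OF p oW WV]) blast
  have t: "Cinf_on k ?W (\<lambda>w. snd (p w))"
    using pW unfolding plot_param by blast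
  from W(4) have "plot M k ?W (\<lambda>w. fst (P (fst (p w))) (snd (p w)))"
  proof (elim disjE exE bexE conjE)
    fix b assume b: "\<forall>w\<in>W. P w = b"
    have "P (fst (p w0)) \<in> pts PG"
      using P pm(1)[OF w0] unfolding plot_PG_iff by blast
    then have "b \<in> pts PG" using b W(2) by simp
    then have "smooth unit_interval M (fst b)" by (rule PG_mem(3))
    moreover have "plot unit_interval k ?W (\<lambda>w. snd (p w))"
      unfolding plot_unit_interval using t pm(2) by blast
    ultimately have "plot M k ?W (fst b \<circ> (\<lambda>w. snd (p w)))"
      unfolding smooth_def by blast
    then show ?thesis
      by (rule plot_manifold_cong) (simp add: b)
  next
    fix g q assume q: "plot (twisted_paths act M g) m W q" and eq: "\<forall>w\<in>W. P w = (q w, g)"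
    have "plot M k ?W (\<lambda>w. q (fst (p w)) (snd (p w)))"
      using q pW unfolding plot_twisted_iff by blast
    then show ?thesis
      by (rule plot_manifold_cong) (simp add: eq)
  qed
  then show "\<exists>W q. openin (Euclidean_space k) W \<and> w0 \<in> W \<and> W \<subseteq> V \<and> plot M k W q \<and>
      (\<forall>w\<in>W. fst (P (fst (p w))) (snd (p w)) = q w)"
    using oW W(2) w0 WV by (intro exI[of _ ?W] exI[of _ "\<lambda>w. fst (P (fst (p w))) (snd (p w))"] conjI) auto
qed

lemma ptilde_apply: "ptilde z = compose {0..1} orb (fst z)"
  by (simp add: p_tilde_def case_prod_unfold)

lemma ptilde_eval: "t \<in> {0..1} \<Longrightarrow> ptilde z t = orb (fst z t)"
  by (simp add: ptilde_apply compose_def)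

lemma ptilde_mem:
  assumes z: "z \<in> pts PG"
  shows "ptilde z \<in> pts LN"
proof -
  have "smooth unit_interval N (ptilde z)"
    unfolding smooth_def
  proof (intro conjI allI impI)
    show "ptilde z \<in> pts unit_interval \<rightarrow> pts N"
      unfolding pts_unit_interval using smooth_mem[OF smooth_orb] PG_mem(5)[OF z]
      by (simp add: ptilde_eval pts_manifold_diff)
    fix k U t assume t: "plot unit_interval k U t"
    have "plot M k U (fst z \<circ> t)"
      using PG_mem(3)[OF z] t unfolding smooth_def by blast
    then have "plot N k U (orb \<circ> (fst z \<circ> t))"
      using smooth_orb unfolding smooth_def by blast
    then show "plot N k U (ptilde z \<circ> t)"
      unfolding quotient_diff_def
      by (rule plot_manifold_cong) (use t in \<open>auto simp: plot_unit_interval ptilde_eval Pi_iff\<close>)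
  qed
  moreover have "ptilde z 0 = ptilde z 1"
    using PG_mem[OF z] by (simp add: ptilde_eval orb_act)
  moreover have "ptilde z \<in> extensional {0..1}"
    by (simp add: ptilde_apply)
  ultimately show ?thesis
    unfolding pts_LN by blast
qed

lemma smooth_ptilde: "smooth PG LN ptilde"
  unfolding smooth_def
proof (intro conjI allI impI)
  show "ptilde \<in> pts PG \<rightarrow> pts LN" using ptilde_mem by blast
  fix m U P assume P: "plot PG m U P"
  show "plot LN m U (ptilde \<circ> P)"
    unfolding plot_LN_iff
  proof (intro conjI allI impI ballI)
    show "openin (Euclidean_space m) U" using P unfolding plot_PG_iff by blast
    show "(ptilde \<circ> P) u \<in> pts LN" if "u \<in> U" for u
      using P that ptilde_mem unfolding plot_PG_iff by simp
    fix k V p assume p: "plot (param_diff m U) k V p"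
    have "plot N k V (orb \<circ> (\<lambda>w. fst (P (fst (p w))) (snd (p w))))"
      using smooth_orb plot_PG_evaluate[OF P p] unfolding smooth_def by blast
    then show "plot N k V (\<lambda>w. (ptilde \<circ> P) (fst (p w)) (snd (p w)))"
      unfolding quotient_diff_def
      by (rule plot_manifold_cong) (use p in \<open>auto simp: plot_param ptilde_eval\<close>)
  qed
qed

section \<open>Lifting smooth simplices of loops\<close>

lemma plot_LN_evaluate:
  assumes "plot LN m U P" "Cinf_on m U t" "\<And>u. u \<in> U \<Longrightarrow> t u \<in> {0..1}"
  shows "plot N m U (\<lambda>u. P u (t u))"
proof -
  have U: "openin (Euclidean_space m) U" using assms(1) unfolding plot_LN_iff by blast
  have "plot N m U (\<lambda>w. P (fst ((\<lambda>u. (u, t u)) w)) (snd ((\<lambda>u. (u, t u)) w)))"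
    using assms(1) plot_param_id[OF U assms(2,3)] unfolding plot_LN_iff by blast
  then show ?thesis by simp
qed

lemma plot_simplex_interval:
  assumes "plot (prod_diff (std_simplex n) unit_interval) m U p"
  shows "plot (std_simplex n) m U (\<lambda>u. fst (p u))" "Cinf_on m U (\<lambda>u. snd (p u))" "\<And>u. u \<in> U \<Longrightarrow> snd (p u) \<in> {0..1}"
  using assms by (auto simp: prod_diff_def plot_unit_interval o_def Pi_iff)

lemma sing_plot:
  assumes "s \<in> sing D n" "plot (std_simplex n) m U q"
  shows "plot D m U (\<lambda>u. s (q u))"
  using assms unfolding sing_def smooth_def o_def by blast

lemma continuous_adjoint_LN:
  assumes s: "s \<in> sing LN n"
  shows "continuous_map (top_of_set (standard_simplex n \<times> {0..1})) quotient_top (\<lambda>(x, t). s x t)"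
proof (rule continuous_on_simplex_times_interval)
  fix m U p assume p: "plot (prod_diff (std_simplex n) unit_interval) m U p"
  note p' = plot_simplex_interval[OF p]
  have "plot N m U (\<lambda>u. s (fst (p u)) (snd (p u)))"
    by (rule plot_LN_evaluate[OF sing_plot[OF s p'(1)] p'(2,3)])
  then show "continuous_map (subtopology (Euclidean_space m) U) quotient_top ((\<lambda>(x, t). s x t) \<circ> p)"
    using plot_N_continuous by (simp only: o_def case_prod_unfold)
qed

text \<open>
  Evaluating along a plot of the simplex times the interval gives a plot of M, which is
  continuous.
\<close>

lemma continuous_adjoint_PG:
  assumes s: "s \<in> sing PG n"
  shows "continuous_map (top_of_set (standard_simplex n \<times> {0..1})) T (\<lambda>(x, t). fst (s x) t)"
proof (rule continuous_on_simplex_times_interval)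
  fix m U p assume p: "plot (prod_diff (std_simplex n) unit_interval) m U p"
  note p' = plot_simplex_interval[OF p]
  have U: "openin (Euclidean_space m) U" by (rule plot_std_simplex_open[OF p'(1)])
  have "plot M m U (\<lambda>w. fst (s (fst (p (fst (w, snd (p w)))))) (snd (w, snd (p w))))"
    by (rule plot_PG_evaluate[OF sing_plot[OF s p'(1)] plot_param_id[OF U p'(2,3)]])
  then have "plot M m U (\<lambda>u. fst (s (fst (p u))) (snd (p u)))"
    by (simp only: fst_conv snd_conv)
  then show "continuous_map (subtopology (Euclidean_space m) U) T ((\<lambda>(x, t). fst (s x) t) \<circ> p)"
    using plot_M_continuous by (simp only: o_def case_prod_unfold)
qed

lemma connected_standard_simplex: "connected_space (top_of_set (standard_simplex n))"
  using connectedin_standard_simplex[of n] by (simp add: euclidean_product_topology connectedin_def)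

lemma connected_simplex_times_interval: "connected_space (top_of_set (standard_simplex n \<times> {0..1::real}))"
proof -
  have "connected (standard_simplex n)"
    using connectedin_standard_simplex[of n] by (simp add: euclidean_product_topology connectedin_iff_connected)
  then have "connected (standard_simplex n \<times> {0..1::real})"
    by (rule connected_Times) (rule connected_Icc)
  then show ?thesis
    by (simp add: connectedin_iff_connected[symmetric] connectedin_def)
qed

text \<open>The path determines the group element, because the action is free.\<close>

lemma PG_eqI:
  assumes z: "z \<in> pts PG" "z' \<in> pts PG" and eq: "\<And>r. r \<in> {0..1} \<Longrightarrow> fst z r = fst z' r"
  shows "z = z'"
proof -
  have fst_eq: "fst z = fst z'"
    using PG_mem(2)[OF z(1)] PG_mem(2)[OF z(2)] eq by (rule extensionalityI)
  have "act (snd z) (fst z 0) = act (snd z') (fst z 0)"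
    using PG_mem(4)[OF z(1)] PG_mem(4)[OF z(2)] by (simp add: fst_eq)
  then have "snd z = snd z'"
    using act_cancel[OF PG_mem(1)[OF z(1)] PG_mem(1)[OF z(2)] PG_mem(5)[OF z(1), of 0]] by simp
  with fst_eq show ?thesis by (rule prod_eqI)
qed

text \<open>
  The two ends of the lifted paths are lifts of the same map on the connected simplex, so they
  differ by one element g, and all lifted paths lie in the component of g. Smoothness is that of
  continuous lifts of plots.
\<close>

lemma lift_sing:
  assumes t: "t \<in> sing LN n" and F: "continuous_map (top_of_set (standard_simplex n \<times> {0..1})) T F"
    and lift: "\<And>x r. x \<in> standard_simplex n \<Longrightarrow> r \<in> {0..1} \<Longrightarrow> orb (F (x, r)) = t x r"
  obtains s where "s \<in> sing PG n" "compose (standard_simplex n) ptilde s = t"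
    "\<And>x r. x \<in> standard_simplex n \<Longrightarrow> r \<in> {0..1} \<Longrightarrow> fst (s x) r = F (x, r)"
proof -
  let ?Z = "standard_simplex n \<times> {0..1::real}"
  have tx: "t x \<in> pts LN" if "x \<in> standard_simplex n" for x
    using sing_mem[OF t that] .
  have along: "continuous_map (subtopology (Euclidean_space k) U) T (\<lambda>w. F (q w, \<tau> w))"
    if U: "openin (Euclidean_space k) U" and q: "continuous_on U q" "\<And>w. w \<in> U \<Longrightarrow> q w \<in> standard_simplex n"
      and \<tau>: "continuous_on U \<tau>" "\<And>w. w \<in> U \<Longrightarrow> \<tau> w \<in> {0..1}" for k U q \<tau>
  proof -
    have "continuous_on U (\<lambda>w. (q w, \<tau> w))"
      by (rule continuous_on_Pair[OF q(1) \<tau>(1)])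
    moreover have "(\<lambda>w. (q w, \<tau> w)) \<in> U \<rightarrow> ?Z" using q(2) \<tau>(2) by blast
    ultimately have "continuous_map (top_of_set U) (top_of_set ?Z) (\<lambda>w. (q w, \<tau> w))"
      by (simp only: continuous_map_subtopology_eu continuous_map_in_subtopology continuous_map_iff_continuous
          topspace_euclidean_subtopology)
    from continuous_map_compose[OF this F] show ?thesis
      by (simp only: o_def continuous_map_subtopology_Euclidean_space[OF U])
  qed
  have at_end: "continuous_map (top_of_set (standard_simplex n)) T (\<lambda>x. F (x, r))" if "r \<in> {0..1}" for r
  proof -
    have "continuous_map (top_of_set (standard_simplex n)) (top_of_set ?Z) (\<lambda>x. (x, r))"
      using that by (auto intro!: continuous_on_Pair continuous_on_id continuous_on_const)
    from continuous_map_compose[OF this F] show ?thesis by (simp only: o_def)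
  qed
  obtain e where e: "e \<in> standard_simplex n" using nonempty_standard_simplex by blast
  have ends: "orb (F (x, 0)) = orb (F (x, 1))" if "x \<in> standard_simplex n" for x
    using lift[OF that, of 0] lift[OF that, of 1] tx[OF that] by (simp add: pts_LN)
  obtain g where g: "g \<in> carrier G" "\<And>x. x \<in> standard_simplex n \<Longrightarrow> F (x, 1) = act g (F (x, 0))"
  proof (rule lifts_differ_by_translate[OF connected_standard_simplex])
    show "continuous_map (top_of_set (standard_simplex n)) T (\<lambda>x. F (x, 0))" by (rule at_end) simp
    show "continuous_map (top_of_set (standard_simplex n)) T (\<lambda>x. F (x, 1))" by (rule at_end) simp
    show "e \<in> topspace (top_of_set (standard_simplex n))" using e by simp
    show "orb (F (x, 0)) = orb (F (x, 1))" if "x \<in> topspace (top_of_set (standard_simplex n))" for x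
      using ends that by simp
    fix g assume g: "g \<in> carrier G"
      and "\<And>x. x \<in> topspace (top_of_set (standard_simplex n)) \<Longrightarrow> F (x, 1) = act g (F (x, 0))"
    then have "\<And>x. x \<in> standard_simplex n \<Longrightarrow> F (x, 1) = act g (F (x, 0))" by simp
    then show thesis by (rule that[OF g])
  qed
  define s where "s = (\<lambda>x\<in>standard_simplex n. (\<lambda>r\<in>{0..1}. F (x, r), g))"
  have s_eval: "fst (s x) r = F (x, r)" if "x \<in> standard_simplex n" "r \<in> {0..1}" for x r
    using that by (simp add: s_def)
  have s_mem: "s x \<in> pts PG" if x: "x \<in> standard_simplex n" for x
  proof -
    have "smooth unit_interval M (\<lambda>r\<in>{0..1}. F (x, r))"
      unfolding smooth_def
    proof (intro conjI allI impI)
      have "F (x, r) \<in> topspace T" if "r \<in> {0..1}" for r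
        using continuous_map_funspace[OF F] x that by auto
      then show "(\<lambda>r\<in>{0..1}. F (x, r)) \<in> pts unit_interval \<rightarrow> pts M"
        unfolding pts_unit_interval pts_manifold_diff by simp
      fix k U \<tau> assume \<tau>: "plot unit_interval k U \<tau>"
      then have \<tau>': "Cinf_on k U \<tau>" "\<And>w. w \<in> U \<Longrightarrow> \<tau> w \<in> {0..1}"
        unfolding plot_unit_interval by blast+
      have U: "openin (Euclidean_space k) U" using \<tau>'(1) by (simp add: Cinf_on_def)
      have "plot N k U (t x \<circ> \<tau>)"
        using tx[OF x] \<tau> unfolding pts_LN smooth_def by blast
      moreover have "continuous_map (subtopology (Euclidean_space k) U) T (\<lambda>w. F (x, \<tau> w))"
        by (rule along[OF U continuous_on_const x Cinf_on_continuous_on[OF \<tau>'(1)] \<tau>'(2)])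
      ultimately have "plot M k U (\<lambda>w. F (x, \<tau> w))"
        by (rule continuous_lift_of_plot) (simp add: lift[OF x \<tau>'(2)])
      then show "plot M k U ((\<lambda>r\<in>{0..1}. F (x, r)) \<circ> \<tau>)"
        by (rule plot_manifold_cong) (use \<tau>'(2) in \<open>simp add: restrict_def\<close>)
    qed
    then show ?thesis
      unfolding pts_PG pts_twisted using x g by (simp add: s_def)
  qed
  have "s \<in> sing PG n"
    unfolding sing_def smooth_def pts_std_simplex
  proof (intro CollectI conjI allI impI)
    show "s \<in> extensional (standard_simplex n)" by (simp add: s_def)
    show "s \<in> standard_simplex n \<rightarrow> pts PG" using s_mem by blast
    fix m U q assume q: "plot (std_simplex n) m U q"
    have U: "openin (Euclidean_space m) U" by (rule plot_std_simplex_open[OF q])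
    note q_mem = plot_std_simplex_mem[OF q]
    have twisted: "plot (twisted_paths act M g) m U (\<lambda>w. fst (s (q w)))"
      unfolding plot_twisted_iff
    proof (intro conjI ballI allI impI U)
      show "fst (s (q u)) \<in> pts (twisted_paths act M g)" if "u \<in> U" for u
        using s_mem[OF q_mem[OF that]] q_mem[OF that] unfolding pts_PG by (simp add: s_def)
      fix k V p assume p: "plot (param_diff m U) k V p"
      then have p': "openin (Euclidean_space k) V" "\<And>w. w \<in> V \<Longrightarrow> fst (p w) \<in> U" "\<And>w. w \<in> V \<Longrightarrow> snd (p w) \<in> {0..1}"
        unfolding plot_param by blast+
      have "plot N k V (\<lambda>w. t (q (fst (p w))) (snd (p w)))"
        using sing_plot[OF t q] p unfolding plot_LN_iff by blast
      moreover have "continuous_map (subtopology (Euclidean_space k) V) T (\<lambda>w. F (q (fst (p w)), snd (p w)))"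
      proof (rule along[OF p'(1)])
        show "continuous_on V (\<lambda>w. q (fst (p w)))"
          by (rule continuous_on_compose2[OF plot_std_simplex_continuous[OF q] plot_param_continuous(1)[OF p]])
            (use p'(2) in blast)
      qed (use q_mem p' plot_param_continuous(2)[OF p] in blast)+
      ultimately have "plot M k V (\<lambda>w. F (q (fst (p w)), snd (p w)))"
        by (rule continuous_lift_of_plot) (rule lift[OF q_mem[OF p'(2)] p'(3)])
      then show "plot M k V (\<lambda>w. fst (s (q (fst (p w)))) (snd (p w)))"
        by (rule plot_manifold_cong) (simp only: s_eval[OF q_mem[OF p'(2)] p'(3)])
    qed
    have "(s \<circ> q) w = (fst (s (q w)), g)" if "w \<in> U" for w
      using q_mem[OF that] by (simp add: s_def)
    then show "plot PG m U (s \<circ> q)"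
      unfolding plot_PG_iff
    proof (intro conjI ballI U)
      show "(s \<circ> q) u \<in> pts PG" if "u \<in> U" for u
        using s_mem[OF q_mem[OF that]] by simp
      show "\<exists>W. openin (Euclidean_space m) W \<and> u \<in> W \<and> W \<subseteq> U \<and>
        ((\<exists>b. \<forall>w\<in>W. (s \<circ> q) w = b) \<or>
         (\<exists>g\<in>carrier G. \<exists>q'. plot (twisted_paths act M g) m W q' \<and> (\<forall>w\<in>W. (s \<circ> q) w = (q' w, g))))"
        if "\<And>w. w \<in> U \<Longrightarrow> (s \<circ> q) w = (fst (s (q w)), g)" "u \<in> U" for u
        using that twisted g(1) U
        by (intro exI[of _ U] conjI disjI2 bexI[of _ g] exI[of _ "\<lambda>w. fst (s (q w))"] ballI subset_refl) assumption+
    qed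
  qed
  moreover have "compose (standard_simplex n) ptilde s = t"
  proof (rule extensionalityI[OF compose_extensional sing_extensional[OF t]])
    fix x assume x: "x \<in> standard_simplex n"
    have "ptilde (s x) = t x"
    proof (rule extensionalityI)
      show "ptilde (s x) \<in> extensional {0..1}" by (simp add: ptilde_apply)
      show "t x \<in> extensional {0..1}" using tx[OF x] unfolding pts_LN by blast
      show "ptilde (s x) r = t x r" if "r \<in> {0..1}" for r
        using that by (simp only: ptilde_eval s_eval[OF x] lift[OF x])
    qed
    then show "compose (standard_simplex n) ptilde s x = t x"
      using x by (simp add: compose_def)
  qed
  ultimately show ?thesis
    using s_eval by (rule that)
qed

text \<open>A lift is determined by its paths, so \<open>lift_sing\<close> returns s itself.\<close>

lemma sing_PG_if_continuous:
  assumes ext: "s \<in> extensional (standard_simplex n)" and mem: "\<And>x. x \<in> standard_simplex n \<Longrightarrow> s x \<in> pts PG"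
    and down: "compose (standard_simplex n) ptilde s \<in> sing LN n"
    and cont: "continuous_map (top_of_set (standard_simplex n \<times> {0..1})) T (\<lambda>(x, r). fst (s x) r)"
  shows "s \<in> sing PG n"
proof -
  have "orb ((\<lambda>(x, r). fst (s x) r) (x, r)) = compose (standard_simplex n) ptilde s x r"
    if "x \<in> standard_simplex n" "r \<in> {0..1}" for x r
    using that by (simp add: compose_def[of "standard_simplex n"] ptilde_eval)
  then obtain s' where s': "s' \<in> sing PG n"
    "\<And>x r. x \<in> standard_simplex n \<Longrightarrow> r \<in> {0..1} \<Longrightarrow> fst (s' x) r = (\<lambda>(x, r). fst (s x) r) (x, r)"
    using lift_sing[OF down cont] by metis
  have "s' = s"
  proof (rule extensionalityI[OF sing_extensional[OF s'(1)] ext])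
    fix x assume x: "x \<in> standard_simplex n"
    show "s' x = s x"
      by (rule PG_eqI[OF sing_mem[OF s'(1) x] mem[OF x]]) (use s'(2)[OF x] in simp)
  qed
  with s'(1) show ?thesis by simp
qed

lemma cylinder_top_of_set: "cylinder (top_of_set Z) a b = top_of_set (Z \<times> {a..b})"
  by (simp only: subtopology_Times subtopology_UNIV prod_topology_subtopology_eu)

text \<open>
  The product of the simplex and the interval contracts along straight lines to the vertex 0 of
  the simplex at the left end of the interval.
\<close>

lemma lift_exists:
  assumes t: "t \<in> sing LN n"
  shows "\<exists>s\<in>sing PG n. compose (standard_simplex n) ptilde s = t"
proof -
  let ?Z = "standard_simplex n \<times> {0..1::real}"
  let ?e = "\<lambda>j::nat. if j = 0 then 1 else 0 :: real"
  let ?H = "\<lambda>z. ((\<lambda>j. (1 - snd z) * ?e j + snd z * fst (fst z) j), snd z * snd (fst z))"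
  have e: "?e \<in> standard_simplex n" by simp
  have "compact_space (top_of_set ?Z)"
    using compact_Times[OF compact_standard_simplex compact_Icc, of n 0 1]
    by (simp add: compact_space_subtopology)
  moreover have "continuous_map (cylinder (top_of_set ?Z) 0 1) (top_of_set ?Z) ?H"
  proof -
    have coord: "continuous_on S (\<lambda>z :: ((nat \<Rightarrow> real) \<times> real) \<times> real. fst (fst z) j)" for S j
      using continuous_on_compose[OF continuous_on_fst[OF continuous_on_fst[OF continuous_on_id]] continuous_on_coordinate]
      by (simp add: o_def)
    have "continuous_on (?Z \<times> {0..1}) (\<lambda>z j. (1 - snd z) * ?e j + snd z * fst (fst z) j)"
      by (rule continuous_on_coordinatewise_then_product)
        (intro continuous_on_add continuous_on_mult continuous_on_diff continuous_on_const continuous_on_snd continuous_on_id coord)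
    moreover have "continuous_on (?Z \<times> {0..1}) (\<lambda>z. snd z * snd (fst z))"
      by (intro continuous_on_mult continuous_on_snd continuous_on_fst continuous_on_id)
    ultimately have "continuous_on (?Z \<times> {0..1}) ?H"
      by (rule continuous_on_Pair)
    moreover have "?H \<in> ?Z \<times> {0..1} \<rightarrow> ?Z"
    proof (rule funcsetI)
      fix z assume "z \<in> ?Z \<times> {0..1::real}"
      then obtain x r \<tau> where z: "z = ((x, r), \<tau>)" "x \<in> standard_simplex n" "r \<in> {0..1}" "\<tau> \<in> {0..1}"
        by auto
      have "(\<lambda>j. (1 - \<tau>) * ?e j + \<tau> * x j) \<in> standard_simplex n"
        using z by (intro convex_standard_simplex[OF e]) auto
      moreover have "\<tau> * r \<in> {0..1}" using z by (auto intro: mult_le_one)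
      ultimately show "?H z \<in> ?Z" unfolding z(1) by simp
    qed
    ultimately show ?thesis
      unfolding cylinder_top_of_set
      by (simp only: continuous_map_subtopology_eu continuous_map_in_subtopology continuous_map_iff_continuous
          topspace_euclidean_subtopology)
  qed
  moreover have "(?e, 0) \<in> topspace (top_of_set ?Z)" using e by simp
  moreover have "?H (k, 0) = (?e, 0)" for k by auto
  moreover have "?H (k, 1) = k" for k by auto
  ultimately show ?thesis
  proof (rule lift_contractible[OF _ _ _ _ _ continuous_adjoint_LN[OF t]])
    fix F assume F: "continuous_map (top_of_set ?Z) T F"
      "\<And>k. k \<in> topspace (top_of_set ?Z) \<Longrightarrow> orb (F k) = (\<lambda>(x, r). t x r) k"
    have "orb (F (x, r)) = t x r" if "x \<in> standard_simplex n" "r \<in> {0..1}" for x r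
      using F(2)[of "(x, r)"] that by simp
    from lift_sing[OF t F(1) this] show "\<exists>s\<in>sing PG n. compose (standard_simplex n) ptilde s = t"
      by blast
  qed
qed

abbreviation "PGact \<equiv> PG_act G act"

lemma PG_act_eval: "r \<in> {0..1} \<Longrightarrow> fst (PGact h z) r = act h (fst z r)"
  by (simp add: PG_act_def case_prod_unfold compose_def)

lemma PG_act_mem:
  assumes h: "h \<in> carrier G" and z: "z \<in> pts PG"
  shows "PGact h z \<in> pts PG"
proof -
  note z' = PG_mem[OF z]
  have z0: "fst z 0 \<in> topspace T" by (rule z'(5)) simp
  have "smooth unit_interval M (fst (PGact h z))"
    unfolding smooth_def
  proof (intro conjI allI impI)
    show "fst (PGact h z) \<in> pts unit_interval \<rightarrow> pts M"
      unfolding pts_unit_interval pts_manifold_diff using z'(5) act_in[OF h] by (simp add: PG_act_eval)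
    fix k U \<tau> assume \<tau>: "plot unit_interval k U \<tau>"
    have "plot M k U (fst z \<circ> \<tau>)" using z'(3) \<tau> unfolding smooth_def by blast
    then have "plot M k U (act h \<circ> (fst z \<circ> \<tau>))" using smooth_act[OF h] unfolding smooth_def by blast
    then show "plot M k U (fst (PGact h z) \<circ> \<tau>)"
      by (rule plot_manifold_cong) (use \<tau> in \<open>simp add: plot_unit_interval PG_act_eval Pi_iff\<close>)
  qed
  moreover have "snd (PGact h z) = h \<otimes>\<^bsub>G\<^esub> snd z \<otimes>\<^bsub>G\<^esub> inv\<^bsub>G\<^esub> h"
    by (simp add: PG_act_def case_prod_unfold)
  moreover have "fst (PGact h z) \<in> extensional {0..1}"
    by (simp add: PG_act_def case_prod_unfold)
  moreover have "fst (PGact h z) 1 = act (h \<otimes>\<^bsub>G\<^esub> snd z \<otimes>\<^bsub>G\<^esub> inv\<^bsub>G\<^esub> h) (fst (PGact h z) 0)"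
  proof -
    have "act (h \<otimes>\<^bsub>G\<^esub> snd z \<otimes>\<^bsub>G\<^esub> inv\<^bsub>G\<^esub> h) (act h (fst z 0)) = act (h \<otimes>\<^bsub>G\<^esub> snd z \<otimes>\<^bsub>G\<^esub> inv\<^bsub>G\<^esub> h \<otimes>\<^bsub>G\<^esub> h) (fst z 0)"
      using h z'(1) z0 by (simp add: act_mult)
    also have "h \<otimes>\<^bsub>G\<^esub> snd z \<otimes>\<^bsub>G\<^esub> inv\<^bsub>G\<^esub> h \<otimes>\<^bsub>G\<^esub> h = h \<otimes>\<^bsub>G\<^esub> snd z"
      using h z'(1) by (simp add: G.m_assoc)
    also have "act (h \<otimes>\<^bsub>G\<^esub> snd z) (fst z 0) = act h (fst z 1)"
      using h z'(1) z0 by (simp add: act_mult z'(4))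
    finally show ?thesis by (simp add: PG_act_eval)
  qed
  ultimately show ?thesis
    unfolding pts_PG pts_twisted using h z'(1) by simp
qed

lemma PG_act_one: "z \<in> pts PG \<Longrightarrow> PGact \<one>\<^bsub>G\<^esub> z = z"
  by (rule PG_eqI) (simp_all add: PG_act_mem PG_act_eval act_one PG_mem(5))

lemma PG_act_mult:
  assumes "h \<in> carrier G" "k \<in> carrier G" "z \<in> pts PG"
  shows "PGact (h \<otimes>\<^bsub>G\<^esub> k) z = PGact h (PGact k z)"
  by (rule PG_eqI) (use assms in \<open>simp_all add: PG_act_mem PG_act_eval act_mult PG_mem(5)\<close>)

lemma ptilde_act:
  assumes "h \<in> carrier G" "z \<in> pts PG"
  shows "ptilde (PGact h z) = ptilde z"
proof (rule extensionalityI)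
  show "ptilde (PGact h z) r = ptilde z r" if "r \<in> {0..1}" for r
    using that assms by (simp add: ptilde_eval PG_act_eval orb_act PG_mem(5))
qed (simp_all add: ptilde_apply)

lemma plot_LN_cong:
  assumes P: "plot LN m U P" and eq: "\<And>u. u \<in> U \<Longrightarrow> P u = P' u"
  shows "plot LN m U P'"
  unfolding plot_LN_iff
proof (intro conjI ballI allI impI)
  show "openin (Euclidean_space m) U" using P unfolding plot_LN_iff by blast
  show "P' u \<in> pts LN" if "u \<in> U" for u
    using P that eq[OF that] unfolding plot_LN_iff by auto
  fix k V p assume p: "plot (param_diff m U) k V p"
  have "plot N k V (\<lambda>w. P (fst (p w)) (snd (p w)))"
    using P p unfolding plot_LN_iff by blast
  then show "plot N k V (\<lambda>w. P' (fst (p w)) (snd (p w)))"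
    unfolding quotient_diff_def
    by (rule plot_manifold_cong) (use p eq in \<open>simp add: plot_param\<close>)
qed

lemma ptilde_sing:
  assumes s: "s \<in> sing PG n"
  shows "compose (standard_simplex n) ptilde s \<in> sing LN n"
  unfolding sing_def smooth_def pts_std_simplex
proof (intro CollectI conjI allI impI)
  show "compose (standard_simplex n) ptilde s \<in> standard_simplex n \<rightarrow> pts LN"
    using ptilde_mem[OF sing_mem[OF s]] by (auto simp: compose_def)
  fix m U q assume q: "plot (std_simplex n) m U q"
  have "plot LN m U (ptilde \<circ> (\<lambda>u. s (q u)))"
    using smooth_ptilde sing_plot[OF s q] unfolding smooth_def by blast
  then show "plot LN m U (compose (standard_simplex n) ptilde s \<circ> q)"
    by (rule plot_LN_cong) (simp add: compose_def plot_std_simplex_mem[OF q])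
qed simp

text \<open>The translate of a smooth simplex is a continuous lift of the same simplex of loops.\<close>

lemma PG_act_sing:
  assumes h: "h \<in> carrier G" and s: "s \<in> sing PG n"
  shows "compose (standard_simplex n) (PGact h) s \<in> sing PG n"
proof (rule sing_PG_if_continuous)
  show "compose (standard_simplex n) (PGact h) s x \<in> pts PG" if "x \<in> standard_simplex n" for x
    using that PG_act_mem[OF h sing_mem[OF s]] by (simp add: compose_def)
  have "compose (standard_simplex n) ptilde (compose (standard_simplex n) (PGact h) s) = compose (standard_simplex n) ptilde s"
    using ptilde_act[OF h sing_mem[OF s]] by (auto simp: compose_def fun_eq_iff)
  then show "compose (standard_simplex n) ptilde (compose (standard_simplex n) (PGact h) s) \<in> sing LN n"
    using ptilde_sing[OF s] by simp
  show "continuous_map (top_of_set (standard_simplex n \<times> {0..1})) T (\<lambda>(x, r). fst (compose (standard_simplex n) (PGact h) s x) r)"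
    by (rule continuous_map_eq[OF continuous_map_compose[OF continuous_adjoint_PG[OF s] continuous_act[OF h]]])
      (auto simp: compose_def[of "standard_simplex n"] PG_act_eval)
qed simp

lemma continuous_vertex_map: "continuous_on S (vertex_map m a)"
proof (rule continuous_on_coordinatewise_then_product)
  show "continuous_on S (\<lambda>x. vertex_map m a x j)" for j
    unfolding vertex_map_def by (intro continuous_on_sum continuous_on_coordinate)
qed

text \<open>
  Vertex maps are continuous for the Euclidean topology, so the face is a continuous lift of a
  simplex of loops that is smooth by assumption.
\<close>

lemma PG_lift_face:
  assumes a: "a \<in> {..m::nat} \<rightarrow> {..n::nat}" and s: "s \<in> sing PG n"
    and down: "compose (standard_simplex m) (compose (standard_simplex n) ptilde s) (vertex_map m a) \<in> sing LN m"
  shows "compose (standard_simplex m) s (vertex_map m a) \<in> sing PG m"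
proof (rule sing_PG_if_continuous)
  note v = vertex_map_simplex[OF a]
  show "compose (standard_simplex m) s (vertex_map m a) x \<in> pts PG" if "x \<in> standard_simplex m" for x
    using that sing_mem[OF s v] by (simp add: compose_def)
  have "compose (standard_simplex m) ptilde (compose (standard_simplex m) s (vertex_map m a))
      = compose (standard_simplex m) (compose (standard_simplex n) ptilde s) (vertex_map m a)"
    using v by (auto simp: compose_def fun_eq_iff)
  then show "compose (standard_simplex m) ptilde (compose (standard_simplex m) s (vertex_map m a)) \<in> sing LN m"
    using down by simp
  have "continuous_on (standard_simplex m \<times> {0..1::real}) (\<lambda>z. (vertex_map m a (fst z), snd z))"
    by (rule continuous_on_Pair[OF continuous_on_compose2[OF continuous_vertex_map continuous_on_fst[OF continuous_on_id] subset_refl]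
        continuous_on_snd[OF continuous_on_id]])
  then have "continuous_map (top_of_set (standard_simplex m \<times> {0..1::real})) (top_of_set (standard_simplex n \<times> {0..1}))
      (\<lambda>z. (vertex_map m a (fst z), snd z))"
    using v by auto
  from continuous_map_compose[OF this continuous_adjoint_PG[OF s]]
  show "continuous_map (top_of_set (standard_simplex m \<times> {0..1})) T (\<lambda>(x, r). fst (compose (standard_simplex m) s (vertex_map m a) x) r)"
    by (rule continuous_map_eq) (auto simp: compose_def)
qed simp

lemma PG_orbit:
  assumes s: "s \<in> sing PG n" and s': "s' \<in> sing PG n"
    and eq: "compose (standard_simplex n) ptilde s = compose (standard_simplex n) ptilde s'"
  shows "\<exists>h\<in>carrier G. s' = compose (standard_simplex n) (PGact h) s"
proof -
  obtain e where e: "e \<in> standard_simplex n" using nonempty_standard_simplex by blast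
  have "orb (fst (s x) r) = orb (fst (s' x) r)" if "x \<in> standard_simplex n" "r \<in> {0..1}" for x r
  proof -
    have "compose (standard_simplex n) ptilde s x r = compose (standard_simplex n) ptilde s' x r"
      by (simp only: eq)
    then show ?thesis using that by (simp add: compose_def[of "standard_simplex n"] ptilde_eval)
  qed
  note same = this
  obtain h where h: "h \<in> carrier G"
    "\<And>z. z \<in> standard_simplex n \<times> {0..1} \<Longrightarrow> (\<lambda>(x, r). fst (s' x) r) z = act h ((\<lambda>(x, r). fst (s x) r) z)"
  proof (rule lifts_differ_by_translate[OF connected_simplex_times_interval continuous_adjoint_PG[OF s] continuous_adjoint_PG[OF s']])
    show "(e, 0) \<in> topspace (top_of_set (standard_simplex n \<times> {0..1::real}))" using e by simp
    show "orb ((\<lambda>(x, r). fst (s x) r) z) = orb ((\<lambda>(x, r). fst (s' x) r) z)"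
      if "z \<in> topspace (top_of_set (standard_simplex n \<times> {0..1::real}))" for z
      using same that by auto
    fix h assume h: "h \<in> carrier G"
      and "\<And>z. z \<in> topspace (top_of_set (standard_simplex n \<times> {0..1::real})) \<Longrightarrow>
        (\<lambda>(x, r). fst (s' x) r) z = act h ((\<lambda>(x, r). fst (s x) r) z)"
    then have "\<And>z. z \<in> standard_simplex n \<times> {0..1} \<Longrightarrow> (\<lambda>(x, r). fst (s' x) r) z = act h ((\<lambda>(x, r). fst (s x) r) z)"
      by simp
    then show thesis by (rule that[OF h])
  qed
  have "s' = compose (standard_simplex n) (PGact h) s"
  proof (rule extensionalityI[OF sing_extensional[OF s'] compose_extensional])
    fix x assume x: "x \<in> standard_simplex n"
    have "s' x = PGact h (s x)"
    proof (rule PG_eqI[OF sing_mem[OF s' x] PG_act_mem[OF h(1) sing_mem[OF s x]]])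
      show "fst (s' x) r = fst (PGact h (s x)) r" if "r \<in> {0..1}" for r
        using h(2)[of "(x, r)"] x that by (simp add: PG_act_eval)
    qed
    then show "s' x = compose (standard_simplex n) (PGact h) s x"
      using x by (simp add: compose_def)
  qed
  with h(1) show ?thesis by blast
qed

theorem H_pullback_ptilde_iso: "H_pullback PG ptilde \<in> galgebra_iso (H_DR LN) (cotensor G PG PGact)"
proof -
  interpret simplicial_quotient G PG LN PGact ptilde
    by (rule simplicial_quotient.intro[OF group_G finite_group ptilde_sing PG_act_sing PG_act_one PG_act_mult
          ptilde_act lift_exists PG_orbit PG_lift_face])
  show ?thesis by (rule H_pullback_iso)
qed

end

theorem theorem6p1:
  fixes G :: "('g, 'c) monoid_scheme"
    and T :: "'a topology"
    and \<A> :: "'a chart set"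
    and n :: nat
    and act :: "'g \<Rightarrow> 'a \<Rightarrow> 'a"
  assumes "smooth_manifold n T \<A>"
    and "group G" and "finite (carrier G)"
    and "group_action G (topspace T) act"
    and "\<And>g. g \<in> carrier G \<Longrightarrow>
           smooth (manifold_diff (topspace T) \<A>) (manifold_diff (topspace T) \<A>) (act g)"
    and "\<And>g x. g \<in> carrier G \<Longrightarrow> x \<in> topspace T \<Longrightarrow> act g x = x \<Longrightarrow> g = \<one>\<^bsub>G\<^esub>"
    and "simply_connected_top T"
  shows "smooth (PG_space G act (manifold_diff (topspace T) \<A>))
                (loop_space (quotient_diff G act T \<A>)) (p_tilde G act) \<and>
         H_pullback (PG_space G act (manifold_diff (topspace T) \<A>)) (p_tilde G act) \<in>
           galgebra_iso
             (H_DR (loop_space (quotient_diff G act T \<A>)))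
             (cotensor G (PG_space G act (manifold_diff (topspace T) \<A>)) (PG_act G act))"
proof -
  interpret manifold_action G T \<A> n act
    by (rule manifold_action.intro[OF assms(1-6)])
  show ?thesis
    using smooth_ptilde H_pullback_ptilde_iso by blast
qed

end
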